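(* Let $\mu_1\ge\mu_2\ge0$, $N>0$, $g_1,g_2\in L^\infty(0,\infty;H)$, $\mathfrak g_j=\sup_{t\ge0}|g_j(t)|/\nu^2$, $\mathfrak g^2=\mathfrak g_1^2+\mathfrak g_2^2$, and $N_*:=4C_L\mathfrak g$. Suppose $$\tfrac14N_*^2\nu\le\mu_1+\mu_2\le\tfrac14N^2\nu.$$ Let $(v_1,v_2)$ be the global strong solution of the symmetric nudging intertwinement $$\begin{aligned}\tfrac{dv_1}{dt}+\nu Av_1+B(v_1,v_1)&=g_1-\mu_1P_Nv_1+\mu_2P_Nv_2,\\ \tfrac{dv_2}{dt}+\nu Av_2+B(v_2,v_2)&=g_2+\mu_2P_Nv_1-\mu_1P_Nv_2,\end{aligned}$$ with arbitrary initial data $(v_0^1,v_0^2)\in V\times V$. If $|g_1(t)-g_2(t)|\to0$ as $t\to\infty$, then $|v_1(t)-v_2(t)|\to0$ as $t\to\infty$.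
   Context: Let $\Omega=[0,2\pi]^2$ with periodic boundary conditions. $H$ is the space of $2\pi$-periodic, divergence-free, mean-free vector fields in $L^2(\Omega)^2$, with inner product $(u,v)=\int_\Omega u\cdot v\,dx$ and norm $|u|=(u,u)^{1/2}$; $V$ is the subspace of $H$ consisting of fields in $H^1$, with norm $\|u\|=|\nabla u|$. $\mathbb P$ is the Leray projection, $A=-\mathbb P\Delta$ is the Stokes operator with domain $D(A)$, and $B(u,v)=\mathbb P((u\cdot\nabla)v)$. For real $N>0$, $P_N$ is the orthogonal projection onto the Fourier modes with wavenumbers $k\in\mathbb Z^2\setminus\{0\}$, $|k|\le N$, and $Q_N=I-P_N$. $\nu>0$ is the viscosity. $C_L,C_A,C_S$ are absolute constants such that $\|u\|_{L^4}^2\le C_L\|u\||u|$, $\|u\|_{L^\infty}^2\le C_A|Au||u|$ and $\|P_Nu\|_{L^\infty}\le C_S(\ln N)^{1/2}\|P_Nu\|$. Global strong solution: $v_j\in C([0,T];V)\cap L^2(0,T;D(A))$ for every $T>0$. *)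

theory Defs
  imports "HOL-Analysis.Analysis"
begin

text \<open>Vector fields on the torus [0,2pi]^2 (only their values on the box matter);
  wavenumbers are pairs of integers.\<close>
type_synonym vf = "real \<times> real \<Rightarrow> real \<times> real"
type_synonym wn = "int \<times> int"

definition Om :: "(real \<times> real) set" where
  "Om = {0..2*pi} \<times> {0..2*pi}"

definition ex :: "wn \<Rightarrow> real \<times> real \<Rightarrow> complex" where
  "ex k x = cis (of_int (fst k) * fst x + of_int (snd k) * snd x)"

text \<open>Fourier coefficients: u(x) = sum_k (fc u k) e^{i k.x}.\<close>
definition fcs :: "(real \<times> real \<Rightarrow> real) \<Rightarrow> wn \<Rightarrow> complex" where
  "fcs f k = (LINT x:Om|lborel. complex_of_real (f x) * cnj (ex k x)) / complex_of_real (4 * pi^2)"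

definition fc :: "vf \<Rightarrow> wn \<Rightarrow> complex \<times> complex" where
  "fc u k = (fcs (\<lambda>x. fst (u x)) k, fcs (\<lambda>x. snd (u x)) k)"

definition cmul :: "complex \<Rightarrow> complex \<times> complex \<Rightarrow> complex \<times> complex" where
  "cmul c p = (c * fst p, c * snd p)"

definition ksq :: "wn \<Rightarrow> real" where
  "ksq k = (of_int (fst k))^2 + (of_int (snd k))^2"

definition L2 :: "vf \<Rightarrow> bool" where
  "L2 u \<longleftrightarrow> set_borel_measurable lborel Om u \<and> set_integrable lborel Om (\<lambda>x. (norm (u x))^2)"

text \<open>The space H: square integrable, mean-free, divergence-free (k . u_k = 0).\<close>
definition Hsp :: "vf \<Rightarrow> bool" where
  "Hsp u \<longleftrightarrow> L2 u \<and> fc u (0,0) = (0,0) \<and>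
     (\<forall>k. of_int (fst k) * fst (fc u k) + of_int (snd k) * snd (fc u k) = 0)"

definition Hnorm :: "vf \<Rightarrow> real" where
  "Hnorm u = sqrt (LINT x:Om|lborel. (norm (u x))^2)"

text \<open>V = H \<inter> H^1 (periodic H^1 via Fourier coefficients), norm |grad u|.\<close>
definition Vsp :: "vf \<Rightarrow> bool" where
  "Vsp u \<longleftrightarrow> Hsp u \<and> (\<lambda>k. ksq k * (norm (fc u k))^2) summable_on UNIV"

definition Vnorm :: "vf \<Rightarrow> real" where
  "Vnorm u = sqrt (4 * pi^2 * (\<Sum>\<^sub>\<infinity>k. ksq k * (norm (fc u k))^2))"

definition DA :: "vf \<Rightarrow> bool" where
  "DA u \<longleftrightarrow> Hsp u \<and> (\<lambda>k. (ksq k)^2 * (norm (fc u k))^2) summable_on UNIV"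

definition Anorm :: "vf \<Rightarrow> real" where
  "Anorm u = sqrt (4 * pi^2 * (\<Sum>\<^sub>\<infinity>k. (ksq k)^2 * (norm (fc u k))^2))"

text \<open>Fourier coefficients of the Stokes operator A = -P Delta.\<close>
definition Ac :: "vf \<Rightarrow> wn \<Rightarrow> complex \<times> complex" where
  "Ac u k = cmul (complex_of_real (ksq k)) (fc u k)"

definition L4norm :: "vf \<Rightarrow> real" where
  "L4norm u = (LINT x:Om|lborel. (norm (u x))^4) powr (1/4)"

definition d1 :: "vf \<Rightarrow> vf" where
  "d1 u = (SOME w. L2 w \<and> (\<forall>k. fc w k = cmul (\<i> * of_int (fst k)) (fc u k)))"

definition d2 :: "vf \<Rightarrow> vf" where
  "d2 u = (SOME w. L2 w \<and> (\<forall>k. fc w k = cmul (\<i> * of_int (snd k)) (fc u k)))"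

definition adv :: "vf \<Rightarrow> vf \<Rightarrow> vf" where
  "adv u v x = (fst (u x) * fst (d1 v x) + snd (u x) * fst (d2 v x),
                fst (u x) * snd (d1 v x) + snd (u x) * snd (d2 v x))"

definition leray :: "wn \<Rightarrow> complex \<times> complex \<Rightarrow> complex \<times> complex" where
  "leray k c = (if k = (0,0) then (0,0) else
     c - cmul ((of_int (fst k) * fst c + of_int (snd k) * snd c) / complex_of_real (ksq k))
              (of_int (fst k), of_int (snd k)))"

definition Bc :: "vf \<Rightarrow> vf \<Rightarrow> wn \<Rightarrow> complex \<times> complex" where
  "Bc u v k = leray k (fc (adv u v) k)"

definition PN :: "real \<Rightarrow> vf \<Rightarrow> vf" where
  "PN N u x = (Re (\<Sum>k\<in>{k. k \<noteq> (0,0) \<and> sqrt (ksq k) \<le> N}. fst (fc u k) * ex k x),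
               Re (\<Sum>k\<in>{k. k \<noteq> (0,0) \<and> sqrt (ksq k) \<le> N}. snd (fc u k) * ex k x))"

text \<open>g \<in> L^\<infinity>(0,\<infinity>;H) (H-valued on [0,\<infinity>), bounded, weakly = strongly measurable).\<close>
definition Linf :: "(real \<Rightarrow> vf) \<Rightarrow> bool" where
  "Linf g \<longleftrightarrow> (\<forall>t\<ge>0. Hsp (g t)) \<and> bdd_above ((\<lambda>t. Hnorm (g t)) ` {0..}) \<and>
     (\<forall>k. (\<lambda>t. fc (g t) k) \<in> borel_measurable (restrict_space lborel {0..}))"

definition gfrak :: "(real \<Rightarrow> vf) \<Rightarrow> real \<Rightarrow> real" where
  "gfrak g nu = (SUP t\<in>{0..}. Hnorm (g t)) / nu^2"

definition strong_class :: "(real \<Rightarrow> vf) \<Rightarrow> bool" where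
  "strong_class v \<longleftrightarrow> (\<forall>t\<ge>0. Vsp (v t)) \<and>
     (\<forall>t\<ge>0. ((\<lambda>s. Vnorm (v s - v t)) \<longlongrightarrow> 0) (at t within {0..})) \<and>
     (\<forall>T\<ge>0. (AE t in lborel. t \<in> {0..T} \<longrightarrow> DA (v t)) \<and>
              set_nn_integral lborel {0..T} (\<lambda>t. ennreal ((Anorm (v t))^2)) < \<infinity>)"

text \<open>Global strong solution of the symmetric nudging intertwinement; the equations
  are imposed mode by mode in integrated form on [0,t] for every t \<ge> 0.\<close>
definition sym_nudge_sol ::
  "real \<Rightarrow> real \<Rightarrow> real \<Rightarrow> real \<Rightarrow> (real \<Rightarrow> vf) \<Rightarrow> (real \<Rightarrow> vf) \<Rightarrow> (real \<Rightarrow> vf) \<Rightarrow> (real \<Rightarrow> vf) \<Rightarrow> bool"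
  where
  "sym_nudge_sol nu mu1 mu2 N g1 g2 v1 v2 \<longleftrightarrow> strong_class v1 \<and> strong_class v2 \<and>
    (\<forall>t\<ge>0. \<forall>k.
      ((\<lambda>s. - cmul (complex_of_real nu) (Ac (v1 s) k) - Bc (v1 s) (v1 s) k + fc (g1 s) k
            - cmul (complex_of_real mu1) (fc (PN N (v1 s)) k)
            + cmul (complex_of_real mu2) (fc (PN N (v2 s)) k))
        has_integral (fc (v1 t) k - fc (v1 0) k)) {0..t} \<and>
      ((\<lambda>s. - cmul (complex_of_real nu) (Ac (v2 s) k) - Bc (v2 s) (v2 s) k + fc (g2 s) k
            + cmul (complex_of_real mu2) (fc (PN N (v1 s)) k)
            - cmul (complex_of_real mu1) (fc (PN N (v2 s)) k))
        has_integral (fc (v2 t) k - fc (v2 0) k)) {0..t})"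

end

theory Submission
  imports Defs
begin

text \<open>
  Let \<open>w = v\<^sub>1 - v\<^sub>2\<close> and \<open>M = \<mu>\<^sub>1 + \<mu>\<^sub>2\<close>. Testing the difference of the two equations with \<open>w\<close>, the only
  nonlinear contribution is \<open>((w \<cdot> \<nabla>) v\<^sub>1, w)\<close>, bounded by \<open>C\<^sub>L |w| \<parallel>w\<parallel> \<parallel>v\<^sub>1\<parallel>\<close>; the damping acts
  on the low modes only, but \<open>|Q\<^sub>N w| \<le> \<parallel>w\<parallel> / N\<close> and \<open>M \<le> N\<^sup>2 \<nu> / 4\<close> let the viscosity take care of
  the high ones. This gives \<open>(|w|\<^sup>2)' \<le> - \<alpha> |w|\<^sup>2 + (4 / \<nu>) |g\<^sub>1 - g\<^sub>2|\<^sup>2\<close> with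
  \<open>\<alpha> = \<nu> / 4 + 2 M - C\<^sub>L\<^sup>2 \<parallel>v\<^sub>1\<parallel>\<^sup>2 / \<nu>\<close>. In the sum of the two energy equalities the coupling is dissipative
  because \<open>\<mu>\<^sub>1 \<ge> \<mu>\<^sub>2\<close>; hence the energies stay bounded and the time averages of \<open>\<parallel>v\<^sub>1\<parallel>\<^sup>2\<close> are
  controlled by the forcing, so that the lower bound on \<open>M\<close> gives
  \<open>\<integral>\<^sub>s\<^sup>t \<alpha> \<ge> (\<nu> / 4) (t - s) - K\<close>, and Gronwall's inequality concludes.

  The equations are only given mode by mode in integrated form. They are summed by Parseval's
  identity and dominated convergence in time, with the square integrability of \<open>|A v\<^sub>j|\<close> as majorant;
  for fields in \<open>D(A)\<close> the Fourier series converges absolutely, which reduces \<open>((u \<cdot> \<nabla>) w, w) = 0\<close>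
  to an identity for each Fourier mode of \<open>u\<close>.
\<close>

section \<open>Square integrable functions on the torus\<close>

text \<open>Three features of the formulation shape the work. The derivative fields
  \<open>d1\<close> and \<open>d2\<close> are chosen by \<open>SOME\<close> from their Fourier
  coefficients, so their existence rests on Riesz-Fischer, and computing with them requires that
  coefficients determine a function almost everywhere; completeness of the modes serves this. The
  solution lies in \<open>D(A)\<close> only for almost every time, so every energy balance carries a
  negligible exceptional set off which the rates are estimated. The sign of \<alpha> is not
  controlled pointwise: the V-norm of \<open>v1\<close> may be large at some times, and only its
  time average is bounded, with an additive constant independent of the starting time. An
  integrating factor copes with this, and the comparison may start so late that the forcing
  difference is already small. Energies are kept as sums of squared coefficients, that is, as
  squared norms divided by \<open>4 * pi^2\<close>.\<close>

definition torus :: "(real \<times> real) measure" where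
  "torus = restrict_space lborel Om"

lemma Om_eq_cbox: "Om = cbox (0, 0) (2 * pi, 2 * pi)"
  by (auto simp: Om_def)

lemma Om_sets [measurable]: "Om \<in> sets borel"
  by (simp add: Om_eq_cbox)

lemma space_torus [simp]: "space torus = Om"
  by (simp add: torus_def space_restrict_space)

lemma set_integral_Om: "(LINT x:Om|lborel. f x) = integral\<^sup>L torus f"
  for f :: "real \<times> real \<Rightarrow> 'a::{banach, second_countable_topology}"
  unfolding torus_def set_lebesgue_integral_def
  by (subst integral_restrict_space) auto

lemma set_integrable_Om: "set_integrable lborel Om f \<longleftrightarrow> integrable torus f"
  for f :: "real \<times> real \<Rightarrow> 'a::{banach, second_countable_topology}"
  unfolding torus_def set_integrable_def
  by (subst integrable_restrict_space) auto

lemma set_borel_measurable_Om: "set_borel_measurable lborel Om f \<longleftrightarrow> f \<in> borel_measurable torus"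
  for f :: "real \<times> real \<Rightarrow> 'a::real_normed_vector"
  unfolding torus_def set_borel_measurable_def
  by (subst borel_measurable_restrict_space_iff) auto

lemma measurable_torusI: "f \<in> borel_measurable borel \<Longrightarrow> f \<in> borel_measurable torus"
  unfolding torus_def by (rule measurable_restrict_space1) simp

lemma emeasure_torus: "emeasure torus Om = ennreal (4 * pi\<^sup>2)"
proof -
  have "emeasure lborel Om = emeasure (lborel \<Otimes>\<^sub>M lborel) ({0..2*pi} \<times> {0..2*pi})"
    by (simp add: Om_def lborel_prod)
  also have "\<dots> = ennreal (2 * pi) * ennreal (2 * pi)"
    by (subst lborel.emeasure_pair_measure_Times) auto
  also have "\<dots> = ennreal (4 * pi\<^sup>2)"
    by (simp add: power2_eq_square flip: ennreal_mult')
  finally show ?thesis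
    unfolding torus_def by (subst emeasure_restrict_space) auto
qed

interpretation torus: finite_measure torus
  by standard (simp add: emeasure_torus)

lemma measure_torus [simp]: "measure torus Om = 4 * pi\<^sup>2"
  by (simp add: emeasure_torus measure_def)

lemma integrable_torus_bounded:
  fixes f :: "real \<times> real \<Rightarrow> 'a::{banach, second_countable_topology}"
  assumes "f \<in> borel_measurable torus" "\<And>x. norm (f x) \<le> B"
  shows "integrable torus f"
  using assms by (intro torus.integrable_const_bound[where B = B]) auto

text \<open>Polymorphic in the codomain, so that real components, complex integrands and whole
  vector fields share one theory.\<close>

definition sqint :: "(real \<times> real \<Rightarrow> 'a::{banach, second_countable_topology}) \<Rightarrow> bool" where
  "sqint f \<longleftrightarrow> f \<in> borel_measurable torus \<and> integrable torus (\<lambda>x. (norm (f x))\<^sup>2)"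

lemma L2_iff_sqint: "L2 u \<longleftrightarrow> sqint u"
  by (simp add: L2_def sqint_def set_borel_measurable_Om set_integrable_Om)

lemma sqint_measurable: "sqint f \<Longrightarrow> f \<in> borel_measurable torus"
  by (simp add: sqint_def)

lemma sqint_norm_le:
  assumes g: "sqint g" and f: "f \<in> borel_measurable torus"
    and le: "AE x in torus. norm (f x) \<le> C * norm (g x)"
  shows "sqint f"
proof -
  have 1: "integrable torus (\<lambda>x. C\<^sup>2 * (norm (g x))\<^sup>2)"
    using g by (auto simp: sqint_def)
  have 2: "AE x in torus. norm ((norm (f x))\<^sup>2) \<le> norm (C\<^sup>2 * (norm (g x))\<^sup>2)"
    using le
  proof eventually_elim
    case (elim x)
    then have "(norm (f x))\<^sup>2 \<le> (C * norm (g x))\<^sup>2"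
      by (intro power_mono) auto
    then show ?case by (simp add: power_mult_distrib)
  qed
  have 3: "(\<lambda>x. (norm (f x))\<^sup>2) \<in> borel_measurable torus"
    using f by simp
  show ?thesis
    using f Bochner_Integration.integrable_bound[OF 1 3 2] by (simp add: sqint_def)
qed

lemma sqint_bounded:
  assumes f: "f \<in> borel_measurable torus" and le: "\<And>x. norm (f x) \<le> B"
  shows "sqint f"
proof -
  have "(norm (f x))\<^sup>2 \<le> B\<^sup>2" for x
    using le[of x] by (simp add: power_mono)
  then show ?thesis
    using f unfolding sqint_def by (auto intro!: integrable_torus_bounded[where B = "B\<^sup>2"])
qed

lemma norm_add_squared_le: "(norm (a + b))\<^sup>2 \<le> 2 * (norm a)\<^sup>2 + 2 * (norm b)\<^sup>2"
  for a b :: "'a::real_normed_vector"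
proof -
  have "(norm (a + b))\<^sup>2 \<le> (norm a + norm b)\<^sup>2"
    by (simp add: norm_triangle_ineq power_mono)
  also have "\<dots> \<le> 2 * (norm a)\<^sup>2 + 2 * (norm b)\<^sup>2"
    using sum_squares_bound[of "norm a" "norm b"] by (simp add: power2_sum)
  finally show ?thesis .
qed

lemma sqint_add:
  assumes "sqint f" "sqint g"
  shows "sqint (\<lambda>x. f x + g x)"
proof -
  have "integrable torus (\<lambda>x. 2 * (norm (f x))\<^sup>2 + 2 * (norm (g x))\<^sup>2)"
    using assms by (auto simp: sqint_def)
  then have "integrable torus (\<lambda>x. (norm (f x + g x))\<^sup>2)"
    using assms norm_add_squared_le
    by (elim Bochner_Integration.integrable_bound) (auto simp: sqint_def)
  then show ?thesis
    using assms by (auto simp: sqint_def)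
qed

lemma sqint_minus: "sqint f \<Longrightarrow> sqint (\<lambda>x. - f x)"
  by (auto simp: sqint_def)

lemma sqint_diff: "sqint f \<Longrightarrow> sqint g \<Longrightarrow> sqint (\<lambda>x. f x - g x)"
  using sqint_add[OF _ sqint_minus, of f g] by simp

lemma sqint_sum:
  assumes "\<And>i. i \<in> I \<Longrightarrow> sqint (f i)"
  shows "sqint (\<lambda>x. \<Sum>i\<in>I. f i x)"
  using assms
proof (induction I rule: infinite_finite_induct)
  case (insert a I)
  then show ?case using sqint_add[of "f a" "\<lambda>x. \<Sum>i\<in>I. f i x"] by simp
qed (auto simp: sqint_def)

lemma integrable_mult_sqint:
  fixes f g :: "real \<times> real \<Rightarrow> 'a::{banach, second_countable_topology, real_normed_algebra}"
  assumes "sqint f" "sqint g"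
  shows "integrable torus (\<lambda>x. f x * g x)"
proof (rule Bochner_Integration.integrable_bound)
  show "integrable torus (\<lambda>x. (norm (f x))\<^sup>2 + (norm (g x))\<^sup>2)"
    using assms by (auto simp: sqint_def)
  show "AE x in torus. norm (f x * g x) \<le> norm ((norm (f x))\<^sup>2 + (norm (g x))\<^sup>2)"
  proof (intro AE_I2)
    fix x
    have "norm (f x * g x) \<le> norm (f x) * norm (g x)" by (rule norm_mult_ineq)
    also have "\<dots> \<le> (norm (f x))\<^sup>2 + (norm (g x))\<^sup>2"
      using sum_squares_bound[of "norm (f x)" "norm (g x)"]
        mult_nonneg_nonneg[OF norm_ge_zero norm_ge_zero, of "f x" "g x"] by linarith
    finally show "norm (f x * g x) \<le> norm ((norm (f x))\<^sup>2 + (norm (g x))\<^sup>2)" by simp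
  qed
qed (use assms in \<open>auto simp: sqint_def\<close>)

lemma sqint_const: "sqint (\<lambda>x. c)"
  by (auto simp: sqint_def)

lemma sqint_imp_integrable: "sqint f \<Longrightarrow> integrable torus f"
proof -
  assume f: "sqint f"
  have "sqint (\<lambda>x. norm (f x))" using f by (auto simp: sqint_def)
  from integrable_mult_sqint[OF this sqint_const[of 1]]
  have "integrable torus (\<lambda>x. norm (f x))" by simp
  then show "integrable torus f"
    using f by (simp add: integrable_norm_iff sqint_def)
qed

lemma sqint_bounded_mult:
  fixes f g :: "real \<times> real \<Rightarrow> 'a::{banach, second_countable_topology, real_normed_algebra}"
  assumes g: "sqint g" and f: "f \<in> borel_measurable torus" and le: "AE x in torus. norm (f x) \<le> B"
  shows "sqint (\<lambda>x. f x * g x)"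
proof (rule sqint_norm_le[OF g])
  show "(\<lambda>x. f x * g x) \<in> borel_measurable torus"
    using f sqint_measurable[OF g] by auto
  show "AE x in torus. norm (f x * g x) \<le> B * norm (g x)"
    using le by eventually_elim (meson mult_right_mono norm_ge_zero norm_mult_ineq order_trans)
qed

lemma sqint_of_real: "sqint f \<Longrightarrow> sqint (\<lambda>x. complex_of_real (f x))"
  by (auto simp: sqint_def)

lemma borel_measurable_cnj [measurable]:
  "f \<in> borel_measurable M \<Longrightarrow> (\<lambda>x. cnj (f x)) \<in> borel_measurable M"
  by (rule measurable_compose[where g = cnj, OF _ borel_measurable_continuous_onI])
    (auto intro!: continuous_on_cnj continuous_on_id)

lemma sqint_cnj: "sqint f \<Longrightarrow> sqint (\<lambda>x. cnj (f x))"
  by (auto simp: sqint_def)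

lemma sqint_mult_left:
  fixes c :: "'a::{banach, second_countable_topology, real_normed_algebra}"
  shows "sqint f \<Longrightarrow> sqint (\<lambda>x. c * f x)"
  by (rule sqint_bounded_mult[where B = "norm c"]) auto

text \<open>The integral of \<open>(f + t * g)^2\<close> is a nonnegative quadratic in
  \<open>t\<close>, so its discriminant is not positive.\<close>

lemma integral_mult_squared_le:
  fixes f g :: "real \<times> real \<Rightarrow> real"
  assumes f: "sqint f" and g: "sqint g"
  shows "(\<integral>x. f x * g x \<partial>torus)\<^sup>2 \<le> (\<integral>x. (f x)\<^sup>2 \<partial>torus) * (\<integral>x. (g x)\<^sup>2 \<partial>torus)"
proof -
  let ?A = "\<integral>x. (f x)\<^sup>2 \<partial>torus" and ?B = "\<integral>x. f x * g x \<partial>torus" and ?C = "\<integral>x. (g x)\<^sup>2 \<partial>torus"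
  have [simp]: "integrable torus (\<lambda>x. (f x)\<^sup>2)" "integrable torus (\<lambda>x. (g x)\<^sup>2)"
    using f g by (auto simp: sqint_def)
  have [simp]: "integrable torus (\<lambda>x. f x * g x)"
    by (rule integrable_mult_sqint[OF f g])
  have q: "0 \<le> ?A + 2 * t * ?B + t\<^sup>2 * ?C" for t
  proof -
    have "0 \<le> (\<integral>x. (f x + t * g x)\<^sup>2 \<partial>torus)" by simp
    also have "\<dots> = (\<integral>x. (f x)\<^sup>2 + 2 * t * (f x * g x) + t\<^sup>2 * (g x)\<^sup>2 \<partial>torus)"
      by (simp add: power2_eq_square algebra_simps)
    also have "\<dots> = ?A + 2 * t * ?B + t\<^sup>2 * ?C"
      by simp
    finally show ?thesis .
  qed
  have "?C \<ge> 0" "?A \<ge> 0" by simp_all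
  show ?thesis
  proof (cases "?C = 0")
    case True
    have "?B = 0"
    proof (rule ccontr)
      assume B: "?B \<noteq> 0"
      \<comment> \<open>Without a quadratic term a nonzero slope is impossible: this
        \<open>t\<close> would bring the value to -1.\<close>
      have "0 \<le> ?A + 2 * (- (?A + 1) / (2 * ?B)) * ?B"
        using q[of "- (?A + 1) / (2 * ?B)"] unfolding True by simp
      also have "\<dots> = -1" using B by (simp add: field_simps)
      finally show False by simp
    qed
    then show ?thesis using True by simp
  next
    case False
    with \<open>?C \<ge> 0\<close> have "?C > 0" by linarith
    with q[of "- ?B / ?C"] show ?thesis
      by (simp add: field_simps power2_eq_square)
  qed
qed

section \<open>Fourier series on the torus\<close>

lemma borel_measurable_ex [measurable]: "ex k \<in> borel_measurable borel"
  unfolding ex_def[abs_def] cis_conv_exp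
  by (intro borel_measurable_continuous_onI continuous_intros)

lemma borel_measurable_ex_torus [measurable]: "ex k \<in> borel_measurable torus"
  by (rule measurable_torusI) simp

lemma norm_ex [simp]: "norm (ex k x) = 1"
  by (simp add: ex_def)

lemma ex_mult: "ex j x * ex k x = ex (j + k) x"
  by (simp add: ex_def cis_mult algebra_simps)

lemma cnj_ex: "cnj (ex k x) = ex (- k) x"
  by (simp add: ex_def cis_cnj algebra_simps)

lemma ex_zero [simp]: "ex 0 x = 1"
  by (simp add: ex_def)

lemma sqint_ex: "sqint (ex k)"
  by (rule sqint_bounded[where B = 1]) auto

section \<open>Orthogonality of the modes\<close>

lemma integral_torus_mult:
  fixes f g :: "real \<Rightarrow> complex"
  assumes f: "set_integrable lborel {0..2*pi} f" and g: "set_integrable lborel {0..2*pi} g"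
  shows "(\<integral>x. f (fst x) * g (snd x) \<partial>torus) = (LINT x:{0..2*pi}|lborel. f x) * (LINT x:{0..2*pi}|lborel. g x)"
proof -
  let ?f = "\<lambda>x. indicator {0..2*pi} x *\<^sub>R f x" and ?g = "\<lambda>x. indicator {0..2*pi} x *\<^sub>R g x"
  have fi: "integrable lborel ?f" and gi: "integrable lborel ?g"
    using f g by (simp_all add: set_integrable_def)
  have int: "integrable (lborel \<Otimes>\<^sub>M lborel) (\<lambda>(x, y). ?f x * ?g y)"
  proof (rule lborel_pair.Fubini_integrable)
    have [measurable]: "?f \<in> borel_measurable lborel" "?g \<in> borel_measurable lborel"
      using fi gi by auto
    show "(\<lambda>(x, y). ?f x * ?g y) \<in> borel_measurable (lborel \<Otimes>\<^sub>M lborel)"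
      by measurable
    show "integrable lborel (\<lambda>x. \<integral>y. norm (case (x, y) of (x, y) \<Rightarrow> ?f x * ?g y) \<partial>lborel)"
    proof -
      have eq: "(\<integral>y. norm (case (x, y) of (x, y) \<Rightarrow> ?f x * ?g y) \<partial>lborel) = norm (?f x) * (\<integral>y. norm (?g y) \<partial>lborel)" for x
        by (simp only: prod.case norm_mult integral_mult_right_zero)
      show ?thesis unfolding eq by (rule integrable_mult_left[OF integrable_norm[OF fi]])
    qed
    show "AE x in lborel. integrable lborel (\<lambda>y. case (x, y) of (x, y) \<Rightarrow> ?f x * ?g y)"
      unfolding prod.case by (intro AE_I2 integrable_mult_right gi)
  qed
  have "(\<integral>x. f (fst x) * g (snd x) \<partial>torus) = (\<integral>x. ?f (fst x) * ?g (snd x) \<partial>lborel)"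
    unfolding set_integral_Om[symmetric] set_lebesgue_integral_def
    by (intro Bochner_Integration.integral_cong) (auto simp: Om_def indicator_def)
  also have "\<dots> = (\<integral>x. (\<integral>y. ?f x * ?g y \<partial>lborel) \<partial>lborel)"
    unfolding lborel_prod[symmetric]
    by (subst lborel_pair.integral_fst[OF int]) (simp add: case_prod_unfold)
  also have "\<dots> = (LINT x:{0..2*pi}|lborel. f x) * (LINT x:{0..2*pi}|lborel. g x)"
    by (simp only: set_lebesgue_integral_def integral_mult_right_zero integral_mult_left_zero)
  finally show ?thesis .
qed

lemma set_integral_cis:
  "(LINT x:{0..2*pi}|lborel. cis (of_int m * x)) = (if m = 0 then complex_of_real (2 * pi) else 0)"
proof (cases "m = 0")
  case True
  then show ?thesis by (simp add: set_lebesgue_integral_def scaleR_conv_of_real)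
next
  case False
  let ?F = "\<lambda>x. cis (of_int m * x) / (\<i> * of_int m)"
  have [simp]: "- (\<i> * (z * \<i>)) = z" for z
    by (simp add: mult.left_commute[of \<i> z \<i>])
  have "((\<lambda>x. cis (of_int m * x)) has_integral (?F (2 * pi) - ?F 0)) {0..2*pi}"
    by (intro fundamental_theorem_of_calculus)
      (use False in \<open>auto simp: cis_conv_exp intro!: derivative_eq_intros has_vector_derivative_real_field\<close>)
  \<comment> \<open>The antiderivative has period \<open>2 * pi\<close> because \<open>m\<close> is
    an integer.\<close>
  moreover have "?F (2 * pi) - ?F 0 = 0"
    using cis_multiple_2pi[of "of_int m"] by (simp add: mult_ac)
  moreover have "set_integrable lborel {0..2*pi} (\<lambda>x. cis (of_int m * x))"
    by (intro borel_integrable_atLeastAtMost') (auto simp: cis_conv_exp intro!: continuous_intros)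
  ultimately show ?thesis
    using False by (simp add: has_integral_iff set_borel_integral_eq_integral)
qed

lemma integral_ex: "(\<integral>x. ex k x \<partial>torus) = (if k = 0 then complex_of_real (4 * pi\<^sup>2) else 0)"
proof -
  have "set_integrable lborel {0..2*pi} (\<lambda>x. cis (of_int m * x))" for m
    by (intro borel_integrable_atLeastAtMost') (auto simp: cis_conv_exp intro!: continuous_intros)
  then have "(\<integral>x. cis (of_int (fst k) * fst x) * cis (of_int (snd k) * snd x) \<partial>torus) =
    (if k = 0 then complex_of_real (4 * pi\<^sup>2) else 0)"
    by (subst integral_torus_mult) (auto simp: set_integral_cis zero_prod_def power2_eq_square prod_eq_iff)
  then show ?thesis
    by (simp add: ex_def[abs_def] cis_mult)
qed

text \<open>\<open>fcs\<close> accepts real functions only; admitting complex ones allows products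
  with a mode, which merely shift the index (\<open>fcoef_ex_mult\<close>).\<close>

definition fcoef :: "(real \<times> real \<Rightarrow> complex) \<Rightarrow> wn \<Rightarrow> complex" where
  "fcoef f k = (\<integral>x. f x * cnj (ex k x) \<partial>torus) / complex_of_real (4 * pi\<^sup>2)"

lemma fcs_eq_fcoef: "fcs f k = fcoef (\<lambda>x. complex_of_real (f x)) k"
  by (simp add: fcs_def fcoef_def set_integral_Om)

lemma sqint_ex_mult: "sqint f \<Longrightarrow> sqint (\<lambda>x. ex k x * f x)"
  by (rule sqint_bounded_mult[where B = 1]) auto

lemma integrable_mult_ex: "integrable torus f \<Longrightarrow> integrable torus (\<lambda>x. f x * ex k x)"
  by (rule Bochner_Integration.integrable_bound[of torus f]) (auto simp: norm_mult)

lemma fcoef_add: "integrable torus f \<Longrightarrow> integrable torus g \<Longrightarrow>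
    fcoef (\<lambda>x. f x + g x) k = fcoef f k + fcoef g k"
  by (simp add: fcoef_def distrib_right cnj_ex integrable_mult_ex add_divide_distrib)

lemma fcoef_diff: "integrable torus f \<Longrightarrow> integrable torus g \<Longrightarrow>
    fcoef (\<lambda>x. f x - g x) k = fcoef f k - fcoef g k"
  by (simp add: fcoef_def left_diff_distrib cnj_ex integrable_mult_ex diff_divide_distrib)

lemma fcoef_cmult: "fcoef (\<lambda>x. c * f x) k = c * fcoef f k"
  by (simp add: fcoef_def mult.assoc)

lemma fcoef_sum:
  assumes "\<And>i. i \<in> I \<Longrightarrow> integrable torus (f i)"
  shows "fcoef (\<lambda>x. \<Sum>i\<in>I. f i x) k = (\<Sum>i\<in>I. fcoef (f i) k)"
  using assms by (simp add: fcoef_def sum_distrib_right cnj_ex integrable_mult_ex sum_divide_distrib)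

lemma fcoef_ex: "fcoef (ex j) k = (if j = k then 1 else 0)"
  by (simp add: fcoef_def cnj_ex ex_mult integral_ex)

lemma fcoef_ex_mult: "fcoef (\<lambda>x. ex k x * f x) m = fcoef f (m - k)"
proof -
  have eq: "ex k x * f x * ex (- m) x = f x * ex (- (m - k)) x" for x
    using ex_mult[of k x "- m"] by (simp add: mult_ac)
  show ?thesis unfolding fcoef_def cnj_ex eq ..
qed

text \<open>For real \<open>f\<close> this is the Hermitian symmetry of the coefficients, by which
  real fields are recognised later.\<close>

lemma fcoef_cnj: "fcoef (\<lambda>x. cnj (f x)) k = cnj (fcoef f (- k))"
proof -
  have "(\<integral>x. cnj (f x) * cnj (ex k x) \<partial>torus) = (\<integral>x. cnj (f x * ex k x) \<partial>torus)" by simp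
  also have "\<dots> = cnj (\<integral>x. f x * ex k x \<partial>torus)" by (rule Bochner_Integration.integral_cnj)
  finally show ?thesis by (simp add: fcoef_def cnj_ex)
qed

lemma fcoef_cong_AE:
  assumes "AE x in torus. f x = g x" "f \<in> borel_measurable torus" "g \<in> borel_measurable torus"
  shows "fcoef f k = fcoef g k"
  unfolding fcoef_def using assms by (auto intro!: arg_cong2[where f = "(/)"] integral_cong_AE)

definition trig_sum :: "(wn \<Rightarrow> complex) \<Rightarrow> wn set \<Rightarrow> real \<times> real \<Rightarrow> complex" where
  "trig_sum c K x = (\<Sum>k\<in>K. c k * ex k x)"

lemma sqint_trig_sum: "sqint (trig_sum c K)"
  unfolding trig_sum_def[abs_def] by (intro sqint_sum sqint_mult_left sqint_ex)

lemma fcoef_trig_sum: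
  assumes "finite K"
  shows "fcoef (trig_sum c K) k = (if k \<in> K then c k else 0)"
proof -
  have "fcoef (trig_sum c K) k = (\<Sum>j\<in>K. c j * fcoef (ex j) k)"
    unfolding trig_sum_def[abs_def]
    by (subst fcoef_sum) (auto simp: fcoef_cmult intro: sqint_imp_integrable sqint_mult_left sqint_ex)
  also have "\<dots> = (\<Sum>j\<in>K. if j = k then c j else 0)"
    by (rule sum.cong) (auto simp: fcoef_ex)
  finally show ?thesis using assms by simp
qed

lemma integral_mult_cnj_trig_sum:
  assumes "sqint f"
  shows "(\<integral>x. f x * cnj (trig_sum c K x) \<partial>torus) = 4 * pi\<^sup>2 * (\<Sum>k\<in>K. fcoef f k * cnj (c k))"
proof -
  have "(\<integral>x. f x * cnj (trig_sum c K x) \<partial>torus) = (\<integral>x. (\<Sum>k\<in>K. cnj (c k) * (f x * cnj (ex k x))) \<partial>torus)"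
    by (simp add: trig_sum_def sum_distrib_left mult_ac)
  also have "\<dots> = (\<Sum>k\<in>K. cnj (c k) * (\<integral>x. f x * cnj (ex k x) \<partial>torus))"
    using sqint_imp_integrable[OF assms] by (simp add: cnj_ex integrable_mult_ex)
  also have "\<dots> = 4 * pi\<^sup>2 * (\<Sum>k\<in>K. fcoef f k * cnj (c k))"
    by (simp add: fcoef_def sum_distrib_left mult_ac)
  finally show ?thesis .
qed

lemma integral_norm_trig_sum:
  assumes "finite K"
  shows "(\<integral>x. (norm (trig_sum c K x))\<^sup>2 \<partial>torus) = 4 * pi\<^sup>2 * (\<Sum>k\<in>K. (norm (c k))\<^sup>2)"
proof -
  have "complex_of_real (\<integral>x. (norm (trig_sum c K x))\<^sup>2 \<partial>torus) = (\<integral>x. trig_sum c K x * cnj (trig_sum c K x) \<partial>torus)"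
    unfolding integral_complex_of_real[symmetric] by (simp only: complex_norm_square)
  also have "\<dots> = 4 * pi\<^sup>2 * (\<Sum>k\<in>K. c k * cnj (c k))"
    by (simp add: integral_mult_cnj_trig_sum[OF sqint_trig_sum] fcoef_trig_sum[OF assms] cong: sum.cong)
  also have "\<dots> = complex_of_real (4 * pi\<^sup>2 * (\<Sum>k\<in>K. (norm (c k))\<^sup>2))"
    by (simp add: complex_norm_square of_real_power[symmetric] del: of_real_power)
  finally show ?thesis by (simp only: of_real_eq_iff)
qed

subsection \<open>Completeness of the trigonometric system\<close>

text \<open>The linear span of the modes. It is an algebra since the product of two modes is a mode,
  so every polynomial in a trigonometric polynomial stays inside; this lets polynomial approximation
  in one variable act on the torus.\<close>

inductive trigp :: "(real \<times> real \<Rightarrow> complex) \<Rightarrow> bool" where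
  mode: "trigp (\<lambda>x. c * ex k x)"
| add: "trigp f \<Longrightarrow> trigp g \<Longrightarrow> trigp (\<lambda>x. f x + g x)"

lemma trigp_const: "trigp (\<lambda>x. c)"
  using trigp.mode[of c 0] by simp

lemma trigp_mult:
  assumes "trigp f" "trigp g"
  shows "trigp (\<lambda>x. f x * g x)"
  using assms(1)
proof induction
  case f: (mode c k)
  show ?case using assms(2)
  proof induction
    case (mode d j)
    have eq: "c * ex k x * (d * ex j x) = (c * d) * ex (k + j) x" for x
      by (simp add: ex_mult[symmetric] mult_ac)
    show ?case unfolding eq by (rule trigp.mode)
  next
    case (add g h)
    then show ?case using trigp.add by (simp add: distrib_left)
  qed
next
  case (add g h)
  then show ?case using trigp.add by (simp add: distrib_right)
qed

lemma trigp_power: "trigp f \<Longrightarrow> trigp (\<lambda>x. f x ^ n)"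
  by (induction n) (auto intro: trigp_const trigp_mult)

lemma trigp_sum: "(\<And>i. i \<in> I \<Longrightarrow> trigp (f i)) \<Longrightarrow> trigp (\<lambda>x. \<Sum>i\<in>I. f i x)"
  by (induction I rule: infinite_finite_induct) (auto intro: trigp_const trigp.add)

lemma trigp_Bernstein:
  assumes "trigp (\<lambda>x. complex_of_real (q x))"
  shows "trigp (\<lambda>x. complex_of_real (\<Sum>k\<le>n. a k * Bernstein n k (q x)))"
proof -
  have 1: "trigp (\<lambda>x. 1 - complex_of_real (q x))"
    using trigp.add[OF trigp_const[of 1] trigp_mult[OF trigp_const[of "-1"] assms]] by simp
  have "trigp (\<lambda>x. \<Sum>k\<le>n. (complex_of_real (a k) * of_nat (n choose k)) *
      (complex_of_real (q x) ^ k * (1 - complex_of_real (q x)) ^ (n - k)))"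
    by (intro trigp_sum trigp_mult trigp_const trigp_power assms 1)
  then show ?thesis by (simp add: Bernstein_def mult_ac)
qed

text \<open>Integrability is part of the induction because the additive step splits the
  integral.\<close>

lemma integral_mult_trigp_eq_0:
  assumes f: "integrable torus f" and 0: "\<And>k. fcoef f k = 0" and "trigp p"
  shows "(\<integral>x. f x * p x \<partial>torus) = 0 \<and> integrable torus (\<lambda>x. f x * p x)"
  using assms(3)
proof induction
  case (mode c k)
  have "(\<integral>x. f x * ex k x \<partial>torus) = 0"
    using 0[of "- k"] by (simp add: fcoef_def cnj_ex)
  then show ?case
    using integrable_mult_ex[OF f, of k] by (simp add: mult.left_commute[of _ c])
next
  case (add p q)
  then show ?case by (simp add: distrib_left)
qed

text \<open>\<open>h n\<close> is the ramp of slope \<open>n\<close> starting at 1/2 and cut off at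
  1; a Bernstein polynomial within \<open>1 / (n + 1)\<close> of it is bounded by 2. Because the
  ramp starts at the threshold, the limit at 1/2 itself is 0, in agreement with the strict
  inequality that describes an open interval.\<close>

lemma polynomial_approx_step:
  obtains p :: "nat \<Rightarrow> real \<Rightarrow> real"
  where "\<And>n. \<exists>m a. p n = (\<lambda>y. \<Sum>k\<le>m. a k * Bernstein m k y)"
    and "\<And>n y. 0 \<le> y \<Longrightarrow> y \<le> 1 \<Longrightarrow> \<bar>p n y\<bar> \<le> 2"
    and "\<And>y. 0 \<le> y \<Longrightarrow> y \<le> 1 \<Longrightarrow> (\<lambda>n. p n y) \<longlonglongrightarrow> (if 1/2 < y then 1 else 0)"
proof -
  define h :: "nat \<Rightarrow> real \<Rightarrow> real" where "h n y = max 0 (min 1 (real n * (y - 1/2)))" for n y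
  have "\<exists>m. \<forall>y\<in>{0..1}. \<bar>h n y - (\<Sum>k\<le>m. h n (k / m) * Bernstein m k y)\<bar> < 1 / (real n + 1)" for n
  proof -
    have "continuous_on {0..1} (h n)"
      unfolding h_def by (intro continuous_intros)
    then obtain N where "\<And>k y. N \<le> k \<and> y \<in> {0..1} \<Longrightarrow>
        \<bar>h n y - (\<Sum>j\<le>k. h n (j / k) * Bernstein k j y)\<bar> < 1 / (real n + 1)"
      using Bernstein_Weierstrass[of "h n" "1 / (real n + 1)"] by (auto simp: field_simps)
    then show ?thesis by blast
  qed
  then obtain m where m: "\<And>n y. y \<in> {0..1} \<Longrightarrow>
      \<bar>h n y - (\<Sum>k\<le>m n. h n (k / m n) * Bernstein (m n) k y)\<bar> < 1 / (real n + 1)"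
    by metis
  define p where "p n y = (\<Sum>k\<le>m n. h n (k / m n) * Bernstein (m n) k y)" for n y
  have p: "\<bar>h n y - p n y\<bar> < 1 / (real n + 1)" if "0 \<le> y" "y \<le> 1" for n y
    using m[of y n] that by (simp add: p_def)
  show thesis
  proof (rule that[of p])
    show "\<exists>m a. p n = (\<lambda>y. \<Sum>k\<le>m. a k * Bernstein m k y)" for n
      unfolding p_def[abs_def] by (rule exI[of _ "m n"], rule exI[of _ "\<lambda>k. h n (real k / real (m n))"]) (rule refl)
  next
    fix n :: nat and y :: real assume y: "0 \<le> y" "y \<le> 1"
    have "0 \<le> h n y" "h n y \<le> 1" by (auto simp: h_def)
    moreover have "1 / (real n + 1) \<le> 1" by simp
    ultimately show "\<bar>p n y\<bar> \<le> 2"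
      using p[OF y, of n] by linarith
  next
    fix y :: real assume y: "0 \<le> y" "y \<le> 1"
    have 1: "(\<lambda>n. h n y) \<longlonglongrightarrow> (if 1/2 < y then 1 else 0)"
    proof (cases "1/2 < y")
      case True
      then obtain n0 where n0: "1 < real n0 * (y - 1/2)"
        using reals_Archimedean3[of "y - 1/2"] by auto
      have "h n y = 1" if "n \<ge> n0" for n
      proof -
        have "real n0 * (y - 1/2) \<le> real n * (y - 1/2)" using that True by (intro mult_right_mono) auto
        then show ?thesis using n0 by (auto simp: h_def)
      qed
      then have "eventually (\<lambda>n. h n y = 1) sequentially" by (auto simp: eventually_sequentially)
      then show ?thesis using True by (auto intro: tendsto_eventually)
    next
      case False
      then have "real n * (y - 1/2) \<le> 0" for n by (simp add: mult_nonneg_nonpos)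
      then have "h n y = 0" for n by (simp add: h_def max.absorb1 min.coboundedI2)
      then show ?thesis using False by simp
    qed
    have "(\<lambda>n. h n y - p n y) \<longlonglongrightarrow> 0"
    proof (rule Lim_null_comparison)
      show "eventually (\<lambda>n. norm (h n y - p n y) \<le> 1 / (real n + 1)) sequentially"
        using p[OF y] by (auto intro!: always_eventually less_imp_le)
      show "(\<lambda>n. 1 / (real n + 1)) \<longlonglongrightarrow> 0"
        using LIMSEQ_inverse_real_of_nat by (simp add: field_simps)
    qed
    from tendsto_diff[OF 1 this]
    show "(\<lambda>n. p n y) \<longlonglongrightarrow> (if 1/2 < y then 1 else 0)" by simp
  qed
qed

text \<open>An interval of the circle is the positivity set of a trigonometric polynomial of degree one.\<close>

definition arc :: "real \<Rightarrow> real \<Rightarrow> real \<Rightarrow> real" where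
  "arc a b t = (cos (t - (a + b) / 2) - cos ((b - a) / 2) + 2) / 4"

text \<open>A difference of two cosines lies in [-2, 2]. Adding 2 and dividing by 4 maps this range
  to [0, 1] and the value 0 to 1/2, which are the domain and the threshold of
  \<open>polynomial_approx_step\<close>.\<close>

lemma arc_bounds: "0 \<le> arc a b t" "arc a b t \<le> 1"
proof -
  have "0 \<le> (u - v + 2) / 4 \<and> (u - v + 2) / 4 \<le> 1" if "-1 \<le> u" "u \<le> 1" "-1 \<le> v" "v \<le> 1" for u v :: real
    using that by auto
  from this[of "cos (t - (a + b) / 2)" "cos ((b - a) / 2)"]
  show "0 \<le> arc a b t" "arc a b t \<le> 1" by (simp_all add: arc_def)
qed

text \<open>\<open>t\<close> lies in the interval iff its distance \<open>s\<close> from the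
  midpoint is below half the length, and the cosine decreases on \<open>[0, pi]\<close>.\<close>

lemma arc_gt_half_iff:
  assumes "0 \<le> a" "a < b" "b \<le> 2 * pi" "0 \<le> t" "t \<le> 2 * pi"
  shows "1/2 < arc a b t \<longleftrightarrow> a < t \<and> t < b"
proof -
  define s h where "s = \<bar>t - (a + b) / 2\<bar>" and "h = (b - a) / 2"
  have eq: "1/2 < arc a b t \<longleftrightarrow> cos h < cos s"
    by (auto simp: arc_def s_def h_def)
  have h: "0 < h" "h \<le> pi" and s: "0 \<le> s" "s \<le> 2 * pi - h"
    using assms by (auto simp: s_def h_def abs_le_iff field_simps)
  have iff: "a < t \<and> t < b \<longleftrightarrow> s < h"
    by (auto simp: s_def h_def abs_less_iff field_simps)
  show ?thesis
  proof (cases "s \<le> pi")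
    case True
    then show ?thesis using cos_mono_less_eq[of h s] h s unfolding eq iff by auto
  next
    case False
    \<comment> \<open>Beyond \<open>pi\<close> the cosine grows again, but the reflected distance
      \<open>2 * pi - s\<close> is still at least \<open>h\<close>, so both sides of the equivalence
      are false.\<close>
    have "cos s = cos (2 * pi - s)" by simp
    then have "cos h < cos s \<longleftrightarrow> 2 * pi - s < h"
      using cos_mono_less_eq[of h "2 * pi - s"] False h s by auto
    then show ?thesis unfolding eq iff using False h s by auto
  qed
qed

lemma trigp_arc:
  "trigp (\<lambda>x. complex_of_real (arc a b (fst x)))" "trigp (\<lambda>x. complex_of_real (arc a b (snd x)))"
proof -
  define m where "m = (a + b) / 2"
  have c: "complex_of_real (cos (t - m)) = cis (- m) / 2 * cis t + cis m / 2 * cis (- t)" for t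
    by (simp add: complex_eq_iff cos_diff field_simps)
  have e: "cis (fst x) = ex (1, 0) x" "cis (- fst x) = ex (-1, 0) x"
    "cis (snd x) = ex (0, 1) x" "cis (- snd x) = ex (0, -1) x" for x
    by (simp_all add: ex_def)
  have a: "complex_of_real (arc a b t) =
      (1/4) * (complex_of_real (cos (t - m)) + complex_of_real (2 - cos ((b - a) / 2)))" for t
    by (simp add: arc_def m_def)
  show "trigp (\<lambda>x. complex_of_real (arc a b (fst x)))" "trigp (\<lambda>x. complex_of_real (arc a b (snd x)))"
    unfolding a c e by (intro trigp_mult trigp_const trigp.add trigp.mode)+
qed

lemma AE_torus_fst: "AE x in torus. fst x \<noteq> c"
  and AE_torus_snd: "AE x in torus. snd x \<noteq> c"
proof -
  have "{c} \<times> (UNIV :: real set) \<in> null_sets (lborel \<Otimes>\<^sub>M lborel)"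
    "(UNIV :: real set) \<times> {c} \<in> null_sets (lborel \<Otimes>\<^sub>M lborel)"
    by (auto simp: null_sets_def lborel.emeasure_pair_measure_Times)
  then have 1: "AE x in lborel. x \<notin> {c} \<times> (UNIV :: real set)"
    and 2: "AE x in lborel. x \<notin> (UNIV :: real set) \<times> {c}"
    unfolding lborel_prod by (auto intro: AE_not_in)
  show "AE x in torus. fst x \<noteq> c"
    unfolding torus_def by (subst AE_restrict_space_iff) (use 1 in \<open>auto elim!: eventually_mono\<close>)
  show "AE x in torus. snd x \<noteq> c"
    unfolding torus_def by (subst AE_restrict_space_iff) (use 2 in \<open>auto elim!: eventually_mono\<close>)
qed

lemma indicator_measurable_torus:
  "A \<in> sets borel \<Longrightarrow> (\<lambda>x. indicator A x :: real) \<in> borel_measurable torus"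
  by (rule measurable_torusI) simp

text \<open>Products of the step polynomials evaluated at the two arcs are trigonometric
  polynomials, bounded by \<open>2 * 2\<close>, and converge on the torus to the indicator of the
  rectangle; \<open>f\<close> is orthogonal to all of them.\<close>

lemma integral_rectangle_eq_0:
  assumes f: "integrable torus f" and 0: "\<And>k. fcoef f k = 0"
    and ab: "0 \<le> a" "a < b" "b \<le> 2 * pi" and cd: "0 \<le> c" "c < d" "d \<le> 2 * pi"
  shows "(\<integral>x. indicator ({a<..<b} \<times> {c<..<d}) x *\<^sub>R f x \<partial>torus) = 0"
proof -
  obtain p :: "nat \<Rightarrow> real \<Rightarrow> real"
    where ber: "\<And>n. \<exists>m a. p n = (\<lambda>y. \<Sum>k\<le>m. a k * Bernstein m k y)"
      and b2: "\<And>n y. 0 \<le> y \<Longrightarrow> y \<le> 1 \<Longrightarrow> \<bar>p n y\<bar> \<le> 2"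
      and lim: "\<And>y. 0 \<le> y \<Longrightarrow> y \<le> 1 \<Longrightarrow> (\<lambda>n. p n y) \<longlonglongrightarrow> (if 1/2 < y then 1 else 0)"
    by (rule polynomial_approx_step) (rule that; assumption)
  let ?P = "\<lambda>n x. complex_of_real (p n (arc a b (fst x))) * complex_of_real (p n (arc c d (snd x)))"
  have tp: "trigp (?P n)" for n
  proof -
    obtain m a' where "p n = (\<lambda>y. \<Sum>k\<le>m. a' k * Bernstein m k y)"
      using ber by blast
    then show ?thesis
      by (simp only:) (intro trigp_mult trigp_Bernstein trigp_arc)
  qed
  have z: "(\<integral>x. f x * ?P n x \<partial>torus) = 0" and i: "integrable torus (\<lambda>x. f x * ?P n x)" for n
    using integral_mult_trigp_eq_0[OF f 0 tp] by auto
  have "(\<lambda>n. \<integral>x. f x * ?P n x \<partial>torus) \<longlonglongrightarrow> (\<integral>x. indicator ({a<..<b} \<times> {c<..<d}) x *\<^sub>R f x \<partial>torus)"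
  proof (rule integral_dominated_convergence[where w = "\<lambda>x. 4 * norm (f x)"])
    show "(\<lambda>x. indicator ({a<..<b} \<times> {c<..<d}) x *\<^sub>R f x) \<in> borel_measurable torus"
      using f by (intro borel_measurable_scaleR indicator_measurable_torus borel_open open_Times) auto
    show "integrable torus (\<lambda>x. 4 * norm (f x))" using f by simp
    show "AE x in torus. norm (f x * ?P n x) \<le> 4 * norm (f x)" for n
    proof (intro AE_I2)
      fix x
      have "norm (?P n x) \<le> 2 * 2"
        unfolding norm_mult norm_of_real by (intro mult_mono b2 arc_bounds) auto
      then have "norm (f x) * norm (?P n x) \<le> norm (f x) * 4" by (intro mult_left_mono) auto
      then show "norm (f x * ?P n x) \<le> 4 * norm (f x)" by (simp add: norm_mult)
    qed
    show "AE x in torus. (\<lambda>n. f x * ?P n x) \<longlonglongrightarrow> indicator ({a<..<b} \<times> {c<..<d}) x *\<^sub>R f x"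
    proof (intro AE_I2)
      fix x assume "x \<in> space torus"
      then have x: "0 \<le> fst x" "fst x \<le> 2 * pi" "0 \<le> snd x" "snd x \<le> 2 * pi" by (auto simp: Om_def)
      have "(\<lambda>n. f x * ?P n x) \<longlonglongrightarrow> f x * (of_real (if 1/2 < arc a b (fst x) then 1 else 0) *
          of_real (if 1/2 < arc c d (snd x) then 1 else 0))"
        by (intro tendsto_intros lim arc_bounds)
      also have "f x * (of_real (if 1/2 < arc a b (fst x) then 1 else 0) *
          of_real (if 1/2 < arc c d (snd x) then 1 else 0)) = indicator ({a<..<b} \<times> {c<..<d}) x *\<^sub>R f x"
        unfolding arc_gt_half_iff[OF ab x(1,2)] arc_gt_half_iff[OF cd x(3,4)]
        by (cases x) (auto simp: indicator_def)
      finally show "(\<lambda>n. f x * ?P n x) \<longlonglongrightarrow> indicator ({a<..<b} \<times> {c<..<d}) x *\<^sub>R f x" .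
    qed
  qed (use i in auto)
  then show ?thesis unfolding z using LIMSEQ_unique tendsto_const by blast
qed

text \<open>\<open>torus\<close> sees nothing outside \<open>Om\<close>, so the sides may be clipped
  to \<open>[0, 2 * pi]\<close>; inside \<open>Om\<close> the box and the clipped rectangle differ
  on boundary lines only, which are null sets.\<close>

lemma integral_box_eq_0:
  assumes f: "integrable torus f" and 0: "\<And>k. fcoef f k = 0"
  shows "(\<integral>x. indicator (box p q) x *\<^sub>R f x \<partial>torus) = 0"
proof -
  define a b c d where "a = max 0 (fst p)" and "b = min (2 * pi) (fst q)"
    and "c = max 0 (snd p)" and "d = min (2 * pi) (snd q)"
  let ?R = "{a<..<b} \<times> {c<..<d}"
  have [measurable]: "f \<in> borel_measurable torus" using f by simp
  have ind: "(\<lambda>x. indicator S x *\<^sub>R f x) \<in> borel_measurable torus" if "open S" for S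
    using that by (intro borel_measurable_scaleR indicator_measurable_torus) auto
  have "AE x in torus. indicator (box p q) x *\<^sub>R f x = indicator ?R x *\<^sub>R f x"
    using AE_torus_fst[of 0] AE_torus_fst[of "2 * pi"] AE_torus_snd[of 0] AE_torus_snd[of "2 * pi"] AE_space
  proof eventually_elim
    case (elim x)
    then have "x \<in> box p q \<longleftrightarrow> x \<in> ?R"
      by (cases x; cases p; cases q) (auto simp: Om_def a_def b_def c_def d_def mem_box Basis_prod_def)
    then show ?case by (simp add: indicator_def)
  qed
  then have "(\<integral>x. indicator (box p q) x *\<^sub>R f x \<partial>torus) = (\<integral>x. indicator ?R x *\<^sub>R f x \<partial>torus)"
    by (intro integral_cong_AE ind) (auto intro: open_Times)
  also have "\<dots> = 0"
  proof (cases "a < b \<and> c < d")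
    case True
    then show ?thesis by (intro integral_rectangle_eq_0 f 0) (auto simp: a_def b_def c_def d_def)
  next
    case False
    then have "x \<notin> ?R" for x by (cases x) auto
    then have "indicator ?R x = (0::real)" for x by simp
    then show ?thesis by (simp only: scale_zero_left integral_zero)
  qed
  finally show ?thesis .
qed

text \<open>The Borel sets over which \<open>f\<close> integrates to zero form a Dynkin system
  containing the open boxes, and these are stable under intersection and generate the Borel sets. An
  integrable function whose set integrals all vanish is zero almost everywhere.\<close>

theorem fcoef_eq_0_imp_AE_0:
  assumes f: "integrable torus f" and 0: "\<And>k. fcoef f k = 0"
  shows "AE x in torus. f x = 0"
proof (rule torus.density_zero[OF f])
  have fm [measurable]: "f \<in> borel_measurable torus" using f by simp
  have sets: "A \<inter> Om \<in> sets torus" if "A \<in> sets borel" for A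
    using that by (auto simp: torus_def sets_restrict_space)
  have ii: "integrable torus (\<lambda>x. indicator A x *\<^sub>R f x)" if "A \<in> sets borel" for A
  proof -
    have "integrable torus (\<lambda>x. indicator (A \<inter> Om) x *\<^sub>R f x)"
      by (rule integrable_mult_indicator[OF sets[OF that] f])
    then show ?thesis
      by (rule Bochner_Integration.integrable_cong[THEN iffD1, rotated -1]) (auto simp: indicator_def)
  qed
  let ?G = "range (\<lambda>(a, b). box a b :: (real \<times> real) set)"
  have bor: "sets borel = sigma_sets UNIV ?G"
    by (subst borel_eq_box) (simp add: sets_measure_of)
  have "(\<integral>x. indicator A x *\<^sub>R f x \<partial>torus) = 0" if "A \<in> sigma_sets UNIV ?G" for A
  proof (rule sigma_sets_induct_disjoint[OF _ _ that, where P = "\<lambda>A. (\<integral>x. indicator A x *\<^sub>R f x \<partial>torus) = 0"])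
    show "Int_stable ?G"
    proof (rule Int_stableI)
      fix a b assume "a \<in> ?G" "b \<in> ?G"
      then obtain p q p' q' where "a = box p q" "b = box p' q'" by auto
      then have "a \<inter> b = (\<lambda>(a, b). box a b) (\<Sum>i\<in>Basis. max (p \<bullet> i) (p' \<bullet> i) *\<^sub>R i, \<Sum>i\<in>Basis. min (q \<bullet> i) (q' \<bullet> i) *\<^sub>R i)"
        by (simp add: box_Int_box)
      then show "a \<inter> b \<in> ?G" by (rule range_eqI)
    qed
    show "(\<integral>x. indicator A x *\<^sub>R f x \<partial>torus) = 0" if "A \<in> ?G" for A
      using that integral_box_eq_0[OF f 0] by auto
    \<comment> \<open>The coefficient at wavenumber zero supplies the integral over the whole torus,
      on which the step for complements depends.\<close>
    have one: "(\<integral>x. f x \<partial>torus) = 0" using 0[of 0] by (simp add: fcoef_def)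
    show "(\<integral>x. indicator (UNIV - A) x *\<^sub>R f x \<partial>torus) = 0"
      if "A \<in> sigma_sets UNIV ?G" "(\<integral>x. indicator A x *\<^sub>R f x \<partial>torus) = 0" for A
    proof -
      have "(\<integral>x. indicator (UNIV - A) x *\<^sub>R f x \<partial>torus) = (\<integral>x. f x - indicator A x *\<^sub>R f x \<partial>torus)"
        by (intro Bochner_Integration.integral_cong) (auto simp: indicator_def)
      also have "\<dots> = 0"
        using ii[of A] that f one by (simp add: bor)
      finally show ?thesis .
    qed
    show "(\<integral>x. indicator (\<Union>i. A i) x *\<^sub>R f x \<partial>torus) = 0"
      if dis: "disjoint_family A" and A: "range A \<subseteq> sigma_sets UNIV ?G"
        and z: "\<And>i. (\<integral>x. indicator (A i) x *\<^sub>R f x \<partial>torus) = 0" for A :: "nat \<Rightarrow> _ set"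
    proof -
      have Ai: "A i \<in> sets borel" for i using A bor by auto
      have U: "(\<Union>i. A i) \<in> sets borel" using Ai by blast
      have "(\<lambda>n. \<integral>x. (\<Sum>i<n. indicator (A i) x *\<^sub>R f x) \<partial>torus) \<longlonglongrightarrow> (\<integral>x. indicator (\<Union>i. A i) x *\<^sub>R f x \<partial>torus)"
      proof (rule integral_dominated_convergence[where w = "\<lambda>x. norm (f x)"])
        have s: "(\<Sum>i<n. indicator (A i) x *\<^sub>R f x) = indicator (\<Union>i<n. A i) x *\<^sub>R f x" for n x
          using dis by (subst indicator_UN_disjoint) (auto simp: scaleR_sum_left disjoint_family_on_def)
        show "AE x in torus. norm (\<Sum>i<n. indicator (A i) x *\<^sub>R f x) \<le> norm (f x)" for n
          unfolding s by (auto simp: indicator_def)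
        show "AE x in torus. (\<lambda>n. \<Sum>i<n. indicator (A i) x *\<^sub>R f x) \<longlonglongrightarrow> indicator (\<Union>i. A i) x *\<^sub>R f x"
          unfolding s by (intro AE_I2 tendsto_scaleR LIMSEQ_indicator_UN tendsto_const)
        show "(\<lambda>x. indicator (\<Union>i. A i) x *\<^sub>R f x) \<in> borel_measurable torus" using ii[OF U] by simp
        show "(\<lambda>x. \<Sum>i<n. indicator (A i) x *\<^sub>R f x) \<in> borel_measurable torus" for n
          by (intro borel_measurable_sum borel_measurable_integrable ii Ai)
        show "integrable torus (\<lambda>x. norm (f x))" using f by simp
      qed
      moreover have "(\<integral>x. (\<Sum>i<n. indicator (A i) x *\<^sub>R f x) \<partial>torus) = 0" for n
        by (subst Bochner_Integration.integral_sum) (auto intro: ii Ai simp: z)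
      ultimately have "(\<lambda>n. 0) \<longlonglongrightarrow> (\<integral>x. indicator (\<Union>i. A i) x *\<^sub>R f x \<partial>torus)"
        by (simp only:)
      from LIMSEQ_unique[OF this tendsto_const] show ?thesis .
    qed
  qed (auto)
  then show "set_lebesgue_integral torus A f = 0" if "A \<in> sets torus" for A
    using that unfolding set_lebesgue_integral_def bor[symmetric]
    by (auto simp: torus_def sets_restrict_space)
qed

subsection \<open>Riesz--Fischer and Parseval\<close>

text \<open>A fixed increasing exhaustion by squares turns the unordered \<open>has_sum\<close> into
  a limit of a sequence, the form that dominated convergence requires.\<close>

definition Kbox :: "nat \<Rightarrow> wn set" where
  "Kbox n = {- int n..int n} \<times> {- int n..int n}"

lemma finite_Kbox [simp]: "finite (Kbox n)"
  by (simp add: Kbox_def)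

lemma Kbox_mono: "m \<le> n \<Longrightarrow> Kbox m \<subseteq> Kbox n"
  by (auto simp: Kbox_def)

lemma in_Kbox: "n \<ge> nat \<bar>fst k\<bar> + nat \<bar>snd k\<bar> \<Longrightarrow> k \<in> Kbox n"
  by (cases k) (auto simp: Kbox_def)

lemma filterlim_Kbox: "filterlim Kbox (finite_subsets_at_top UNIV) sequentially"
proof (rule filterlim_finite_subsets_at_top[THEN iffD2], intro allI impI)
  fix X :: "wn set" assume X: "finite X \<and> X \<subseteq> UNIV"
  define m where "m = (\<Sum>k\<in>X. nat \<bar>fst k\<bar> + nat \<bar>snd k\<bar>)"
  have "X \<subseteq> Kbox n" if "n \<ge> m" for n
  proof
    fix k assume k: "k \<in> X"
    have "nat \<bar>fst k\<bar> + nat \<bar>snd k\<bar> \<le> m"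
      unfolding m_def using X by (intro member_le_sum[OF k]) auto
    then show "k \<in> Kbox n" using that by (intro in_Kbox) linarith
  qed
  then show "\<forall>\<^sub>F n in sequentially. finite (Kbox n) \<and> X \<subseteq> Kbox n \<and> Kbox n \<subseteq> UNIV"
    by (auto simp: eventually_sequentially)
qed

lemma has_sum_Kbox: "(f has_sum S) UNIV \<Longrightarrow> (\<lambda>n. sum f (Kbox n)) \<longlonglongrightarrow> S"
  unfolding has_sum_def by (rule filterlim_compose[OF _ filterlim_Kbox])

lemma has_sum_diff:
  fixes f g :: "'a \<Rightarrow> 'b::real_normed_vector"
  assumes "(f has_sum a) A" "(g has_sum b) A"
  shows "((\<lambda>x. f x - g x) has_sum (a - b)) A"
  using has_sum_add[OF assms(1), of "\<lambda>x. - g x" "- b"] assms(2) by (simp add: has_sum_uminus)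

lemma norm_diff_squared:
  "complex_of_real ((norm (a - b))\<^sup>2) = a * cnj a - a * cnj b - cnj (a * cnj b) + b * cnj b"
  by (simp add: complex_norm_square algebra_simps del: complex_mult_cnj of_real_power)

text \<open>Both cross terms and the square of the partial sum equal the same real number, so two
  minus signs and one plus sign leave a single subtraction.\<close>

lemma Bessel_identity:
  assumes f: "sqint f" and K: "finite K"
  shows "(\<integral>x. (norm (f x - trig_sum (fcoef f) K x))\<^sup>2 \<partial>torus) =
    (\<integral>x. (norm (f x))\<^sup>2 \<partial>torus) - 4 * pi\<^sup>2 * (\<Sum>k\<in>K. (norm (fcoef f k))\<^sup>2)"
proof -
  let ?s = "trig_sum (fcoef f) K"
  note [simp] = integrable_mult_sqint[OF f sqint_cnj[OF f]]
    integrable_mult_sqint[OF f sqint_cnj[OF sqint_trig_sum]]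
    integrable_mult_sqint[OF sqint_trig_sum sqint_cnj[OF sqint_trig_sum]]
  have i: "integrable torus (\<lambda>x. cnj (f x * cnj (?s x)))"
    by (rule integrable_cnj) simp
  have cn: "(\<integral>x. cnj (f x * cnj (?s x)) \<partial>torus) = cnj (\<integral>x. f x * cnj (?s x) \<partial>torus)"
    by (rule Bochner_Integration.integral_cnj)
  have nn: "(\<Sum>k\<in>K. fcoef f k * cnj (fcoef f k)) = complex_of_real (\<Sum>k\<in>K. (norm (fcoef f k))\<^sup>2)"
    by (simp add: complex_norm_square of_real_power[symmetric] del: of_real_power complex_mult_cnj)
  have fs: "(\<integral>x. f x * cnj (?s x) \<partial>torus) = complex_of_real (4 * pi\<^sup>2 * (\<Sum>k\<in>K. (norm (fcoef f k))\<^sup>2))"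
    by (simp add: integral_mult_cnj_trig_sum[OF f] nn del: complex_mult_cnj)
  have ss: "(\<integral>x. ?s x * cnj (?s x) \<partial>torus) = complex_of_real (4 * pi\<^sup>2 * (\<Sum>k\<in>K. (norm (fcoef f k))\<^sup>2))"
  proof -
    have "(\<integral>x. ?s x * cnj (?s x) \<partial>torus) = complex_of_real (\<integral>x. (norm (?s x))\<^sup>2 \<partial>torus)"
      unfolding integral_complex_of_real[symmetric] by (simp only: complex_norm_square)
    then show ?thesis by (simp only: integral_norm_trig_sum[OF K])
  qed
  have ff: "(\<integral>x. f x * cnj (f x) \<partial>torus) = complex_of_real (\<integral>x. (norm (f x))\<^sup>2 \<partial>torus)"
    unfolding integral_complex_of_real[symmetric] by (simp only: complex_norm_square)
  have "complex_of_real (\<integral>x. (norm (f x - ?s x))\<^sup>2 \<partial>torus) =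
      (\<integral>x. f x * cnj (f x) - f x * cnj (?s x) - cnj (f x * cnj (?s x)) + ?s x * cnj (?s x) \<partial>torus)"
    unfolding integral_complex_of_real[symmetric] norm_diff_squared ..
  also have "\<dots> = (\<integral>x. f x * cnj (f x) \<partial>torus) - (\<integral>x. f x * cnj (?s x) \<partial>torus) -
      (\<integral>x. cnj (f x * cnj (?s x)) \<partial>torus) + (\<integral>x. ?s x * cnj (?s x) \<partial>torus)"
    using i by (simp del: complex_cnj_mult complex_cnj_cnj complex_mult_cnj)
  also have "\<dots> = complex_of_real ((\<integral>x. (norm (f x))\<^sup>2 \<partial>torus) - 4 * pi\<^sup>2 * (\<Sum>k\<in>K. (norm (fcoef f k))\<^sup>2))"
    unfolding cn fs ss ff by (simp only: complex_cnj_complex_of_real of_real_diff) simp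
  finally show ?thesis by (simp only: of_real_eq_iff)
qed

lemma Bessel_inequality:
  assumes "sqint f" "finite K"
  shows "4 * pi\<^sup>2 * (\<Sum>k\<in>K. (norm (fcoef f k))\<^sup>2) \<le> (\<integral>x. (norm (f x))\<^sup>2 \<partial>torus)"
proof -
  have "0 \<le> (\<integral>x. (norm (f x - trig_sum (fcoef f) K x))\<^sup>2 \<partial>torus)" by simp
  then show ?thesis using Bessel_identity[OF assms] by simp
qed

lemma summable_fcoef: "sqint f \<Longrightarrow> (\<lambda>k. (norm (fcoef f k))\<^sup>2) summable_on UNIV"
proof (rule nonneg_bdd_above_summable_on)
  assume f: "sqint f"
  show "bdd_above (sum (\<lambda>k. (norm (fcoef f k))\<^sup>2) ` {F. F \<subseteq> UNIV \<and> finite F})"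
  proof (rule bdd_aboveI2)
    fix F :: "wn set" assume "F \<in> {F. F \<subseteq> UNIV \<and> finite F}"
    then show "(\<Sum>k\<in>F. (norm (fcoef f k))\<^sup>2) \<le> (\<integral>x. (norm (f x))\<^sup>2 \<partial>torus) / (4 * pi\<^sup>2)"
      using Bessel_inequality[OF f, of F] by (simp add: field_simps)
  qed
qed auto

lemma trig_sum_diff: "K \<subseteq> L \<Longrightarrow> finite L \<Longrightarrow> trig_sum c L x - trig_sum c K x = trig_sum c (L - K) x"
  by (simp add: trig_sum_def sum_diff)

text \<open>Along sufficiently fast growing squares the partial sums have L2 gaps of order
  \<open>2^(-n)\<close>. The increments are then summable in L1, hence absolutely summable almost
  everywhere, and Fatou's lemma turns the pointwise limit into an L2 limit.\<close>

theorem Riesz_Fischer: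
  assumes c: "((\<lambda>k. (norm (c k))\<^sup>2) has_sum S) UNIV"
  obtains f where "sqint f" "\<And>k. fcoef f k = c k" "(\<integral>x. (norm (f x))\<^sup>2 \<partial>torus) = 4 * pi\<^sup>2 * S"
proof -
  define a where "a n = (\<Sum>k\<in>Kbox n. (norm (c k))\<^sup>2)" for n
  have a_lim: "a \<longlonglongrightarrow> S" unfolding a_def by (rule has_sum_Kbox[OF c])
  have a_mono: "a m \<le> a n" if "m \<le> n" for m n
    unfolding a_def using Kbox_mono[OF that] by (intro sum_mono2) auto
  have a_le: "a n \<le> S" for n
    by (rule LIMSEQ_le_const[OF a_lim]) (use a_mono in blast)
  have "\<exists>N. \<forall>n\<ge>N. S - a n < (1/4) ^ j" for j
  proof -
    have "\<forall>\<^sub>F n in sequentially. dist (a n) S < (1/4) ^ j"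
      using a_lim by (rule tendstoD) simp
    then show ?thesis using a_le by (auto simp: eventually_sequentially dist_real_def)
  qed
  then obtain N where N: "\<And>j n. n \<ge> N j \<Longrightarrow> S - a n < (1/4) ^ j" by metis
  \<comment> \<open>Summing the \<open>N i\<close> makes \<open>r\<close> monotone with
    \<open>r n\<close> at least \<open>N n\<close>; the added \<open>n\<close> forces
    \<open>r n\<close> to infinity, so that every mode is eventually included.\<close>
  define r where "r n = (\<Sum>i\<le>n. N i) + n" for n
  have r_mono: "r m \<le> r n" if "m \<le> n" for m n
    unfolding r_def using that by (intro add_mono sum_mono2) auto
  have r_N: "N n \<le> r n" for n
    unfolding r_def by (rule trans_le_add1, rule member_le_sum) auto
  have r_ge: "n \<le> r n" for n by (simp add: r_def)
  have tail: "S - a (r n) \<le> (1/4) ^ n" for n using N[OF r_N] by (rule less_imp_le)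
  define s where "s n = trig_sum c (Kbox (r n))" for n
  have sq_s: "sqint (s n)" for n unfolding s_def by (rule sqint_trig_sum)
  have s_meas [measurable]: "s n \<in> borel_measurable torus" for n using sq_s by (rule sqint_measurable)
  have diff: "(\<integral>x. (norm (s m x - s n x))\<^sup>2 \<partial>torus) \<le> 4 * pi\<^sup>2 * (1/4) ^ n" if "n \<le> m" for m n
  proof -
    have sub: "Kbox (r n) \<subseteq> Kbox (r m)" by (intro Kbox_mono r_mono that)
    have "(\<integral>x. (norm (s m x - s n x))\<^sup>2 \<partial>torus) = 4 * pi\<^sup>2 * (\<Sum>k\<in>Kbox (r m) - Kbox (r n). (norm (c k))\<^sup>2)"
      unfolding s_def trig_sum_diff[OF sub finite_Kbox] by (rule integral_norm_trig_sum) simp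
    also have "(\<Sum>k\<in>Kbox (r m) - Kbox (r n). (norm (c k))\<^sup>2) = a (r m) - a (r n)"
      unfolding a_def using sub by (intro sum_diff) auto
    also have "\<dots> \<le> (1/4) ^ n" using a_le[of "r m"] tail[of n] by linarith
    finally show ?thesis by simp
  qed
  have L1: "(\<integral>x. norm (s (Suc n) x - s n x) \<partial>torus) \<le> 4 * pi\<^sup>2 * (1/2) ^ n" for n
  proof -
    have "sqint (\<lambda>x. norm (s (Suc n) x - s n x))"
      using sqint_diff[OF sq_s sq_s, of "Suc n" n] by (auto simp: sqint_def)
    \<comment> \<open>Cauchy-Schwarz against the constant 1, on a space of measure
      \<open>4 * pi^2\<close>, passes from the L2 norm to the L1 norm.\<close>
    from integral_mult_squared_le[OF this sqint_const[of 1]]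
    have "(\<integral>x. norm (s (Suc n) x - s n x) \<partial>torus)\<^sup>2 \<le> (\<integral>x. (norm (s (Suc n) x - s n x))\<^sup>2 \<partial>torus) * (4 * pi\<^sup>2)"
      by simp
    also have "\<dots> \<le> 4 * pi\<^sup>2 * (1/4) ^ n * (4 * pi\<^sup>2)"
      by (intro mult_right_mono diff) auto
    also have "(1/4 :: real) ^ n = ((1/2) ^ n)\<^sup>2"
      by (simp add: power2_eq_square flip: power_mult_distrib)
    also have "4 * pi\<^sup>2 * ((1/2) ^ n)\<^sup>2 * (4 * pi\<^sup>2) = (4 * pi\<^sup>2 * (1/2) ^ n)\<^sup>2"
      by (simp add: power2_eq_square)
    finally show ?thesis by (rule power2_le_imp_le) simp
  qed
  have D_int: "integrable torus (\<lambda>x. norm (s (Suc n) x - s n x))" for n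
    by (intro integrable_norm sqint_imp_integrable sqint_diff sq_s)
  have "(\<integral>\<^sup>+x. (\<Sum>n. ennreal (norm (s (Suc n) x - s n x))) \<partial>torus) =
      (\<Sum>n. \<integral>\<^sup>+x. ennreal (norm (s (Suc n) x - s n x)) \<partial>torus)"
    by (rule nn_integral_suminf) simp
  also have "\<dots> \<le> (\<Sum>n. ennreal (4 * pi\<^sup>2 * (1/2) ^ n))"
    using L1 D_int by (intro suminf_le) (auto simp: nn_integral_eq_integral intro!: ennreal_leI)
  also have "\<dots> < \<infinity>"
  proof -
    have "summable (\<lambda>n. 4 * pi\<^sup>2 * (1/2 :: real) ^ n)" by (intro summable_mult summable_geometric) simp
    then show ?thesis by (subst suminf_ennreal2) (auto)
  qed
  finally have "AE x in torus. (\<Sum>n. ennreal (norm (s (Suc n) x - s n x))) \<noteq> \<infinity>"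
    by (intro nn_integral_PInf_AE) auto
  then have conv: "AE x in torus. convergent (\<lambda>n. s n x)"
  proof eventually_elim
    case (elim x)
    then have "summable (\<lambda>n. norm (s (Suc n) x - s n x))"
      by (intro summable_suminf_not_top) auto
    then have "summable (\<lambda>n. s (Suc n) x - s n x)" by (rule summable_norm_cancel)
    then have "convergent (\<lambda>n. \<Sum>i<n. s (Suc i) x - s i x)" by (simp add: summable_iff_convergent)
    then have "convergent (\<lambda>n. s n x - s 0 x)" by (simp add: sum_lessThan_telescope[of "\<lambda>i. s i x"])
    then show ?case by (simp add: convergent_diff_const_right_iff)
  qed
  define f where "f x = lim (\<lambda>n. s n x)" for x
  have f_meas [measurable]: "f \<in> borel_measurable torus"
    unfolding f_def[abs_def] by measurable
  have lim: "AE x in torus. (\<lambda>n. s n x) \<longlonglongrightarrow> f x"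
    using conv by eventually_elim (simp add: f_def convergent_LIMSEQ_iff)
  have fat: "(\<integral>\<^sup>+x. ennreal ((norm (f x - s n x))\<^sup>2) \<partial>torus) \<le> ennreal (4 * pi\<^sup>2 * (1/4) ^ n)" for n
  proof -
    have "AE x in torus. ennreal ((norm (f x - s n x))\<^sup>2) = liminf (\<lambda>m. ennreal ((norm (s m x - s n x))\<^sup>2))"
      using lim
    proof eventually_elim
      case (elim x)
      then have "(\<lambda>m. ennreal ((norm (s m x - s n x))\<^sup>2)) \<longlonglongrightarrow> ennreal ((norm (f x - s n x))\<^sup>2)"
        by (intro tendsto_ennrealI tendsto_intros)
      from lim_imp_Liminf[OF sequentially_bot this] show ?case by (rule sym)
    qed
    then have "(\<integral>\<^sup>+x. ennreal ((norm (f x - s n x))\<^sup>2) \<partial>torus) =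
        (\<integral>\<^sup>+x. liminf (\<lambda>m. ennreal ((norm (s m x - s n x))\<^sup>2)) \<partial>torus)"
      by (rule nn_integral_cong_AE)
    also have "\<dots> \<le> liminf (\<lambda>m. \<integral>\<^sup>+x. ennreal ((norm (s m x - s n x))\<^sup>2) \<partial>torus)"
      by (rule nn_integral_liminf) measurable
    also have "\<dots> \<le> liminf (\<lambda>m. ennreal (4 * pi\<^sup>2 * (1/4) ^ n))"
    proof (rule Liminf_mono)
      have "(\<integral>\<^sup>+x. ennreal ((norm (s m x - s n x))\<^sup>2) \<partial>torus) \<le> ennreal (4 * pi\<^sup>2 * (1/4) ^ n)" if "m \<ge> n" for m
        using diff[OF that] sqint_diff[OF sq_s sq_s, of m n]
        by (subst nn_integral_eq_integral) (auto simp: sqint_def intro!: ennreal_leI)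
      then show "\<forall>\<^sub>F m in sequentially. (\<integral>\<^sup>+x. ennreal ((norm (s m x - s n x))\<^sup>2) \<partial>torus) \<le> ennreal (4 * pi\<^sup>2 * (1/4) ^ n)"
        by (auto simp: eventually_sequentially)
    qed
    also have "\<dots> = ennreal (4 * pi\<^sup>2 * (1/4) ^ n)" by (simp add: Liminf_const)
    finally show ?thesis .
  qed
  have sq_fs: "sqint (\<lambda>x. f x - s n x)" for n
    unfolding sqint_def
  proof
    show "integrable torus (\<lambda>x. (norm (f x - s n x))\<^sup>2)"
      using fat[of n] by (intro integrableI_bounded) (auto intro: le_less_trans)
  qed simp
  have fs_le: "(\<integral>x. (norm (f x - s n x))\<^sup>2 \<partial>torus) \<le> 4 * pi\<^sup>2 * (1/4) ^ n" for n
  proof -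
    have "ennreal (\<integral>x. (norm (f x - s n x))\<^sup>2 \<partial>torus) \<le> ennreal (4 * pi\<^sup>2 * (1/4) ^ n)"
      using fat[of n] sq_fs[of n] by (subst nn_integral_eq_integral[symmetric]) (auto simp: sqint_def)
    then show ?thesis by (subst (asm) ennreal_le_iff) auto
  qed
  have sq_f: "sqint f" using sqint_add[OF sq_fs[of 0] sq_s[of 0]] by simp
  have lim0: "(\<lambda>n. 4 * pi\<^sup>2 * (1/4 :: real) ^ n) \<longlonglongrightarrow> 0"
    by (intro tendsto_mult_right_zero LIMSEQ_power_zero) simp
  have coef: "fcoef f k = c k" for k
  proof -
    have bnd: "(norm (fcoef f k - c k))\<^sup>2 \<le> (1/4) ^ n" if "n \<ge> nat \<bar>fst k\<bar> + nat \<bar>snd k\<bar>" for n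
    proof -
      have k: "k \<in> Kbox (r n)" using that r_ge[of n] by (intro in_Kbox) linarith
      have "fcoef (\<lambda>x. f x - s n x) k = fcoef f k - fcoef (s n) k"
        by (intro fcoef_diff sqint_imp_integrable sq_f sq_s)
      also have "fcoef (s n) k = c k" unfolding s_def using k by (simp add: fcoef_trig_sum)
      finally have "4 * pi\<^sup>2 * (norm (fcoef f k - c k))\<^sup>2 \<le> (\<integral>x. (norm (f x - s n x))\<^sup>2 \<partial>torus)"
        using Bessel_inequality[OF sq_fs[of n], of "{k}"] by simp
      also have "\<dots> \<le> 4 * pi\<^sup>2 * (1/4) ^ n" by (rule fs_le)
      finally show ?thesis by simp
    qed
    have "(\<lambda>n. (1/4 :: real) ^ n) \<longlonglongrightarrow> 0" by (intro LIMSEQ_power_zero) simp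
    then have "(norm (fcoef f k - c k))\<^sup>2 \<le> 0"
      by (rule LIMSEQ_le_const) (use bnd in blast)
    then show ?thesis by simp
  qed
  \<comment> \<open>The norm is read off from the Bessel identity, whose left-hand side tends to
    zero.\<close>
  have "(\<integral>x. (norm (f x))\<^sup>2 \<partial>torus) = 4 * pi\<^sup>2 * S"
  proof (rule LIMSEQ_unique)
    have B: "(\<integral>x. (norm (f x - s n x))\<^sup>2 \<partial>torus) = (\<integral>x. (norm (f x))\<^sup>2 \<partial>torus) - 4 * pi\<^sup>2 * a (r n)" for n
      using Bessel_identity[OF sq_f finite_Kbox, of "r n"] unfolding coef[abs_def] s_def a_def by simp
    show "(\<lambda>n. 4 * pi\<^sup>2 * a (r n)) \<longlonglongrightarrow> 4 * pi\<^sup>2 * S"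
      by (intro tendsto_intros filterlim_compose[OF a_lim] filterlim_at_top_mono[OF filterlim_ident])
        (auto simp: r_ge)
    have "(\<lambda>n. (\<integral>x. (norm (f x))\<^sup>2 \<partial>torus) - 4 * pi\<^sup>2 * a (r n)) \<longlonglongrightarrow> 0"
      using fs_le by (intro tendsto_sandwich[OF _ _ tendsto_const lim0]) (auto simp flip: B)
    from tendsto_diff[OF tendsto_const[of "\<integral>x. (norm (f x))\<^sup>2 \<partial>torus"] this]
    show "(\<lambda>n. 4 * pi\<^sup>2 * a (r n)) \<longlonglongrightarrow> (\<integral>x. (norm (f x))\<^sup>2 \<partial>torus)" by simp
  qed
  with sq_f coef show thesis by (rule that)
qed

lemma AE_eq_of_fcoef_eq:
  assumes "integrable torus f" "integrable torus g" "\<And>k. fcoef f k = fcoef g k"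
  shows "AE x in torus. f x = g x"
proof -
  have "AE x in torus. f x - g x = 0"
    using assms by (intro fcoef_eq_0_imp_AE_0) (auto simp: fcoef_diff)
  then show ?thesis by simp
qed

text \<open>Riesz-Fischer builds from the coefficients of \<open>f\<close> a function whose norm is
  known exactly, and completeness identifies it with \<open>f\<close> almost everywhere. Bessel's
  inequality alone would give one direction only.\<close>

theorem Parseval:
  assumes f: "sqint f"
  shows "((\<lambda>k. (norm (fcoef f k))\<^sup>2) has_sum (\<integral>x. (norm (f x))\<^sup>2 \<partial>torus) / (4 * pi\<^sup>2)) UNIV"
proof -
  obtain S where S: "((\<lambda>k. (norm (fcoef f k))\<^sup>2) has_sum S) UNIV"
    using summable_fcoef[OF f] by (auto simp: summable_on_def)
  then obtain g where g: "sqint g" "\<And>k. fcoef g k = fcoef f k" "(\<integral>x. (norm (g x))\<^sup>2 \<partial>torus) = 4 * pi\<^sup>2 * S"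
    by (rule Riesz_Fischer) (rule that)
  have "AE x in torus. f x = g x"
    using f g by (intro AE_eq_of_fcoef_eq sqint_imp_integrable) auto
  then have "(\<integral>x. (norm (f x))\<^sup>2 \<partial>torus) = (\<integral>x. (norm (g x))\<^sup>2 \<partial>torus)"
    using f g by (intro integral_cong_AE) (auto simp: sqint_def)
  then have "S = (\<integral>x. (norm (f x))\<^sup>2 \<partial>torus) / (4 * pi\<^sup>2)"
    using g(3) by simp
  with S show ?thesis by simp
qed

text \<open>Polarisation of Parseval's identity. The inner product on complex numbers is the real
  one, so this is the real part of the sesquilinear identity.\<close>

lemma has_sum_fcoef_inner:
  assumes f: "sqint f" and g: "sqint g"
  shows "((\<lambda>k. fcoef f k \<bullet> fcoef g k) has_sum (\<integral>x. f x \<bullet> g x \<partial>torus) / (4 * pi\<^sup>2)) UNIV"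
proof -
  have pol: "a \<bullet> b = ((norm (a + b))\<^sup>2 - (norm (a - b))\<^sup>2) / 4" for a b :: complex
    by (simp add: power2_norm_eq_inner inner_add inner_diff inner_commute)
  note p = sqint_add[OF f g] and m = sqint_diff[OF f g]
  have [simp]: "integrable torus f" "integrable torus g"
    using f g by (auto intro: sqint_imp_integrable)
  have "((\<lambda>k. ((norm (fcoef (\<lambda>x. f x + g x) k))\<^sup>2 - (norm (fcoef (\<lambda>x. f x - g x) k))\<^sup>2) / 4) has_sum
      ((\<integral>x. (norm (f x + g x))\<^sup>2 \<partial>torus) / (4 * pi\<^sup>2) - (\<integral>x. (norm (f x - g x))\<^sup>2 \<partial>torus) / (4 * pi\<^sup>2)) / 4) UNIV"
    unfolding divide_inverse[of _ 4] by (intro has_sum_cmult_left has_sum_diff Parseval p m)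
  also have "((\<integral>x. (norm (f x + g x))\<^sup>2 \<partial>torus) / (4 * pi\<^sup>2) - (\<integral>x. (norm (f x - g x))\<^sup>2 \<partial>torus) / (4 * pi\<^sup>2)) / 4 =
      (\<integral>x. ((norm (f x + g x))\<^sup>2 - (norm (f x - g x))\<^sup>2) / 4 \<partial>torus) / (4 * pi\<^sup>2)"
    using p m by (simp add: sqint_def diff_divide_distrib)
  finally show ?thesis unfolding pol[symmetric] by (simp add: fcoef_add fcoef_diff pol)
qed

section \<open>Vector fields\<close>

lemma norm_component_le: "norm (fst p) \<le> norm p" "norm (snd p) \<le> norm p"
  using norm_fst_le[of "fst p" "snd p"] norm_snd_le[of "snd p" "fst p"] by (simp_all only: prod.collapse)

lemma L2_iff_components:
  "L2 u \<longleftrightarrow> sqint (\<lambda>x. fst (u x)) \<and> sqint (\<lambda>x. snd (u x))"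
proof
  assume u: "L2 u"
  then have m: "u \<in> borel_measurable torus" by (simp add: L2_iff_sqint sqint_def)
  have "(\<lambda>x. fst (u x)) \<in> borel_measurable torus" "(\<lambda>x. snd (u x)) \<in> borel_measurable torus"
    using measurable_compose[OF m borel_measurable_continuous_onI[OF continuous_on_fst[OF continuous_on_id]]]
      measurable_compose[OF m borel_measurable_continuous_onI[OF continuous_on_snd[OF continuous_on_id]]]
    by auto
  then show "sqint (\<lambda>x. fst (u x)) \<and> sqint (\<lambda>x. snd (u x))"
    using sqint_norm_le[OF u[unfolded L2_iff_sqint], of _ 1, unfolded mult_1, OF _ AE_I2, OF _ norm_component_le(1)]
      sqint_norm_le[OF u[unfolded L2_iff_sqint], of _ 1, unfolded mult_1, OF _ AE_I2, OF _ norm_component_le(2)]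
    by blast
next
  assume u: "sqint (\<lambda>x. fst (u x)) \<and> sqint (\<lambda>x. snd (u x))"
  then have "(\<lambda>x. (fst (u x), snd (u x))) \<in> borel_measurable torus"
    by (intro borel_measurable_Pair) (auto simp: sqint_def)
  moreover have "integrable torus (\<lambda>x. (norm (fst (u x)))\<^sup>2 + (norm (snd (u x)))\<^sup>2)"
    using u by (auto simp: sqint_def)
  ultimately show "L2 u"
    by (simp add: L2_iff_sqint sqint_def norm_prod_def)
qed

lemma L2_compD: "L2 u \<Longrightarrow> sqint (\<lambda>x. complex_of_real (fst (u x)))"
  "L2 u \<Longrightarrow> sqint (\<lambda>x. complex_of_real (snd (u x)))"
  by (auto simp: L2_iff_components intro: sqint_of_real)

lemma L2_diff: "L2 u \<Longrightarrow> L2 v \<Longrightarrow> L2 (u - v)"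
  by (auto simp: L2_iff_components intro: sqint_diff)

lemma fc_eq_fcoef:
  "fc u k = (fcoef (\<lambda>x. complex_of_real (fst (u x))) k, fcoef (\<lambda>x. complex_of_real (snd (u x))) k)"
  by (simp add: fc_def fcs_eq_fcoef)

lemma fc_diff: "L2 u \<Longrightarrow> L2 v \<Longrightarrow> fc (u - v) k = fc u k - fc v k"
  by (simp add: fc_eq_fcoef fcoef_diff L2_compD sqint_imp_integrable)

lemma fc_uminus_index: "fc u (- k) = (cnj (fst (fc u k)), cnj (snd (fc u k)))"
  using fcoef_cnj[of "\<lambda>x. complex_of_real (fst (u x))" "- k"] fcoef_cnj[of "\<lambda>x. complex_of_real (snd (u x))" "- k"]
  by (simp add: fc_eq_fcoef)

lemma AE_eq_of_fc_eq:
  assumes "L2 u" "L2 v" "\<And>k. fc u k = fc v k"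
  shows "AE x in torus. u x = v x"
proof -
  have "AE x in torus. complex_of_real (fst (u x)) = complex_of_real (fst (v x))"
    "AE x in torus. complex_of_real (snd (u x)) = complex_of_real (snd (v x))"
    using assms by (intro AE_eq_of_fcoef_eq sqint_imp_integrable L2_compD; force simp: fc_eq_fcoef)+
  then show ?thesis by eventually_elim (simp add: prod_eq_iff)
qed

lemma has_sum_fc_inner:
  assumes u: "L2 u" and v: "L2 v"
  shows "((\<lambda>k. fc u k \<bullet> fc v k) has_sum (\<integral>x. u x \<bullet> v x \<partial>torus) / (4 * pi\<^sup>2)) UNIV"
proof -
  have c: "sqint (\<lambda>x. fst (u x))" "sqint (\<lambda>x. fst (v x))" "sqint (\<lambda>x. snd (u x))" "sqint (\<lambda>x. snd (v x))"
    using u v by (auto simp: L2_iff_components)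
  have r: "complex_of_real a \<bullet> complex_of_real b = a * b" for a b
    by (simp add: inner_complex_def)
  have "((\<lambda>k. fc u k \<bullet> fc v k) has_sum (\<integral>x. fst (u x) * fst (v x) \<partial>torus) / (4 * pi\<^sup>2) +
      (\<integral>x. snd (u x) * snd (v x) \<partial>torus) / (4 * pi\<^sup>2)) UNIV"
    unfolding fc_eq_fcoef inner_prod_def fst_conv snd_conv
    by (intro has_sum_add has_sum_fcoef_inner[unfolded r, where f = "\<lambda>x. complex_of_real (_ x)" and g = "\<lambda>x. complex_of_real (_ x)", unfolded r] L2_compD u v)
  moreover have "(\<integral>x. u x \<bullet> v x \<partial>torus) = (\<integral>x. fst (u x) * fst (v x) \<partial>torus) + (\<integral>x. snd (u x) * snd (v x) \<partial>torus)"
    unfolding inner_prod_def inner_real_def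
    by (intro Bochner_Integration.integral_add integrable_mult_sqint c)
  ultimately show ?thesis by (simp add: add_divide_distrib)
qed

lemma Hnorm_squared: "(Hnorm u)\<^sup>2 = (\<integral>x. (norm (u x))\<^sup>2 \<partial>torus)"
  by (simp add: Hnorm_def set_integral_Om)

lemma Hnorm_nonneg [simp]: "0 \<le> Hnorm u"
  by (simp add: Hnorm_def set_integral_Om)

lemma has_sum_Hnorm: "L2 u \<Longrightarrow> ((\<lambda>k. (norm (fc u k))\<^sup>2) has_sum (Hnorm u)\<^sup>2 / (4 * pi\<^sup>2)) UNIV"
  using has_sum_fc_inner[of u u] by (simp add: Hnorm_squared power2_norm_eq_inner)

lemma integrable_inner: "L2 u \<Longrightarrow> L2 v \<Longrightarrow> integrable torus (\<lambda>x. u x \<bullet> v x)"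
  unfolding inner_prod_def inner_real_def L2_iff_components
  by (intro Bochner_Integration.integrable_add integrable_mult_sqint) auto

lemma integral_inner_le:
  assumes u: "L2 u" and v: "L2 v"
  shows "\<bar>\<integral>x. u x \<bullet> v x \<partial>torus\<bar> \<le> Hnorm u * Hnorm v"
proof -
  have n: "sqint (\<lambda>x. norm (u x))" "sqint (\<lambda>x. norm (v x))"
    using u v by (auto simp: L2_iff_sqint sqint_def)
  have "\<bar>\<integral>x. u x \<bullet> v x \<partial>torus\<bar> \<le> (\<integral>x. \<bar>u x \<bullet> v x\<bar> \<partial>torus)"
    by (rule integral_abs_bound)
  also have "\<dots> \<le> (\<integral>x. norm (u x) * norm (v x) \<partial>torus)"
    using integrable_inner[OF u v] integrable_mult_sqint[OF n]
    by (intro integral_mono) (auto intro: Cauchy_Schwarz_ineq2)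
  also have "\<dots> \<le> Hnorm u * Hnorm v"
  proof (rule power2_le_imp_le)
    show "(\<integral>x. norm (u x) * norm (v x) \<partial>torus)\<^sup>2 \<le> (Hnorm u * Hnorm v)\<^sup>2"
      using integral_mult_squared_le[OF n] by (simp add: power_mult_distrib Hnorm_squared)
  qed simp
  finally show ?thesis .
qed

text \<open>By Hermitian symmetry the complex solution and its conjugate have equal coefficients, so
  they agree almost everywhere and the real part is a solution as well.\<close>

lemma Riesz_Fischer_real:
  assumes c: "(\<lambda>k. (norm (c k))\<^sup>2) summable_on UNIV" and sym: "\<And>k. c (- k) = cnj (c k)"
  obtains f :: "real \<times> real \<Rightarrow> real" where "sqint f" "\<And>k. fcoef (\<lambda>x. complex_of_real (f x)) k = c k"
proof -
  obtain S where "((\<lambda>k. (norm (c k))\<^sup>2) has_sum S) UNIV" using c by (auto simp: summable_on_def)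
  then obtain f where f: "sqint f" "\<And>k. fcoef f k = c k"
    by (rule Riesz_Fischer) (rule that; assumption)
  have "fcoef (\<lambda>x. cnj (f x)) k = fcoef f k" for k
    by (simp add: fcoef_cnj f(2) sym)
  then have "AE x in torus. cnj (f x) = f x"
    by (intro AE_eq_of_fcoef_eq sqint_imp_integrable sqint_cnj f(1))
  then have ae: "AE x in torus. complex_of_real (Re (f x)) = f x"
    by eventually_elim (simp add: complex_eq_iff)
  have re: "sqint (\<lambda>x. Re (f x))"
    by (rule sqint_norm_le[OF f(1), of _ 1]) (use f(1) in \<open>auto simp: sqint_def abs_Re_le_cmod\<close>)
  show thesis
  proof (rule that[OF re])
    show "fcoef (\<lambda>x. complex_of_real (Re (f x))) k = c k" for k
      using fcoef_cong_AE[OF ae sqint_measurable[OF sqint_of_real[OF re]] sqint_measurable[OF f(1)]] f(2) by simp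
  qed
qed

lemma L2_with_fc:
  assumes c: "(\<lambda>k. (norm (c k))\<^sup>2) summable_on UNIV"
    and sym: "\<And>k. c (- k) = (cnj (fst (c k)), cnj (snd (c k)))"
  obtains w where "L2 w" "\<And>k. fc w k = c k"
proof -
  have "(\<lambda>k. (norm (fst (c k)))\<^sup>2) summable_on UNIV" "(\<lambda>k. (norm (snd (c k)))\<^sup>2) summable_on UNIV"
    by (rule summable_on_comparison_test[OF c]; simp add: norm_component_le power_mono)+
  note sc = this
  obtain f :: "real \<times> real \<Rightarrow> real" where f: "sqint f" "\<And>k. fcoef (\<lambda>x. complex_of_real (f x)) k = fst (c k)"
    by (rule Riesz_Fischer_real[OF sc(1)]) (use sym in \<open>auto intro: that\<close>)
  obtain g :: "real \<times> real \<Rightarrow> real" where g: "sqint g" "\<And>k. fcoef (\<lambda>x. complex_of_real (g x)) k = snd (c k)"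
    by (rule Riesz_Fischer_real[OF sc(2)]) (use sym in \<open>auto intro: that\<close>)
  show thesis
    by (rule that[of "\<lambda>x. (f x, g x)"]) (auto simp: L2_iff_components fc_eq_fcoef f g)
qed

section \<open>The spaces H and V in terms of Fourier coefficients\<close>

lemma norm_cmul: "norm (cmul z p) = norm z * norm p"
  by (simp add: cmul_def norm_prod_def norm_mult power_mult_distrib real_sqrt_mult flip: distrib_left)

lemma ksq_nonneg [simp]: "0 \<le> ksq k"
  by (simp add: ksq_def)

lemma ksq_ge_1: "k \<noteq> 0 \<Longrightarrow> 1 \<le> ksq k"
proof -
  assume "k \<noteq> 0"
  then have "1 \<le> (fst k)\<^sup>2 + (snd k)\<^sup>2"
    by (cases k) (auto simp: zero_prod_def; smt (verit) power2_less_eq_zero_iff zero_le_power2 zero_less_power2)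
  then have "of_int 1 \<le> (of_int ((fst k)\<^sup>2 + (snd k)\<^sup>2) :: real)" by (simp only: of_int_le_iff)
  then show ?thesis by (simp add: ksq_def)
qed

lemma ksq_0 [simp]: "ksq 0 = 0"
  by (simp add: ksq_def)

lemma Vsp_D: "Vsp v \<Longrightarrow> Hsp v" "Hsp v \<Longrightarrow> L2 v" "Hsp v \<Longrightarrow> fc v 0 = 0"
  by (auto simp: Vsp_def Hsp_def zero_prod_def)

lemma has_sum_Vnorm: "Vsp v \<Longrightarrow> ((\<lambda>k. ksq k * (norm (fc v k))\<^sup>2) has_sum (Vnorm v)\<^sup>2 / (4 * pi\<^sup>2)) UNIV"
  by (simp add: Vsp_def Vnorm_def infsum_nonneg)

lemma Vnorm_nonneg [simp]: "0 \<le> Vnorm v"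
  by (simp add: Vnorm_def infsum_nonneg)

text \<open>Poincare's inequality, with constant 1 because nonzero integer wavenumbers have length
  at least 1 and the mean vanishes.\<close>

lemma Hnorm_le_Vnorm: "Vsp v \<Longrightarrow> Hnorm v \<le> Vnorm v"
proof -
  assume v: "Vsp v"
  have "(Hnorm v)\<^sup>2 / (4 * pi\<^sup>2) \<le> (Vnorm v)\<^sup>2 / (4 * pi\<^sup>2)"
  proof (rule has_sum_mono[OF has_sum_Hnorm has_sum_Vnorm[OF v]])
    show "(norm (fc v k))\<^sup>2 \<le> ksq k * (norm (fc v k))\<^sup>2" for k
      using mult_right_mono[OF ksq_ge_1, of k "(norm (fc v k))\<^sup>2"] Vsp_D(3)[OF Vsp_D(1)[OF v]]
      by (cases "k = 0") auto
  qed (use v Vsp_D in auto)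
  then have "(Hnorm v)\<^sup>2 \<le> (Vnorm v)\<^sup>2" by (simp add: divide_le_cancel)
  then show ?thesis by (rule power2_le_imp_le) simp
qed

lemma Hsp_diff: "Hsp u \<Longrightarrow> Hsp v \<Longrightarrow> Hsp (u - v)"
  by (simp add: Hsp_def L2_diff fc_diff zero_prod_def[symmetric] algebra_simps)

lemma Vsp_diff:
  assumes u: "Vsp u" and v: "Vsp v"
  shows "Vsp (u - v)"
  unfolding Vsp_def
proof
  show "Hsp (u - v)" using u v by (auto simp: Vsp_def intro: Hsp_diff)
  have f: "fc (u - v) k = fc u k - fc v k" for k
    using u v by (intro fc_diff) (auto dest: Vsp_D)
  show "(\<lambda>k. ksq k * (norm (fc (u - v) k))\<^sup>2) summable_on UNIV"
  proof (rule summable_on_comparison_test)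
    show "(\<lambda>k. 2 * (ksq k * (norm (fc u k))\<^sup>2) + 2 * (ksq k * (norm (fc v k))\<^sup>2)) summable_on UNIV"
      using u v by (intro summable_on_add summable_on_cmult_right) (auto simp: Vsp_def)
    show "ksq k * (norm (fc (u - v) k))\<^sup>2 \<le> 2 * (ksq k * (norm (fc u k))\<^sup>2) + 2 * (ksq k * (norm (fc v k))\<^sup>2)" for k
      using mult_left_mono[OF norm_add_squared_le[of "fc u k" "- fc v k"] ksq_nonneg[of k]]
      by (simp add: f algebra_simps)
  qed simp
qed

text \<open>Obtained in the limit from the triangle inequality for finite Euclidean norms of the
  weighted coefficients. It is what makes \<open>Vnorm\<close> continuous along a strong
  solution.\<close>

lemma Vnorm_triangle:
  assumes u: "Vsp u" and v: "Vsp v"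
  shows "Vnorm u \<le> Vnorm (u - v) + Vnorm v"
proof -
  let ?L = "\<lambda>w n. L2_set (\<lambda>k. sqrt (ksq k) * norm (fc w k)) (Kbox n)"
  have lim: "(\<lambda>n. ?L w n) \<longlonglongrightarrow> sqrt ((Vnorm w)\<^sup>2 / (4 * pi\<^sup>2))" if "Vsp w" for w
    using tendsto_real_sqrt[OF has_sum_Kbox[OF has_sum_Vnorm[OF that]]]
    by (simp add: L2_set_def power_mult_distrib)
  have s: "sqrt ((Vnorm w)\<^sup>2 / (4 * pi\<^sup>2)) = Vnorm w / (2 * pi)" for w
    by (simp add: real_sqrt_divide real_sqrt_mult)
  have le: "?L u n \<le> ?L (u - v) n + ?L v n" for n
  proof -
    have f: "fc (u - v) k = fc u k - fc v k" for k
      using u v by (intro fc_diff) (auto dest: Vsp_D)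
    have "?L u n \<le> L2_set (\<lambda>k. sqrt (ksq k) * norm (fc (u - v) k) + sqrt (ksq k) * norm (fc v k)) (Kbox n)"
      using norm_triangle_ineq[of "fc u k - fc v k" "fc v k" for k]
      by (intro L2_set_mono) (auto simp: f simp flip: distrib_left intro!: mult_left_mono)
    also have "\<dots> \<le> ?L (u - v) n + ?L v n" by (rule L2_set_triangle_ineq)
    finally show ?thesis .
  qed
  have "Vnorm u / (2 * pi) \<le> Vnorm (u - v) / (2 * pi) + Vnorm v / (2 * pi)"
    unfolding s[symmetric]
    by (rule LIMSEQ_le[OF lim[OF u] tendsto_add[OF lim[OF Vsp_diff[OF u v]] lim[OF v]]]) (use le in auto)
  then show ?thesis by (simp add: field_simps)
qed

section \<open>The Leray projection and the low modes\<close>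

lemma inner_cmul_wn:
  "of_int (fst k) * fst d + of_int (snd k) * snd d = 0 \<Longrightarrow> cmul z (of_int (fst k), of_int (snd k)) \<bullet> d = 0"
proof -
  assume "of_int (fst k) * fst d + of_int (snd k) * snd d = 0"
  then have "Re (z * cnj (of_int (fst k) * fst d + of_int (snd k) * snd d)) = 0" by simp
  then show ?thesis
    by (simp add: cmul_def inner_prod_def inner_complex_def algebra_simps)
qed

text \<open>The part removed by the projection is a multiple of \<open>k\<close>, orthogonal to the
  coefficients of divergence-free fields. Wavenumber zero needs its own condition since
  \<open>leray\<close> discards the mean.\<close>

lemma inner_leray:
  assumes "of_int (fst k) * fst d + of_int (snd k) * snd d = 0" "k = 0 \<Longrightarrow> d = 0"
  shows "leray k c \<bullet> d = c \<bullet> d"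
proof (cases "k = 0")
  case True
  then show ?thesis using assms by simp
next
  case False
  then show ?thesis
    using inner_cmul_wn[OF assms(1)] by (simp add: leray_def zero_prod_def[symmetric] inner_diff_left)
qed

text \<open>The projected vector is itself orthogonal to \<open>k\<close>, so its squared norm
  equals its inner product with \<open>c\<close>, and Cauchy-Schwarz concludes.\<close>

lemma norm_leray: "norm (leray k c) \<le> norm c"
proof (cases "k = 0")
  case True
  then show ?thesis by (simp add: leray_def zero_prod_def[symmetric])
next
  case False
  then have "ksq k \<noteq> 0" using ksq_ge_1[of k] by auto
  then have kc: "complex_of_real (ksq k) \<noteq> 0" by simp
  have kk: "of_int (fst k) * of_int (fst k) + of_int (snd k) * of_int (snd k) = complex_of_real (ksq k)"
    by (simp add: ksq_def power2_eq_square)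
  let ?s = "(of_int (fst k) * fst c + of_int (snd k) * snd c) / complex_of_real (ksq k)"
  have e: "fst (leray k c) = fst c - ?s * of_int (fst k)" "snd (leray k c) = snd c - ?s * of_int (snd k)"
    using False by (simp_all add: leray_def zero_prod_def cmul_def)
  have "of_int (fst k) * fst (leray k c) + of_int (snd k) * snd (leray k c) =
      (of_int (fst k) * fst c + of_int (snd k) * snd c) - ?s * complex_of_real (ksq k)"
    unfolding e kk[symmetric] by (simp only: algebra_simps)
  also have "\<dots> = 0" using kc by simp
  finally have "leray k c \<bullet> leray k c = c \<bullet> leray k c"
    using False by (intro inner_leray) auto
  also have "\<dots> \<le> norm c * norm (leray k c)" by (rule norm_cauchy_schwarz)
  finally have "norm (leray k c) * norm (leray k c) \<le> norm c * norm (leray k c)"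
    by (simp add: power2_norm_eq_inner[symmetric] power2_eq_square)
  then show ?thesis by (cases "leray k c = 0") auto
qed

definition low_modes :: "real \<Rightarrow> wn set" where
  "low_modes N = {k. k \<noteq> (0, 0) \<and> sqrt (ksq k) \<le> N}"

lemma finite_low_modes: "finite (low_modes N)"
proof (rule finite_subset)
  show "low_modes N \<subseteq> Kbox (nat \<lceil>N\<rceil>)"
  proof
    fix k assume "k \<in> low_modes N"
    then have k: "sqrt (ksq k) \<le> N" by (simp add: low_modes_def)
    have "\<bar>real_of_int (fst k)\<bar> \<le> sqrt (ksq k)" "\<bar>real_of_int (snd k)\<bar> \<le> sqrt (ksq k)"
      unfolding ksq_def by (auto intro!: real_le_rsqrt simp: power2_abs)
    moreover have "0 \<le> N" using k real_sqrt_ge_zero[OF ksq_nonneg, of k] by linarith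
    ultimately have "\<bar>real_of_int (fst k)\<bar> \<le> N" "\<bar>real_of_int (snd k)\<bar> \<le> N" "0 \<le> N" using k by linarith+
    then have "\<bar>fst k\<bar> \<le> \<lceil>N\<rceil>" "\<bar>snd k\<bar> \<le> \<lceil>N\<rceil>" "0 \<le> \<lceil>N\<rceil>" by linarith+
    then show "k \<in> Kbox (nat \<lceil>N\<rceil>)" by (cases k) (simp add: Kbox_def abs_le_iff)
  qed
qed simp

text \<open>The real part in the definition of \<open>PN\<close> loses nothing: with Hermitian
  coefficients on a symmetric set of wavenumbers, conjugation leaves every coefficient of the sum
  unchanged.\<close>

lemma fcoef_Re_trig_sum:
  assumes K: "finite K" and sK: "\<And>k. - k \<in> K \<longleftrightarrow> k \<in> K" and sym: "\<And>k. c (- k) = cnj (c k)"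
  shows "fcoef (\<lambda>x. complex_of_real (Re (trig_sum c K x))) k = (if k \<in> K then c k else 0)"
proof -
  have i: "integrable torus (trig_sum c K)" "integrable torus (\<lambda>x. cnj (trig_sum c K x))"
    by (auto intro!: sqint_imp_integrable sqint_trig_sum sqint_cnj)
  have "complex_of_real (Re z) = (1/2) * (z + cnj z)" for z
    by (simp add: complex_eq_iff)
  then have "fcoef (\<lambda>x. complex_of_real (Re (trig_sum c K x))) k =
      (1/2) * (fcoef (trig_sum c K) k + fcoef (\<lambda>x. cnj (trig_sum c K x)) k)"
    by (simp only: fcoef_cmult fcoef_add[OF i])
  also have "\<dots> = (if k \<in> K then c k else 0)"
    by (simp add: fcoef_cnj fcoef_trig_sum[OF K] sK sym)
  finally show ?thesis .
qed

lemma PN_eq_trig_sum: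
  "PN N u = (\<lambda>x. (Re (trig_sum (\<lambda>k. fst (fc u k)) (low_modes N) x), Re (trig_sum (\<lambda>k. snd (fc u k)) (low_modes N) x)))"
  by (rule ext) (simp add: PN_def trig_sum_def low_modes_def)

lemma fc_PN: "fc (PN N u) k = (if k \<in> low_modes N then fc u k else 0)"
proof -
  have s: "- k \<in> low_modes N \<longleftrightarrow> k \<in> low_modes N" for k
    by (cases k) (auto simp: low_modes_def ksq_def)
  have "fc (PN N u) k = (fcoef (\<lambda>x. complex_of_real (Re (trig_sum (\<lambda>k. fst (fc u k)) (low_modes N) x))) k,
      fcoef (\<lambda>x. complex_of_real (Re (trig_sum (\<lambda>k. snd (fc u k)) (low_modes N) x))) k)"
    by (subst fc_eq_fcoef) (simp only: PN_eq_trig_sum fst_conv snd_conv)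
  also have "\<dots> = (if k \<in> low_modes N then fc u k else 0)"
    by (subst (1 2) fcoef_Re_trig_sum[OF finite_low_modes s]) (auto simp: fc_uminus_index zero_prod_def)
  finally show ?thesis .
qed

subsection \<open>Weak derivatives\<close>

text \<open>The multiplier \<open>\<i> * j k\<close> keeps the coefficients square summable because
  \<open>(j k)^2\<close> is at most \<open>ksq k\<close>, and keeps them Hermitian because
  \<open>j\<close> is odd in \<open>k\<close>. The selector \<open>j\<close> treats both directions
  at once.\<close>

lemma derivative_field_exists:
  assumes v: "Vsp v" and j: "j = fst \<or> j = snd"
  shows "\<exists>w. L2 w \<and> (\<forall>k. fc w k = cmul (\<i> * of_int (j k)) (fc v k))"
proof -
  have le: "(norm (cmul (\<i> * of_int (j k)) (fc v k)))\<^sup>2 \<le> ksq k * (norm (fc v k))\<^sup>2" for k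
  proof -
    have "\<bar>real_of_int (j k)\<bar>\<^sup>2 \<le> ksq k" using j by (auto simp: ksq_def)
    then show ?thesis
      by (simp add: norm_cmul norm_mult power_mult_distrib mult_right_mono)
  qed
  have sv: "(\<lambda>k. ksq k * (norm (fc v k))\<^sup>2) summable_on UNIV"
    using v by (simp add: Vsp_def)
  have s: "(\<lambda>k. (norm (cmul (\<i> * of_int (j k)) (fc v k)))\<^sup>2) summable_on UNIV"
    by (rule summable_on_comparison_test[OF sv le]) simp
  have "j (- k) = - j k" for k using j by (cases k) auto
  then have sym: "cmul (\<i> * of_int (j (- k))) (fc v (- k)) =
      (cnj (fst (cmul (\<i> * of_int (j k)) (fc v k))), cnj (snd (cmul (\<i> * of_int (j k)) (fc v k))))" for k
    by (simp add: cmul_def fc_uminus_index)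
  show ?thesis
    by (rule L2_with_fc[OF s sym]) blast
qed

text \<open>The fields picked by \<open>SOME\<close> are accessible only through these facts, hence
  only up to null sets.\<close>

lemma
  assumes v: "Vsp v"
  shows L2_d1: "L2 (d1 v)" and fc_d1: "fc (d1 v) k = cmul (\<i> * of_int (fst k)) (fc v k)"
    and L2_d2: "L2 (d2 v)" and fc_d2: "fc (d2 v) k = cmul (\<i> * of_int (snd k)) (fc v k)"
proof -
  note 1 = someI_ex[OF derivative_field_exists[OF v disjI1[OF refl]]]
    and 2 = someI_ex[OF derivative_field_exists[OF v disjI2[OF refl]]]
  show "L2 (d1 v)" unfolding d1_def by (rule 1[THEN conjunct1])
  show "fc (d1 v) k = cmul (\<i> * of_int (fst k)) (fc v k)"
    unfolding d1_def by (rule 1[THEN conjunct2, rule_format])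
  show "L2 (d2 v)" unfolding d2_def by (rule 2[THEN conjunct1])
  show "fc (d2 v) k = cmul (\<i> * of_int (snd k)) (fc v k)"
    unfolding d2_def by (rule 2[THEN conjunct2, rule_format])
qed

lemma Hnorm_derivatives:
  assumes v: "Vsp v"
  shows "(Hnorm (d1 v))\<^sup>2 + (Hnorm (d2 v))\<^sup>2 = (Vnorm v)\<^sup>2"
proof -
  have "((\<lambda>k. (norm (fc (d1 v) k))\<^sup>2 + (norm (fc (d2 v) k))\<^sup>2) has_sum
      ((Hnorm (d1 v))\<^sup>2 / (4 * pi\<^sup>2) + (Hnorm (d2 v))\<^sup>2 / (4 * pi\<^sup>2))) UNIV"
    by (intro has_sum_add has_sum_Hnorm L2_d1 L2_d2 v)
  moreover have "(norm (fc (d1 v) k))\<^sup>2 + (norm (fc (d2 v) k))\<^sup>2 = ksq k * (norm (fc v k))\<^sup>2" for k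
    by (simp add: fc_d1[OF v] fc_d2[OF v] norm_cmul norm_mult power_mult_distrib ksq_def distrib_right)
  ultimately have "(Hnorm (d1 v))\<^sup>2 / (4 * pi\<^sup>2) + (Hnorm (d2 v))\<^sup>2 / (4 * pi\<^sup>2) = (Vnorm v)\<^sup>2 / (4 * pi\<^sup>2)"
    using has_sum_unique[OF _ has_sum_Vnorm[OF v]] by simp
  then show ?thesis by (simp flip: add_divide_distrib)
qed

lemma cmul_diff: "cmul z (p - q) = cmul z p - cmul z q"
  by (simp add: cmul_def algebra_simps)

text \<open>The choice made by \<open>SOME\<close> need not be linear pointwise; the coefficients
  are linear, and by completeness this gives linearity almost everywhere.\<close>

lemma AE_d1_diff: "Vsp u \<Longrightarrow> Vsp v \<Longrightarrow> AE x in torus. d1 (u - v) x = d1 u x - d1 v x"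
  using AE_eq_of_fc_eq[of "d1 (u - v)" "d1 u - d1 v"]
  by (simp add: L2_d1 L2_diff Vsp_diff fc_diff fc_d1 Vsp_D cmul_diff)

lemma AE_d2_diff: "Vsp u \<Longrightarrow> Vsp v \<Longrightarrow> AE x in torus. d2 (u - v) x = d2 u x - d2 v x"
  using AE_eq_of_fc_eq[of "d2 (u - v)" "d2 u - d2 v"]
  by (simp add: L2_d2 L2_diff Vsp_diff fc_diff fc_d2 Vsp_D cmul_diff)

subsection \<open>Fields in the domain of the Stokes operator are bounded\<close>

lemma summable_on_inverse_squares_int: "(\<lambda>a::int. 1 / (1 + (real_of_int a)\<^sup>2)) summable_on UNIV"
proof -
  let ?g = "\<lambda>a::int. 1 / (1 + (real_of_int a)\<^sup>2)"
  have "summable (\<lambda>n. norm (1 / (1 + (real n)\<^sup>2)))"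
  proof (rule summable_comparison_test')
    show "summable (\<lambda>n. inverse ((real n) ^ 2))" by (rule inverse_power_summable) simp
    show "norm (norm (1 / (1 + (real n)\<^sup>2))) \<le> inverse ((real n) ^ 2)" if "n \<ge> 1" for n
      using that by (auto simp: field_simps add_pos_nonneg)
  qed
  then have nat: "(\<lambda>n. 1 / (1 + (real n)\<^sup>2)) summable_on UNIV"
    by (rule norm_summable_imp_summable_on)
  have "?g summable_on range int" "?g summable_on range (\<lambda>n. - int n)"
    using nat by (subst summable_on_reindex; auto simp: inj_on_def o_def)+
  then have "?g summable_on (range int \<union> range (\<lambda>n. - int n))" by (rule summable_on_union)
  also have "range int \<union> range (\<lambda>n. - int n) = UNIV"
    by (auto, metis int_cases2 rangeI)
  finally show ?thesis .
qed

text \<open>The term at \<open>k = 0\<close> is 0 by the convention for division by zero. Elsewhere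
  \<open>s = ksq k\<close> is at least 1, so \<open>(1 + x) * (1 + y) = 1 + s + x * y\<close> is at
  most \<open>4 * s^2\<close>, and the lattice sum is dominated by a product of two convergent
  one-dimensional sums.\<close>

lemma summable_on_inverse_ksq: "(\<lambda>k. 1 / (ksq k)\<^sup>2) summable_on UNIV"
proof -
  let ?g = "\<lambda>a::int. 1 / (1 + (real_of_int a)\<^sup>2)"
  have bd: "sum ?g F \<le> infsum ?g UNIV" if "finite F" for F
    using summable_on_inverse_squares_int that by (intro finite_sum_le_infsum) auto
  have le: "1 / (ksq k)\<^sup>2 \<le> 4 * (?g (fst k) * ?g (snd k))" for k
  proof (cases "k = 0")
    case False
    define s where "s = ksq k"
    define x y where "x = (real_of_int (fst k))\<^sup>2" and "y = (real_of_int (snd k))\<^sup>2"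
    have xy: "0 \<le> x" "0 \<le> y" "s = x + y" "1 \<le> s" using ksq_ge_1[OF False] by (auto simp: x_def y_def s_def ksq_def)
    have "x * y \<le> s * s" using xy by (intro mult_mono) auto
    moreover have "s \<le> s * s" using xy by simp
    moreover have "(1 + x) * (1 + y) = 1 + s + x * y" by (simp add: xy(3) algebra_simps)
    ultimately have "(1 + x) * (1 + y) \<le> 4 * (s * s)" using xy(4) by linarith
    moreover have "0 < (1 + x) * (1 + y)" "0 < s * s" using xy by (auto intro!: mult_pos_pos)
    ultimately have "1 / (s * s) \<le> 4 / ((1 + x) * (1 + y))"
      by (simp add: field_simps)
    then show ?thesis by (simp add: s_def x_def y_def power2_eq_square)
  qed simp
  show ?thesis
  proof (rule nonneg_bdd_above_summable_on)
    show "bdd_above (sum (\<lambda>k. 1 / (ksq k)\<^sup>2) ` {F. F \<subseteq> UNIV \<and> finite F})"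
    proof (rule bdd_aboveI2)
      fix F :: "wn set" assume "F \<in> {F. F \<subseteq> UNIV \<and> finite F}"
      then have F: "finite F" by simp
      have "(\<Sum>k\<in>F. 1 / (ksq k)\<^sup>2) \<le> (\<Sum>k\<in>F. 4 * (?g (fst k) * ?g (snd k)))"
        by (intro sum_mono le)
      also have "\<dots> \<le> (\<Sum>k\<in>fst ` F \<times> snd ` F. 4 * (?g (fst k) * ?g (snd k)))"
        using F subset_fst_snd[of F] by (intro sum_mono2) auto
      also have "\<dots> = 4 * (\<Sum>k\<in>fst ` F \<times> snd ` F. ?g (fst k) * ?g (snd k))"
        by (rule sum_distrib_left[symmetric])
      also have "\<dots> = 4 * (sum ?g (fst ` F) * sum ?g (snd ` F))"
        unfolding sum_product sum.cartesian_product case_prod_unfold ..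
      also have "\<dots> \<le> 4 * (infsum ?g UNIV * infsum ?g UNIV)"
        using F by (intro mult_left_mono mult_mono bd) (auto intro!: sum_nonneg infsum_nonneg)
      finally show "(\<Sum>k\<in>F. 1 / (ksq k)\<^sup>2) \<le> 4 * (infsum ?g UNIV * infsum ?g UNIV)" .
    qed
  qed simp
qed

lemma DA_imp_Vsp: "DA u \<Longrightarrow> Vsp u"
  unfolding DA_def Vsp_def
proof (elim conjE, intro conjI)
  assume u: "Hsp u" "(\<lambda>k. (ksq k)\<^sup>2 * (norm (fc u k))\<^sup>2) summable_on UNIV"
  show "(\<lambda>k. ksq k * (norm (fc u k))\<^sup>2) summable_on UNIV"
  proof (rule summable_on_comparison_test[OF u(2)])
    show "ksq k * (norm (fc u k))\<^sup>2 \<le> (ksq k)\<^sup>2 * (norm (fc u k))\<^sup>2" for k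
    proof (rule mult_right_mono)
      show "ksq k \<le> (ksq k)\<^sup>2"
        using ksq_ge_1[of k] by (cases "k = 0") (auto simp: power2_eq_square)
    qed simp
  qed simp
qed

lemma DA_diff:
  assumes u: "DA u" and v: "DA v"
  shows "DA (u - v)"
  unfolding DA_def
proof
  show "Hsp (u - v)" using u v by (auto simp: DA_def intro: Hsp_diff)
  have f: "fc (u - v) k = fc u k - fc v k" for k
    using u v by (intro fc_diff) (auto simp: DA_def dest: Vsp_D)
  show "(\<lambda>k. (ksq k)\<^sup>2 * (norm (fc (u - v) k))\<^sup>2) summable_on UNIV"
  proof (rule summable_on_comparison_test)
    show "(\<lambda>k. 2 * ((ksq k)\<^sup>2 * (norm (fc u k))\<^sup>2) + 2 * ((ksq k)\<^sup>2 * (norm (fc v k))\<^sup>2)) summable_on UNIV"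
      using u v by (intro summable_on_add summable_on_cmult_right) (auto simp: DA_def)
    show "(ksq k)\<^sup>2 * (norm (fc (u - v) k))\<^sup>2 \<le> 2 * ((ksq k)\<^sup>2 * (norm (fc u k))\<^sup>2) + 2 * ((ksq k)\<^sup>2 * (norm (fc v k))\<^sup>2)" for k
      using mult_left_mono[OF norm_add_squared_le[of "fc u k" "- fc v k"], of "(ksq k)\<^sup>2"]
      by (simp add: f algebra_simps)
  qed simp
qed

lemma has_sum_Anorm: "DA u \<Longrightarrow> ((\<lambda>k. (ksq k)\<^sup>2 * (norm (fc u k))\<^sup>2) has_sum (Anorm u)\<^sup>2 / (4 * pi\<^sup>2)) UNIV"
  by (simp add: DA_def Anorm_def infsum_nonneg)

lemma Anorm_nonneg [simp]: "0 \<le> Anorm u"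
  by (simp add: Anorm_def infsum_nonneg)

text \<open>Cauchy-Schwarz bounds the sum of \<open>norm (fc u k)\<close> by the square root of the
  sum of \<open>1 / (ksq k)^2\<close> times \<open>Anorm u / (2 * pi)\<close>. The constant is twice
  that factor, so that each of the two components of a field accounts for one half.\<close>

definition agmon_const :: real where
  "agmon_const = sqrt (\<Sum>\<^sub>\<infinity>k. 1 / (ksq k)\<^sup>2) / pi"

lemma agmon_const_nonneg [simp]: "0 \<le> agmon_const"
  by (simp add: agmon_const_def infsum_nonneg)

lemma sum_norm_fc_le:
  assumes u: "DA u" and F: "finite F"
  shows "(\<Sum>k\<in>F. norm (fc u k)) \<le> agmon_const / 2 * Anorm u"
proof (rule power2_le_imp_le)
  have "norm (fc u k) = (1 / ksq k) * (ksq k * norm (fc u k))" for k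
    using u ksq_ge_1[of k] by (cases "k = 0") (auto simp: DA_def Vsp_D)
  then have "(\<Sum>k\<in>F. norm (fc u k))\<^sup>2 = (\<Sum>k\<in>F. (1 / ksq k) * (ksq k * norm (fc u k)))\<^sup>2"
    by presburger
  also have "\<dots> \<le> (\<Sum>k\<in>F. (1 / ksq k)\<^sup>2) * (\<Sum>k\<in>F. (ksq k * norm (fc u k))\<^sup>2)"
    by (rule Cauchy_Schwarz_ineq_sum)
  also have "\<dots> \<le> (\<Sum>\<^sub>\<infinity>k. 1 / (ksq k)\<^sup>2) * ((Anorm u)\<^sup>2 / (4 * pi\<^sup>2))"
  proof (intro mult_mono)
    show "(\<Sum>k\<in>F. (1 / ksq k)\<^sup>2) \<le> (\<Sum>\<^sub>\<infinity>k. 1 / (ksq k)\<^sup>2)"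
      using summable_on_inverse_ksq F by (simp add: power_divide) (rule finite_sum_le_infsum; auto)
    have "(\<Sum>k\<in>F. (ksq k * norm (fc u k))\<^sup>2) \<le> infsum (\<lambda>k. (ksq k)\<^sup>2 * (norm (fc u k))\<^sup>2) UNIV"
      unfolding power_mult_distrib using u F by (intro finite_sum_le_infsum) (auto simp: DA_def)
    then show "(\<Sum>k\<in>F. (ksq k * norm (fc u k))\<^sup>2) \<le> (Anorm u)\<^sup>2 / (4 * pi\<^sup>2)"
      using infsumI[OF has_sum_Anorm[OF u]] by simp
  qed (auto intro!: sum_nonneg infsum_nonneg)
  also have "\<dots> = (agmon_const / 2 * Anorm u)\<^sup>2"
    by (simp add: agmon_const_def power_mult_distrib power_divide infsum_nonneg)
  finally show "(\<Sum>k\<in>F. norm (fc u k))\<^sup>2 \<le> (agmon_const / 2 * Anorm u)\<^sup>2" .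
qed simp

text \<open>The series converges absolutely at every point to a bounded \<open>g\<close>. The
  constant \<open>B\<close> dominates all partial sums, so \<open>g\<close> inherits the
  coefficients of \<open>f\<close>, and completeness identifies the two.\<close>

lemma AE_trig_sum_tendsto:
  assumes f: "sqint f" and B: "\<And>F. finite F \<Longrightarrow> (\<Sum>k\<in>F. norm (fcoef f k)) \<le> B"
  shows "AE x in torus. (\<lambda>n. trig_sum (fcoef f) (Kbox n) x) \<longlonglongrightarrow> f x"
    and "norm (trig_sum (fcoef f) (Kbox n) x) \<le> B"
proof -
  show nle: "norm (trig_sum (fcoef f) (Kbox n) x) \<le> B" for n x
    unfolding trig_sum_def by (rule order_trans[OF norm_sum]) (simp add: norm_mult B)
  have "\<exists>l. ((\<lambda>k. fcoef f k * ex k x) has_sum l) UNIV" for x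
  proof -
    have "(\<lambda>k. norm (fcoef f k * ex k x)) summable_on UNIV"
    proof (rule nonneg_bdd_above_summable_on)
      show "bdd_above (sum (\<lambda>k. norm (fcoef f k * ex k x)) ` {F. F \<subseteq> UNIV \<and> finite F})"
        by (rule bdd_aboveI2[where M = B]) (simp add: norm_mult B)
    qed simp
    from abs_summable_summable[OF this] show ?thesis by (simp add: summable_on_def)
  qed
  then obtain g where g: "\<And>x. ((\<lambda>k. fcoef f k * ex k x) has_sum g x) UNIV" by metis
  have lim: "(\<lambda>n. trig_sum (fcoef f) (Kbox n) x) \<longlonglongrightarrow> g x" for x
    unfolding trig_sum_def by (rule has_sum_Kbox[OF g])
  have gm [measurable]: "g \<in> borel_measurable torus"
    by (rule borel_measurable_LIMSEQ_metric[OF sqint_measurable[OF sqint_trig_sum] lim])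
  have gb: "norm (g x) \<le> B" for x
    by (rule LIMSEQ_le_const2[OF tendsto_norm[OF lim]]) (use nle in auto)
  have gi: "integrable torus g" by (rule integrable_torus_bounded[OF gm gb])
  have "fcoef g k = fcoef f k" for k
  proof (rule LIMSEQ_unique)
    have "(\<lambda>n. \<integral>x. trig_sum (fcoef f) (Kbox n) x * cnj (ex k x) \<partial>torus) \<longlonglongrightarrow> (\<integral>x. g x * cnj (ex k x) \<partial>torus)"
    proof (rule integral_dominated_convergence[where w = "\<lambda>x. B"])
      show "AE x in torus. (\<lambda>n. trig_sum (fcoef f) (Kbox n) x * cnj (ex k x)) \<longlonglongrightarrow> g x * cnj (ex k x)"
        by (intro AE_I2 tendsto_mult_right lim)
      show "AE x in torus. norm (trig_sum (fcoef f) (Kbox n) x * cnj (ex k x)) \<le> B" for n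
        using nle by (simp add: norm_mult)
      show "(\<lambda>x. trig_sum (fcoef f) (Kbox n) x * cnj (ex k x)) \<in> borel_measurable torus" for n
        using sqint_measurable[OF sqint_trig_sum, of "fcoef f" "Kbox n"] by measurable
    qed auto
    then show "(\<lambda>n. fcoef (trig_sum (fcoef f) (Kbox n)) k) \<longlonglongrightarrow> fcoef g k"
      unfolding fcoef_def[of g] fcoef_def[of "trig_sum _ _"] by (rule tendsto_divide) auto
    have "fcoef (trig_sum (fcoef f) (Kbox n)) k = fcoef f k" if "n \<ge> nat \<bar>fst k\<bar> + nat \<bar>snd k\<bar>" for n
      using in_Kbox[OF that] by (simp add: fcoef_trig_sum)
    then have "\<forall>\<^sub>F n in sequentially. fcoef (trig_sum (fcoef f) (Kbox n)) k = fcoef f k"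
      by (auto simp: eventually_sequentially)
    then show "(\<lambda>n. fcoef (trig_sum (fcoef f) (Kbox n)) k) \<longlonglongrightarrow> fcoef f k"
      by (rule tendsto_eventually)
  qed
  then have "AE x in torus. g x = f x"
    by (intro AE_eq_of_fcoef_eq gi sqint_imp_integrable f)
  then show "AE x in torus. (\<lambda>n. trig_sum (fcoef f) (Kbox n) x) \<longlonglongrightarrow> f x"
    by eventually_elim (use lim in metis)
qed

text \<open>\<open>j\<close> and \<open>jc\<close> select the same component of real and of complex
  pairs, so that one proof covers both components.\<close>

lemma DA_components:
  assumes u: "DA u" and j: "j = (\<lambda>p::real \<times> real. fst p) \<and> jc = (\<lambda>p::complex \<times> complex. fst p) \<or> j = (\<lambda>p. snd p) \<and> jc = (\<lambda>p. snd p)"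
  shows "AE x in torus. (\<lambda>n. trig_sum (\<lambda>k. jc (fc u k)) (Kbox n) x) \<longlonglongrightarrow> complex_of_real (j (u x))"
    and "norm (trig_sum (\<lambda>k. jc (fc u k)) (Kbox n) x) \<le> agmon_const / 2 * Anorm u"
    and "AE x in torus. \<bar>j (u x)\<bar> \<le> agmon_const / 2 * Anorm u"
proof -
  have L: "L2 u" using u by (simp add: DA_def Vsp_D)
  have eq: "jc (fc u k) = fcoef (\<lambda>x. complex_of_real (j (u x))) k" for k
    using j by (auto simp: fc_eq_fcoef)
  have sq: "sqint (\<lambda>x. complex_of_real (j (u x)))" using j L2_compD[OF L] by auto
  have B: "(\<Sum>k\<in>F. norm (fcoef (\<lambda>x. complex_of_real (j (u x))) k)) \<le> agmon_const / 2 * Anorm u" if "finite F" for F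
  proof -
    have "norm (jc p) \<le> norm p" for p using j norm_component_le[of p] by auto
    then have "(\<Sum>k\<in>F. norm (jc (fc u k))) \<le> (\<Sum>k\<in>F. norm (fc u k))" by (intro sum_mono)
    also have "\<dots> \<le> agmon_const / 2 * Anorm u" by (rule sum_norm_fc_le[OF u that])
    finally show ?thesis by (simp only: eq)
  qed
  show 1: "AE x in torus. (\<lambda>n. trig_sum (\<lambda>k. jc (fc u k)) (Kbox n) x) \<longlonglongrightarrow> complex_of_real (j (u x))"
    unfolding eq by (rule AE_trig_sum_tendsto(1)[OF sq B])
  show 2: "norm (trig_sum (\<lambda>k. jc (fc u k)) (Kbox n) x) \<le> agmon_const / 2 * Anorm u" for n x
    unfolding eq by (rule AE_trig_sum_tendsto(2)[OF sq B])
  show "AE x in torus. \<bar>j (u x)\<bar> \<le> agmon_const / 2 * Anorm u"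
    using 1
  proof eventually_elim
    case (elim x)
    have "norm (complex_of_real (j (u x))) \<le> agmon_const / 2 * Anorm u"
      by (rule LIMSEQ_le_const2[OF tendsto_norm[OF elim]]) (use 2 in blast)
    then show ?case by simp
  qed
qed

lemma AE_norm_le_Anorm:
  assumes u: "DA u"
  shows "AE x in torus. norm (u x) \<le> agmon_const * Anorm u"
proof -
  have "AE x in torus. \<bar>fst (u x)\<bar> \<le> agmon_const / 2 * Anorm u"
    by (rule DA_components(3)[OF u, of fst fst]) auto
  moreover have "AE x in torus. \<bar>snd (u x)\<bar> \<le> agmon_const / 2 * Anorm u"
    by (rule DA_components(3)[OF u, of snd snd]) auto
  ultimately show ?thesis
  proof eventually_elim
    case (elim x)
    have "norm (u x) \<le> \<bar>fst (u x)\<bar> + \<bar>snd (u x)\<bar>"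
      using norm_Pair_le[of "fst (u x)" "snd (u x)"] by simp
    then show ?case using elim by linarith
  qed
qed

subsection \<open>The nonlinear term\<close>

lemma Hsp_div: "Hsp u \<Longrightarrow> of_int (fst k) * fst (fc u k) + of_int (snd k) * snd (fc u k) = 0"
  unfolding Hsp_def by blast

lemma has_sum_complexI:
  assumes "((\<lambda>k. Re (h k)) has_sum Re S) A" "((\<lambda>k. Im (h k)) has_sum Im S) A"
  shows "(h has_sum S) A"
proof -
  have "((\<lambda>k. complex_of_real (Re (h k)) + \<i> * complex_of_real (Im (h k))) has_sum
      (complex_of_real (Re S) + \<i> * complex_of_real (Im S))) A"
    by (intro has_sum_add has_sum_cmult_right has_sum_of_real assms)
  then show ?thesis by (simp add: complex_eq[symmetric])
qed

text \<open>The imaginary part is the real inner product with \<open>\<i> * g\<close>, so both parts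
  follow from the real form of Parseval's identity.\<close>

lemma has_sum_fcoef_mult_cnj:
  assumes f: "sqint f" and g: "sqint g"
  shows "((\<lambda>k. fcoef f k * cnj (fcoef g k)) has_sum (\<integral>x. f x * cnj (g x) \<partial>torus) / (4 * pi\<^sup>2)) UNIV"
proof (rule has_sum_complexI)
  have i: "integrable torus (\<lambda>x. f x * cnj (g x))"
    by (intro integrable_mult_sqint sqint_cnj f g)
  have re: "Re (a * cnj b) = a \<bullet> b" and im: "Im (a * cnj b) = a \<bullet> (\<i> * b)" for a b
    by (simp_all add: inner_complex_def)
  have d: "Re (z / (4 * (complex_of_real pi)\<^sup>2)) = Re z / (4 * pi\<^sup>2)" "Im (z / (4 * (complex_of_real pi)\<^sup>2)) = Im z / (4 * pi\<^sup>2)" for z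
    using Re_divide_of_real[of z "4 * pi\<^sup>2"] Im_divide_of_real[of z "4 * pi\<^sup>2"] by simp_all
  show "((\<lambda>k. Re (fcoef f k * cnj (fcoef g k))) has_sum Re ((\<integral>x. f x * cnj (g x) \<partial>torus) / (4 * pi\<^sup>2))) UNIV"
    using has_sum_fcoef_inner[OF f g] integral_Re[OF i] unfolding re by (simp add: d)
  show "((\<lambda>k. Im (fcoef f k * cnj (fcoef g k))) has_sum Im ((\<integral>x. f x * cnj (g x) \<partial>torus) / (4 * pi\<^sup>2))) UNIV"
    using has_sum_fcoef_inner[OF f sqint_mult_left[OF g, of \<i>]] integral_Im[OF i] unfolding im by (simp add: d fcoef_cmult)
qed

text \<open>Integration by parts against a single mode: substituting \<open>m \<mapsto> k - m\<close> in the Parseval sum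
  of the left-hand side and averaging replaces the weight \<open>\<kappa> m\<close> by \<open>\<kappa> k / 2\<close>.\<close>

lemma integral_ex_derivative:
  fixes f g :: "real \<times> real \<Rightarrow> real" and \<kappa> :: "wn \<Rightarrow> int"
  assumes f: "sqint f" and g: "sqint g" and lin: "\<And>m k. \<kappa> (m - k) = \<kappa> m - \<kappa> k"
    and fg: "\<And>m. fcoef (\<lambda>x. complex_of_real (g x)) m = \<i> * of_int (\<kappa> m) * fcoef (\<lambda>x. complex_of_real (f x)) m"
  shows "2 * (\<integral>x. ex k x * complex_of_real (f x * g x) \<partial>torus) =
    - (\<i> * of_int (\<kappa> k)) * (\<integral>x. ex k x * complex_of_real (f x * f x) \<partial>torus)"
proof -
  define a where "a m = fcoef (\<lambda>x. complex_of_real (f x)) m" for m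
  define X Y where "X = (\<integral>x. ex k x * complex_of_real (f x * g x) \<partial>torus)"
    and "Y = (\<integral>x. ex k x * complex_of_real (f x * f x) \<partial>torus)"
  have am: "a (- m) = cnj (a m)" for m
    using fcoef_cnj[of "\<lambda>x. complex_of_real (f x)" "- m"] by (simp add: a_def)
  note F = sqint_ex_mult[OF sqint_of_real[OF f], of k]
  have sX: "((\<lambda>m. a (m - k) * cnj (\<i> * of_int (\<kappa> m) * a m)) has_sum X / (4 * pi\<^sup>2)) UNIV"
    using has_sum_fcoef_mult_cnj[OF F sqint_of_real[OF g]]
    by (simp add: fcoef_ex_mult fg a_def X_def mult.assoc)
  have sY: "((\<lambda>m. a (m - k) * cnj (a m)) has_sum Y / (4 * pi\<^sup>2)) UNIV"
    using has_sum_fcoef_mult_cnj[OF F sqint_of_real[OF f]]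
    by (simp add: fcoef_ex_mult a_def Y_def mult.assoc)
  have "bij_betw (\<lambda>m. k - m) UNIV (UNIV :: wn set)"
    by (rule bij_betw_byWitness[where f' = "\<lambda>m. k - m"]) auto
  from has_sum_reindex_bij_betw[OF this, of "\<lambda>m. a (m - k) * cnj (\<i> * of_int (\<kappa> m) * a m)"] sX
  have s1: "((\<lambda>m. a (k - m - k) * cnj (\<i> * of_int (\<kappa> (k - m)) * a (k - m))) has_sum X / (4 * pi\<^sup>2)) UNIV"
    by simp
  have eq1: "a (k - m - k) * cnj (\<i> * of_int (\<kappa> (k - m)) * a (k - m)) =
      - \<i> * (of_int (\<kappa> k) - of_int (\<kappa> m)) * (a (m - k) * cnj (a m))" for m
    using am[of m] am[of "m - k"] by (simp add: lin)
  have eq2: "- \<i> * (of_int (\<kappa> k) - of_int (\<kappa> m)) * (a (m - k) * cnj (a m)) + a (m - k) * cnj (\<i> * of_int (\<kappa> m) * a m) =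
      - (\<i> * of_int (\<kappa> k)) * (a (m - k) * cnj (a m))" for m
    by (simp add: algebra_simps)
  have "((\<lambda>m. - (\<i> * of_int (\<kappa> k)) * (a (m - k) * cnj (a m))) has_sum (X / (4 * pi\<^sup>2) + X / (4 * pi\<^sup>2))) UNIV"
    using has_sum_add[OF s1[unfolded eq1] sX] by (simp only: eq2)
  from has_sum_unique[OF this has_sum_cmult_right[OF sY]]
  have "2 * X / (4 * pi\<^sup>2) = - (\<i> * of_int (\<kappa> k)) * Y / (4 * pi\<^sup>2)"
    by simp
  then have "2 * X = - (\<i> * of_int (\<kappa> k)) * Y"
    unfolding divide_cancel_right by simp
  then show ?thesis unfolding X_def Y_def .
qed

lemma integrable_ex_mult: "integrable torus f \<Longrightarrow> integrable torus (\<lambda>x. ex k x * f x)"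
  by (simp add: mult.commute[of "ex k _"] integrable_mult_ex)

text \<open>Against the mode \<open>k\<close> of \<open>u\<close>, integration by parts leaves the
  integral of \<open>ex k * f^2\<close> with the factor \<open>k . u_k\<close>, up to a constant,
  and this factor vanishes because \<open>u\<close> is divergence-free. The partial sums of
  \<open>u\<close> are uniformly bounded, which justifies passing to the limit.\<close>

lemma integral_transport_eq_0:
  fixes f g h :: "real \<times> real \<Rightarrow> real"
  assumes u: "DA u" and f: "sqint f" and g: "sqint g" and h: "sqint h"
    and fg: "\<And>m. fcoef (\<lambda>x. complex_of_real (g x)) m = \<i> * of_int (fst m) * fcoef (\<lambda>x. complex_of_real (f x)) m"
    and fh: "\<And>m. fcoef (\<lambda>x. complex_of_real (h x)) m = \<i> * of_int (snd m) * fcoef (\<lambda>x. complex_of_real (f x)) m"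
  shows "(\<integral>x. (fst (u x) * g x + snd (u x) * h x) * f x \<partial>torus) = 0"
proof -
  let ?G = "\<lambda>x. complex_of_real (f x * g x)" and ?H = "\<lambda>x. complex_of_real (f x * h x)"
  let ?s = "\<lambda>n. trig_sum (\<lambda>k. fst (fc u k)) (Kbox n)" and ?t = "\<lambda>n. trig_sum (\<lambda>k. snd (fc u k)) (Kbox n)"
  let ?B = "agmon_const / 2 * Anorm u"
  have GI: "integrable torus ?G" and HI: "integrable torus ?H"
    using integrable_mult_sqint[OF f g] integrable_mult_sqint[OF f h] by (auto simp del: of_real_mult)
  have ie: "integrable torus (\<lambda>x. ex k x * ?G x)" "integrable torus (\<lambda>x. ex k x * ?H x)" for k
    by (rule integrable_ex_mult[OF GI], rule integrable_ex_mult[OF HI])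
  have p_eq: "?s n x * ?G x + ?t n x * ?H x =
      (\<Sum>k\<in>Kbox n. fst (fc u k) * (ex k x * ?G x) + snd (fc u k) * (ex k x * ?H x))" for n x
    by (simp only: trig_sum_def sum_distrib_right sum.distrib mult.assoc)
  have z: "(\<integral>x. ?s n x * ?G x + ?t n x * ?H x \<partial>torus) = 0" for n
  proof -
    have "fst (fc u k) * (\<integral>x. ex k x * ?G x \<partial>torus) + snd (fc u k) * (\<integral>x. ex k x * ?H x \<partial>torus) = 0" for k
    proof -
      let ?Y = "\<integral>x. ex k x * complex_of_real (f x * f x) \<partial>torus"
      have G2: "2 * (\<integral>x. ex k x * ?G x \<partial>torus) = - (\<i> * of_int (fst k)) * ?Y"
        by (rule integral_ex_derivative[OF f g _ fg]) simp
      have H2: "2 * (\<integral>x. ex k x * ?H x \<partial>torus) = - (\<i> * of_int (snd k)) * ?Y"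
        by (rule integral_ex_derivative[OF f h _ fh]) simp
      have lin: "2 * (p * a + q * b) = - \<i> * y * (c * p + d * q)"
        if "2 * a = - (\<i> * c) * y" "2 * b = - (\<i> * d) * y" for p q a b c d y :: complex
      proof -
        have "2 * (p * a + q * b) = p * (2 * a) + q * (2 * b)" by (simp add: algebra_simps)
        then show ?thesis unfolding that by (simp add: algebra_simps)
      qed
      have "2 * (fst (fc u k) * (\<integral>x. ex k x * ?G x \<partial>torus) + snd (fc u k) * (\<integral>x. ex k x * ?H x \<partial>torus)) =
          - \<i> * ?Y * (of_int (fst k) * fst (fc u k) + of_int (snd k) * snd (fc u k))"
        by (rule lin[OF G2 H2])
      also have "\<dots> = 0" using u by (simp only: DA_def Hsp_div mult_zero_right)
      finally show ?thesis unfolding mult_eq_0_iff[of 2] by (simp only: zero_neq_numeral[symmetric] simp_thms)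
    qed
    note zz = this
    have "(\<Sum>k\<in>Kbox n. fst (fc u k) * (\<integral>x. ex k x * ?G x \<partial>torus) + snd (fc u k) * (\<integral>x. ex k x * ?H x \<partial>torus)) = 0"
      by (simp only: zz sum.neutral_const)
    moreover have "(\<integral>x. (\<Sum>k\<in>Kbox n. fst (fc u k) * (ex k x * ?G x) + snd (fc u k) * (ex k x * ?H x)) \<partial>torus) =
        (\<Sum>k\<in>Kbox n. fst (fc u k) * (\<integral>x. ex k x * ?G x \<partial>torus) + snd (fc u k) * (\<integral>x. ex k x * ?H x \<partial>torus))"
      by (simp only: Bochner_Integration.integral_sum Bochner_Integration.integral_add integral_mult_right_zero
          integrable_mult_right Bochner_Integration.integrable_add ie)
    ultimately show ?thesis unfolding p_eq by (simp only:)
  qed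
  have lim: "(\<lambda>n. \<integral>x. ?s n x * ?G x + ?t n x * ?H x \<partial>torus) \<longlonglongrightarrow>
      (\<integral>x. complex_of_real ((fst (u x) * g x + snd (u x) * h x) * f x) \<partial>torus)"
  proof (rule integral_dominated_convergence[where w = "\<lambda>x. ?B * norm (?G x) + ?B * norm (?H x)"])
    have "sqint (\<lambda>x. fst (u x))" "sqint (\<lambda>x. snd (u x))"
      using u by (auto simp: DA_def Hsp_def L2_iff_components)
    then have [measurable]: "(\<lambda>x. fst (u x)) \<in> borel_measurable torus" "(\<lambda>x. snd (u x)) \<in> borel_measurable torus"
      "f \<in> borel_measurable torus" "g \<in> borel_measurable torus" "h \<in> borel_measurable torus"
      using f g h by (auto simp: sqint_def)
    have [measurable]: "trig_sum c K \<in> borel_measurable torus" for c K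
      by (rule sqint_measurable[OF sqint_trig_sum])
    show "(\<lambda>x. complex_of_real ((fst (u x) * g x + snd (u x) * h x) * f x)) \<in> borel_measurable torus"
      by measurable
    show "(\<lambda>x. ?s n x * ?G x + ?t n x * ?H x) \<in> borel_measurable torus" for n
      by measurable
    show "integrable torus (\<lambda>x. ?B * norm (?G x) + ?B * norm (?H x))"
      by (intro Bochner_Integration.integrable_add integrable_mult_right integrable_norm GI HI)
    show "AE x in torus. norm (?s n x * ?G x + ?t n x * ?H x) \<le> ?B * norm (?G x) + ?B * norm (?H x)" for n
    proof (intro AE_I2)
      fix x
      have s: "norm (?s n x) \<le> ?B" by (rule DA_components(2)[OF u, of fst fst]) auto
      have t: "norm (?t n x) \<le> ?B" by (rule DA_components(2)[OF u, of snd snd]) auto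
      have "norm (?s n x * ?G x + ?t n x * ?H x) \<le> norm (?s n x) * norm (?G x) + norm (?t n x) * norm (?H x)"
        by (rule order_trans[OF norm_triangle_ineq]) (simp only: norm_mult order_refl)
      also have "\<dots> \<le> ?B * norm (?G x) + ?B * norm (?H x)"
        by (intro add_mono mult_right_mono s t) auto
      finally show "norm (?s n x * ?G x + ?t n x * ?H x) \<le> ?B * norm (?G x) + ?B * norm (?H x)" .
    qed
    have 1: "AE x in torus. (\<lambda>n. ?s n x) \<longlonglongrightarrow> complex_of_real (fst (u x))"
      by (rule DA_components(1)[OF u, of fst fst]) auto
    have 2: "AE x in torus. (\<lambda>n. ?t n x) \<longlonglongrightarrow> complex_of_real (snd (u x))"
      by (rule DA_components(1)[OF u, of snd snd]) auto
    from 1 2 show "AE x in torus. (\<lambda>n. ?s n x * ?G x + ?t n x * ?H x) \<longlonglongrightarrow>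
        complex_of_real ((fst (u x) * g x + snd (u x) * h x) * f x)"
    proof eventually_elim
      case (elim x)
      have "(\<lambda>n. ?s n x * ?G x + ?t n x * ?H x) \<longlonglongrightarrow>
          complex_of_real (fst (u x)) * ?G x + complex_of_real (snd (u x)) * ?H x"
        by (intro tendsto_add tendsto_mult_right elim)
      also have "complex_of_real (fst (u x)) * ?G x + complex_of_real (snd (u x)) * ?H x =
          complex_of_real ((fst (u x) * g x + snd (u x) * h x) * f x)"
        by (simp add: algebra_simps)
      finally show ?case .
    qed
  qed
  have "(\<integral>x. complex_of_real ((fst (u x) * g x + snd (u x) * h x) * f x) \<partial>torus) = 0"
    by (rule LIMSEQ_unique[OF lim[unfolded z] tendsto_const])
  then show ?thesis unfolding integral_complex_of_real of_real_eq_0_iff .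
qed

lemma norm_pair_squared: "(norm z)\<^sup>2 = (fst z)\<^sup>2 + (snd z)\<^sup>2" for z :: "real \<times> real"
  by (simp add: norm_prod_def)

text \<open>Cauchy-Schwarz in each component, by way of Lagrange's identity.\<close>

lemma norm_adv_squared_le: "(norm (adv u v x))\<^sup>2 \<le> (norm (u x))\<^sup>2 * ((norm (d1 v x))\<^sup>2 + (norm (d2 v x))\<^sup>2)"
proof -
  have cs: "(a * p + b * q)\<^sup>2 \<le> (a\<^sup>2 + b\<^sup>2) * (p\<^sup>2 + q\<^sup>2)" for a b p q :: real
  proof -
    have "(a\<^sup>2 + b\<^sup>2) * (p\<^sup>2 + q\<^sup>2) - (a * p + b * q)\<^sup>2 = (a * q - b * p)\<^sup>2"
      by (simp add: power2_eq_square algebra_simps)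
    then show ?thesis using zero_le_power2[of "a * q - b * p"] by linarith
  qed
  have "(norm (adv u v x))\<^sup>2 \<le> (norm (u x))\<^sup>2 * ((fst (d1 v x))\<^sup>2 + (fst (d2 v x))\<^sup>2) +
      (norm (u x))\<^sup>2 * ((snd (d1 v x))\<^sup>2 + (snd (d2 v x))\<^sup>2)"
    unfolding norm_pair_squared adv_def fst_conv snd_conv by (intro add_mono cs)
  then show ?thesis by (simp add: norm_pair_squared algebra_simps)
qed

text \<open>A bounded field times square integrable derivatives; the boundedness of \<open>u\<close>
  comes from \<open>DA u\<close>.\<close>

lemma L2_adv:
  assumes u: "DA u" and v: "Vsp v"
  shows "L2 (adv u v)"
proof -
  have uc: "(\<lambda>x. fst (u x)) \<in> borel_measurable torus" "(\<lambda>x. snd (u x)) \<in> borel_measurable torus"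
    using u by (auto simp: DA_def Hsp_def L2_iff_components sqint_def)
  have ub: "AE x in torus. norm (fst (u x)) \<le> agmon_const / 2 * Anorm u"
    "AE x in torus. norm (snd (u x)) \<le> agmon_const / 2 * Anorm u"
    using DA_components(3)[OF u, of fst fst] DA_components(3)[OF u, of snd snd] by auto
  have dc: "sqint (\<lambda>x. fst (d1 v x))" "sqint (\<lambda>x. snd (d1 v x))" "sqint (\<lambda>x. fst (d2 v x))" "sqint (\<lambda>x. snd (d2 v x))"
    using L2_d1[OF v] L2_d2[OF v] by (auto simp: L2_iff_components)
  show ?thesis
    unfolding L2_iff_components adv_def fst_conv snd_conv
    by (intro conjI sqint_add sqint_bounded_mult[OF _ uc(1) ub(1)] sqint_bounded_mult[OF _ uc(2) ub(2)] dc)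
qed

lemma integrable_norm_squared: "L2 u \<Longrightarrow> integrable torus (\<lambda>x. (norm (u x))\<^sup>2)"
  by (simp add: L2_iff_sqint sqint_def)

text \<open>Coarse, but along a strong solution the right-hand side is \<open>(Anorm u)^2\<close>
  times a factor bounded on finite time intervals, hence a majorant that is integrable in
  time.\<close>

lemma Hnorm_adv_le:
  assumes u: "DA u" and v: "Vsp v"
  shows "(Hnorm (adv u v))\<^sup>2 \<le> (agmon_const * Anorm u)\<^sup>2 * (Vnorm v)\<^sup>2"
proof -
  let ?B = "agmon_const * Anorm u"
  have i: "integrable torus (\<lambda>x. (norm (d1 v x))\<^sup>2 + (norm (d2 v x))\<^sup>2)"
    by (intro Bochner_Integration.integrable_add integrable_norm_squared L2_d1 L2_d2 v)
  have "(Hnorm (adv u v))\<^sup>2 \<le> (\<integral>x. ?B\<^sup>2 * ((norm (d1 v x))\<^sup>2 + (norm (d2 v x))\<^sup>2) \<partial>torus)"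
    unfolding Hnorm_squared
  proof (rule integral_mono_AE)
    show "AE x in torus. (norm (adv u v x))\<^sup>2 \<le> ?B\<^sup>2 * ((norm (d1 v x))\<^sup>2 + (norm (d2 v x))\<^sup>2)"
      using AE_norm_le_Anorm[OF u]
    proof eventually_elim
      case (elim x)
      then have "(norm (u x))\<^sup>2 \<le> ?B\<^sup>2" by (intro power_mono) auto
      then show ?case
        using norm_adv_squared_le[of u v x] by (meson mult_right_mono order_trans sum_power2_ge_zero)
    qed
  qed (use i in \<open>auto intro: integrable_norm_squared L2_adv u v\<close>)
  also have "\<dots> = ?B\<^sup>2 * ((Hnorm (d1 v))\<^sup>2 + (Hnorm (d2 v))\<^sup>2)"
    by (simp add: Hnorm_squared integrable_norm_squared L2_d1 L2_d2 v)
  also have "\<dots> = ?B\<^sup>2 * (Vnorm v)\<^sup>2" by (simp only: Hnorm_derivatives[OF v])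
  finally show ?thesis .
qed

lemma integral_adv_self_eq_0:
  assumes u: "DA u" and w: "Vsp w"
  shows "(\<integral>x. adv u w x \<bullet> w x \<partial>torus) = 0"
proof -
  have wc: "sqint (\<lambda>x. fst (w x))" "sqint (\<lambda>x. snd (w x))"
    using w by (auto simp: Vsp_def Hsp_def L2_iff_components)
  have dc: "sqint (\<lambda>x. fst (d1 w x))" "sqint (\<lambda>x. snd (d1 w x))" "sqint (\<lambda>x. fst (d2 w x))" "sqint (\<lambda>x. snd (d2 w x))"
    using L2_d1[OF w] L2_d2[OF w] by (auto simp: L2_iff_components)
  have ac: "sqint (\<lambda>x. fst (u x) * fst (d1 w x) + snd (u x) * fst (d2 w x))"
    "sqint (\<lambda>x. fst (u x) * snd (d1 w x) + snd (u x) * snd (d2 w x))"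
    using L2_adv[OF u w] by (auto simp: L2_iff_components adv_def)
  have c: "fcoef (\<lambda>x. complex_of_real (fst (d1 w x))) m = \<i> * of_int (fst m) * fcoef (\<lambda>x. complex_of_real (fst (w x))) m"
    "fcoef (\<lambda>x. complex_of_real (snd (d1 w x))) m = \<i> * of_int (fst m) * fcoef (\<lambda>x. complex_of_real (snd (w x))) m"
    "fcoef (\<lambda>x. complex_of_real (fst (d2 w x))) m = \<i> * of_int (snd m) * fcoef (\<lambda>x. complex_of_real (fst (w x))) m"
    "fcoef (\<lambda>x. complex_of_real (snd (d2 w x))) m = \<i> * of_int (snd m) * fcoef (\<lambda>x. complex_of_real (snd (w x))) m" for m
    using fc_d1[OF w, of m] fc_d2[OF w, of m] by (simp_all add: fc_eq_fcoef cmul_def)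
  have "(\<integral>x. adv u w x \<bullet> w x \<partial>torus) =
      (\<integral>x. (fst (u x) * fst (d1 w x) + snd (u x) * fst (d2 w x)) * fst (w x) \<partial>torus) +
      (\<integral>x. (fst (u x) * snd (d1 w x) + snd (u x) * snd (d2 w x)) * snd (w x) \<partial>torus)"
    unfolding inner_prod_def adv_def fst_conv snd_conv inner_real_def
    by (intro Bochner_Integration.integral_add integrable_mult_sqint ac wc)
  then show ?thesis
    using integral_transport_eq_0[OF u wc(1) dc(1) dc(3) c(1) c(3)]
      integral_transport_eq_0[OF u wc(2) dc(2) dc(4) c(2) c(4)] by simp
qed

text \<open>Hoelder's inequality with exponents 4, 4, 2, in the form of Cauchy-Schwarz for the
  squared length of \<open>w\<close> and the length of the gradient of \<open>v\<close>. The former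
  is square integrable because \<open>w\<close> is bounded.\<close>

lemma integral_adv_le_L4norm:
  assumes w: "DA w" and v: "Vsp v"
  shows "\<bar>\<integral>x. adv w v x \<bullet> w x \<partial>torus\<bar> \<le> (L4norm w)\<^sup>2 * Vnorm v"
proof -
  let ?B = "agmon_const * Anorm w"
  let ?G = "\<lambda>x. sqrt ((norm (d1 v x))\<^sup>2 + (norm (d2 v x))\<^sup>2)"
  have wL: "L2 w" using w by (auto simp: DA_def Hsp_def)
  then have wm [measurable]: "w \<in> borel_measurable torus" by (simp add: L2_iff_sqint sqint_def)
  have dm [measurable]: "d1 v \<in> borel_measurable torus" "d2 v \<in> borel_measurable torus"
    using L2_d1[OF v] L2_d2[OF v] by (simp_all add: L2_iff_sqint sqint_def)
  have sW: "sqint (\<lambda>x. (norm (w x))\<^sup>2)"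
  proof (rule sqint_norm_le[of w _ ?B])
    show "AE x in torus. norm ((norm (w x))\<^sup>2) \<le> ?B * norm (w x)"
      using AE_norm_le_Anorm[OF w] by eventually_elim (auto simp: power2_eq_square intro: mult_right_mono)
  qed (use wL in \<open>auto simp: L2_iff_sqint\<close>)
  have sG: "sqint ?G"
    unfolding sqint_def
    using integrable_norm_squared[OF L2_d1[OF v]] integrable_norm_squared[OF L2_d2[OF v]] by simp
  have "\<bar>\<integral>x. adv w v x \<bullet> w x \<partial>torus\<bar> \<le> (\<integral>x. \<bar>adv w v x \<bullet> w x\<bar> \<partial>torus)"
    by (rule integral_abs_bound)
  also have "\<dots> \<le> (\<integral>x. (norm (w x))\<^sup>2 * ?G x \<partial>torus)"
  proof (rule integral_mono)
    show "integrable torus (\<lambda>x. \<bar>adv w v x \<bullet> w x\<bar>)"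
      by (intro integrable_abs integrable_inner L2_adv w v wL)
    show "integrable torus (\<lambda>x. (norm (w x))\<^sup>2 * ?G x)" by (rule integrable_mult_sqint[OF sW sG])
    show "\<bar>adv w v x \<bullet> w x\<bar> \<le> (norm (w x))\<^sup>2 * ?G x" for x
    proof -
      have "norm (adv w v x) \<le> norm (w x) * ?G x"
      proof (rule power2_le_imp_le)
        show "(norm (adv w v x))\<^sup>2 \<le> (norm (w x) * ?G x)\<^sup>2"
          using norm_adv_squared_le[of w v x] by (simp add: power_mult_distrib)
      qed simp
      then have "norm (adv w v x) * norm (w x) \<le> norm (w x) * ?G x * norm (w x)"
        by (rule mult_right_mono) simp
      then show ?thesis
        using Cauchy_Schwarz_ineq2[of "adv w v x" "w x"] by (simp add: power2_eq_square mult_ac)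
    qed
  qed
  also have "\<dots> \<le> (L4norm w)\<^sup>2 * Vnorm v"
  proof (rule power2_le_imp_le)
    have "(\<integral>x. (norm (w x))\<^sup>2 * ?G x \<partial>torus)\<^sup>2 \<le> (\<integral>x. ((norm (w x))\<^sup>2)\<^sup>2 \<partial>torus) * (\<integral>x. (?G x)\<^sup>2 \<partial>torus)"
      by (rule integral_mult_squared_le[OF sW sG])
    also have "(\<integral>x. (?G x)\<^sup>2 \<partial>torus) = (Vnorm v)\<^sup>2"
      by (simp add: Hnorm_derivatives[OF v, symmetric] Hnorm_squared integrable_norm_squared L2_d1 L2_d2 v)
    also have "(\<integral>x. ((norm (w x))\<^sup>2)\<^sup>2 \<partial>torus) = ((L4norm w)\<^sup>2)\<^sup>2"
    proof -
      have nn: "0 \<le> (\<integral>x. (norm (w x)) ^ 4 \<partial>torus)" by simp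
      have "((L4norm w)\<^sup>2)\<^sup>2 = (L4norm w) powr 4"
        by (simp add: L4norm_def)
      also have "\<dots> = (\<integral>x. (norm (w x)) ^ 4 \<partial>torus)"
        using nn by (simp add: L4norm_def set_integral_Om powr_powr)
      finally show ?thesis by simp
    qed
    finally show "(\<integral>x. (norm (w x))\<^sup>2 * ?G x \<partial>torus)\<^sup>2 \<le> ((L4norm w)\<^sup>2 * Vnorm v)\<^sup>2"
      by (simp add: power_mult_distrib)
  qed simp
  finally show ?thesis .
qed

lemma has_sum_leray_inner:
  assumes a: "L2 a" and w: "Hsp w"
  shows "((\<lambda>k. leray k (fc a k) \<bullet> fc w k) has_sum (\<integral>x. a x \<bullet> w x \<partial>torus) / (4 * pi\<^sup>2)) UNIV"
proof -
  have "leray k (fc a k) \<bullet> fc w k = fc a k \<bullet> fc w k" for k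
    using Hsp_div[OF w] Vsp_D(3)[OF w] by (intro inner_leray) auto
  then show ?thesis using has_sum_fc_inner[OF a Vsp_D(2)[OF w]] by simp
qed

lemma has_sum_Bc_self:
  assumes u: "DA u"
  shows "((\<lambda>k. Bc u u k \<bullet> fc u k) has_sum 0) UNIV"
  unfolding Bc_def
  using has_sum_leray_inner[OF L2_adv[OF u DA_imp_Vsp[OF u]], of u] u integral_adv_self_eq_0[OF u DA_imp_Vsp[OF u]]
  by (simp add: DA_def)

text \<open>With \<open>w = u - v\<close> one has \<open>B(u,u) - B(v,v) = B(w,u) + B(v,w)\<close>,
  and the last term vanishes against \<open>w\<close>. On the level of fields the splitting holds
  almost everywhere, since the derivative fields are linear up to null sets.\<close>

lemma has_sum_Bc_diff:
  assumes u: "DA u" and v: "DA v"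
  shows "((\<lambda>k. (Bc u u k - Bc v v k) \<bullet> fc (u - v) k) has_sum
    (\<integral>x. adv (u - v) u x \<bullet> (u - v) x \<partial>torus) / (4 * pi\<^sup>2)) UNIV"
proof -
  note w = DA_diff[OF u v] and Vu = DA_imp_Vsp[OF u] and Vv = DA_imp_Vsp[OF v]
  note Vw = DA_imp_Vsp[OF w]
  have Hw: "Hsp (u - v)" and Lw: "L2 (u - v)" using Vw Vsp_D by auto
  note La = L2_adv[OF u Vu] L2_adv[OF v Vv] L2_adv[OF w Vu] L2_adv[OF v Vw]
  have "AE x in torus. (adv u u - adv v v) x \<bullet> (u - v) x = adv (u - v) u x \<bullet> (u - v) x + adv v (u - v) x \<bullet> (u - v) x"
    using AE_d1_diff[OF Vu Vv] AE_d2_diff[OF Vu Vv]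
  proof eventually_elim
    case (elim x)
    have "(adv u u - adv v v) x = adv (u - v) u x + adv v (u - v) x"
      by (simp add: adv_def elim algebra_simps)
    then show ?case by (simp add: inner_add_left)
  qed
  then have "(\<integral>x. (adv u u - adv v v) x \<bullet> (u - v) x \<partial>torus) =
      (\<integral>x. adv (u - v) u x \<bullet> (u - v) x + adv v (u - v) x \<bullet> (u - v) x \<partial>torus)"
    by (intro integral_cong_AE borel_measurable_integrable Bochner_Integration.integrable_add integrable_inner La Lw L2_diff)
  also have "\<dots> = (\<integral>x. adv (u - v) u x \<bullet> (u - v) x \<partial>torus)"
    by (simp only: Bochner_Integration.integral_add[OF integrable_inner[OF La(3) Lw] integrable_inner[OF La(4) Lw]]
        integral_adv_self_eq_0[OF v Vw] add_0_right)
  finally have e: "(\<integral>x. (adv u u - adv v v) x \<bullet> (u - v) x \<partial>torus) = (\<integral>x. adv (u - v) u x \<bullet> (u - v) x \<partial>torus)" .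
  have "(Bc u u k - Bc v v k) \<bullet> fc (u - v) k = leray k (fc (adv u u - adv v v) k) \<bullet> fc (u - v) k" for k
  proof -
    have "leray k c \<bullet> fc (u - v) k = c \<bullet> fc (u - v) k" for c
      using Hsp_div[OF Hw] Vsp_D(3)[OF Hw] by (intro inner_leray) auto
    then show ?thesis by (simp only: Bc_def inner_diff_left fc_diff[OF La(1,2)])
  qed
  then show ?thesis
    using has_sum_leray_inner[OF L2_diff[OF La(1,2)] Hw] by (simp only: e)
qed

lemma sum_norm_Bc_le:
  assumes u: "DA u" and F: "finite F"
  shows "4 * pi\<^sup>2 * (\<Sum>k\<in>F. (norm (Bc u u k))\<^sup>2) \<le> (agmon_const * Anorm u)\<^sup>2 * (Vnorm u)\<^sup>2"
proof -
  note V = DA_imp_Vsp[OF u]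
  note h = has_sum_Hnorm[OF L2_adv[OF u V]]
  have "(\<Sum>k\<in>F. (norm (Bc u u k))\<^sup>2) \<le> (\<Sum>k\<in>F. (norm (fc (adv u u) k))\<^sup>2)"
    unfolding Bc_def by (intro sum_mono power_mono norm_leray) auto
  also have "\<dots> \<le> (Hnorm (adv u u))\<^sup>2 / (4 * pi\<^sup>2)"
    using finite_sum_le_infsum[OF has_sum_imp_summable[OF h] F] infsumI[OF h] by simp
  finally show ?thesis using Hnorm_adv_le[OF u V] by (simp add: field_simps)
qed

section \<open>Energy balances in time\<close>

text \<open>A continuous factor is bounded on the compact interval, so the product is dominated by a
  multiple of \<open>norm (f r)\<close>.\<close>

lemma integrable_inner_continuous:
  fixes c f :: "real \<Rightarrow> 'a::euclidean_space"
  assumes f: "f absolutely_integrable_on {a..b}" and c: "continuous_on {a..b} c"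
  shows "(\<lambda>r. f r \<bullet> c r) absolutely_integrable_on {a..b}"
proof -
  obtain B where "\<forall>y\<in>c ` {a..b}. norm y \<le> B"
    using compact_imp_bounded[OF compact_continuous_image[OF c compact_Icc]] unfolding bounded_iff by blast
  then have B: "norm (c r) \<le> B" if "r \<in> {a..b}" for r using that by blast
  have "f integrable_on {a..b}" using f by (rule set_lebesgue_integral_eq_integral(1))
  then have fm: "f \<in> borel_measurable (lebesgue_on {a..b})" by (rule integrable_imp_measurable)
  have cm: "c \<in> borel_measurable (lebesgue_on {a..b})"
    by (intro integrable_imp_measurable integrable_continuous_real c)
  have g: "(\<lambda>r. norm (f r) * B) integrable_on {a..b}"
    using f by (intro integrable_on_mult_left) (simp add: absolutely_integrable_on_def)
  have bd: "norm (f r \<bullet> c r) \<le> norm (f r) * B" if "r \<in> {a..b}" for r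
    using Cauchy_Schwarz_ineq2[of "f r" "c r"] mult_left_mono[OF B[OF that], of "norm (f r)"] by simp
  have "(\<lambda>r. f r \<bullet> c r) integrable_on {a..b}"
    by (rule measurable_bounded_by_integrable_imp_integrable[OF borel_measurable_inner[OF fm cm] g bd]) auto
  from absolutely_integrable_integrable_bound[OF bd this g] show ?thesis .
qed

text \<open>Telescoping over equal steps shorter than \<open>d\<close> bounds the total increment of
  \<open>H\<close> by \<open>e\<close> times that of \<open>A\<close>, for every \<open>e\<close>.
  This yields identities for absolutely continuous functions without any differentiation almost
  everywhere.\<close>

lemma eq_of_small_increments:
  fixes H A :: "real \<Rightarrow> real"
  assumes "a \<le> b"
    and inc: "\<And>e. e > 0 \<Longrightarrow> \<exists>d>0. \<forall>x y. a \<le> x \<and> x \<le> y \<and> y \<le> b \<and> y - x < d \<longrightarrow> \<bar>H y - H x\<bar> \<le> e * (A y - A x)"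
  shows "H b = H a"
proof (rule ccontr)
  assume ne: "H b \<noteq> H a"
  \<comment> \<open>Adding 1 keeps the denominator of \<open>e\<close> positive even if
    \<open>A\<close> does not change; with this \<open>e\<close> the total increment would be at
    most half of itself.\<close>
  define q where "q = \<bar>A b - A a\<bar> + 1"
  have q: "q > 0" "A b - A a \<le> q" by (auto simp: q_def)
  define e where "e = \<bar>H b - H a\<bar> / (2 * q)"
  have e: "e > 0" unfolding e_def using ne q by simp
  obtain d where d: "d > 0" and inc': "\<And>x y. a \<le> x \<Longrightarrow> x \<le> y \<Longrightarrow> y \<le> b \<Longrightarrow> y - x < d \<Longrightarrow> \<bar>H y - H x\<bar> \<le> e * (A y - A x)"
    using inc[OF e] by blast
  obtain n :: nat where n: "(b - a) / d < real n" using reals_Archimedean2 by blast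
  moreover have "0 \<le> (b - a) / d" using \<open>a \<le> b\<close> d by simp
  ultimately have n0: "0 < real n" by linarith
  define x where "x i = a + real i * ((b - a) / n)" for i
  have step: "x (Suc i) - x i = (b - a) / n" for i by (simp add: x_def distrib_right del: times_divide_eq_right)
  have small: "(b - a) / n < d" using n n0 d by (simp add: field_simps)
  have st0: "0 \<le> (b - a) / n" using \<open>a \<le> b\<close> by simp
  have xn: "x n = b" "x 0 = a" using n0 by (auto simp: x_def)
  have "\<bar>H (x (Suc i)) - H (x i)\<bar> \<le> e * (A (x (Suc i)) - A (x i))" if "i < n" for i
  proof (rule inc')
    show "a \<le> x i" unfolding x_def using mult_nonneg_nonneg[OF of_nat_0_le_iff st0, of i] by linarith
    show "x i \<le> x (Suc i)" using step[of i] st0 by linarith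
    show "x (Suc i) - x i < d" using step small by simp
    have "real (Suc i) * ((b - a) / n) \<le> real n * ((b - a) / n)"
      using that st0 by (intro mult_right_mono) auto
    then show "x (Suc i) \<le> b" using n0 by (simp add: x_def)
  qed
  then have "(\<Sum>i<n. \<bar>H (x (Suc i)) - H (x i)\<bar>) \<le> (\<Sum>i<n. e * (A (x (Suc i)) - A (x i)))"
    by (intro sum_mono) auto
  also have "\<dots> = e * (A b - A a)"
    unfolding sum_distrib_left[symmetric] sum_lessThan_telescope[of "\<lambda>i. A (x i)"] xn ..
  finally have "\<bar>\<Sum>i<n. H (x (Suc i)) - H (x i)\<bar> \<le> e * (A b - A a)"
    using sum_abs[of "\<lambda>i. H (x (Suc i)) - H (x i)" "{..<n}"] by linarith
  then have "\<bar>H b - H a\<bar> \<le> e * (A b - A a)"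
    unfolding sum_lessThan_telescope[of "\<lambda>i. H (x i)"] xn .
  also have "\<dots> \<le> e * q" using e q by (intro mult_left_mono) auto
  also have "\<dots> = \<bar>H b - H a\<bar> / 2" using q by (simp add: e_def)
  finally have "\<bar>H b - H a\<bar> \<le> \<bar>H b - H a\<bar> / 2" .
  moreover have "0 < \<bar>H b - H a\<bar>" using ne by simp
  ultimately show False by (simp add: field_simps)
qed

text \<open>The chain rule for the squared norm of an absolutely continuous \<open>c\<close>. On a
  short interval the defect is the integral of
  \<open>f r \<bullet> ((c y - c r) + (c x - c r))\<close>, which by uniform continuity is at most
  \<open>2 * e\<close> times the integral of \<open>norm (f r)\<close>; hence the choice of
  \<open>A\<close>.\<close>

lemma has_integral_norm_squared:
  fixes c f :: "real \<Rightarrow> 'a::euclidean_space"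
  assumes f: "f absolutely_integrable_on {a..b}" and ab: "a \<le> b"
    and c: "\<And>t. a \<le> t \<Longrightarrow> t \<le> b \<Longrightarrow> (f has_integral (c t - c a)) {a..t}"
  shows "((\<lambda>r. 2 * (f r \<bullet> c r)) has_integral ((norm (c b))\<^sup>2 - (norm (c a))\<^sup>2)) {a..b}"
proof -
  have fi: "f integrable_on {a..b}" using f by (rule set_lebesgue_integral_eq_integral(1))
  have ni: "(\<lambda>r. norm (f r)) integrable_on {a..b}" using f by (simp add: absolutely_integrable_on_def)
  have ceq: "c t = c a + integral {a..t} f" if "t \<in> {a..b}" for t
    using c[of t] that by (simp add: has_integral_iff)
  have "continuous_on {a..b} (\<lambda>t. c a + integral {a..t} f)"
    by (intro continuous_intros indefinite_integral_continuous_1 fi)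
  then have cc: "continuous_on {a..b} c" by (rule continuous_on_eq) (rule ceq[symmetric])
  let ?g = "\<lambda>r. 2 * (f r \<bullet> c r)"
  have gi: "?g integrable_on {a..b}"
    using set_lebesgue_integral_eq_integral(1)[OF integrable_inner_continuous[OF f cc]] by (rule integrable_on_mult_right)
  have split: "integral {a..y} h - integral {a..x} h = integral {x..y} h"
    if "h integrable_on {a..b}" "a \<le> x" "x \<le> y" "y \<le> b" for h :: "real \<Rightarrow> 'z::euclidean_space" and x y
    using Henstock_Kurzweil_Integration.integral_combine[of a x y h] integrable_on_subinterval[OF that(1), of a y] that by (simp add: algebra_simps)
  define H where "H t = (norm (c t))\<^sup>2 - integral {a..t} ?g" for t
  define A where "A t = 2 * integral {a..t} (\<lambda>r. norm (f r))" for t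
  have "H b = H a"
  proof (rule eq_of_small_increments[OF ab, of H A])
    fix e :: real assume e: "e > 0"
    have "uniformly_continuous_on {a..b} c"
      by (rule compact_uniformly_continuous[OF cc compact_Icc])
    then obtain d where d: "d > 0" "\<And>x y. x \<in> {a..b} \<Longrightarrow> y \<in> {a..b} \<Longrightarrow> dist y x < d \<Longrightarrow> dist (c y) (c x) < e"
      unfolding uniformly_continuous_on_def using e by meson
    show "\<exists>d>0. \<forall>x y. a \<le> x \<and> x \<le> y \<and> y \<le> b \<and> y - x < d \<longrightarrow> \<bar>H y - H x\<bar> \<le> e * (A y - A x)"
    proof (intro exI[of _ d] conjI allI impI)
      fix x y assume "a \<le> x \<and> x \<le> y \<and> y \<le> b \<and> y - x < d"
      then have xy: "a \<le> x" "x \<le> y" "y \<le> b" "y - x < d" by auto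
      have sub: "{x..y} \<subseteq> {a..b}" using xy by auto
      have fxy: "(f has_integral (c y - c x)) {x..y}"
        using split[OF fi xy(1-3)] ceq[of x] ceq[of y] xy integrable_on_subinterval[OF fi sub]
        by (simp add: has_integral_iff)
      have h1: "((\<lambda>r. f r \<bullet> (c y + c x)) has_integral ((c y - c x) \<bullet> (c y + c x))) {x..y}"
        using has_integral_linear[OF fxy bounded_linear_inner_left[of "c y + c x"]] by (simp add: o_def)
      have "(c y - c x) \<bullet> (c y + c x) = (norm (c y))\<^sup>2 - (norm (c x))\<^sup>2"
        by (simp add: power2_norm_eq_inner inner_diff_left inner_diff_right inner_add_right inner_commute)
      then have eq: "(c y - c x) \<bullet> (c y + c x) - integral {x..y} ?g = H y - H x"
        using split[OF gi xy(1-3)] by (simp add: H_def)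
      have h: "((\<lambda>r. f r \<bullet> (c y + c x) - ?g r) has_integral (H y - H x)) {x..y}"
        unfolding eq[symmetric]
        by (rule has_integral_diff[OF h1 integrable_integral[OF integrable_on_subinterval[OF gi sub]]])
      have "norm (H y - H x) \<le> integral {x..y} (\<lambda>r. norm (f r) * (2 * e))"
        unfolding integral_unique[OF h, symmetric]
      proof (rule integral_norm_bound_integral)
        show "(\<lambda>r. f r \<bullet> (c y + c x) - ?g r) integrable_on {x..y}" using h by blast
        show "(\<lambda>r. norm (f r) * (2 * e)) integrable_on {x..y}"
          by (intro integrable_on_mult_left integrable_on_subinterval[OF ni sub])
        fix r assume r: "r \<in> {x..y}"
        have "norm (c y - c r) < e" "norm (c x - c r) < e"
          using d(2)[of r y] d(2)[of r x] r xy by (auto simp: dist_norm)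
        then have "norm ((c y - c r) + (c x - c r)) \<le> 2 * e"
          using norm_triangle_ineq[of "c y - c r" "c x - c r"] by linarith
        moreover have "f r \<bullet> (c y + c x) - ?g r = f r \<bullet> ((c y - c r) + (c x - c r))"
          by (simp add: inner_add_right inner_diff_right)
        ultimately show "norm (f r \<bullet> (c y + c x) - ?g r) \<le> norm (f r) * (2 * e)"
          using Cauchy_Schwarz_ineq2[of "f r" "(c y - c r) + (c x - c r)"]
          by (smt (verit) mult_left_mono norm_ge_zero real_norm_def)
      qed
      also have "\<dots> = e * (A y - A x)"
        using split[OF ni xy(1-3)] by (simp add: A_def algebra_simps)
      finally show "\<bar>H y - H x\<bar> \<le> e * (A y - A x)" by simp
    qed (use d in auto)
  qed
  then have "(norm (c b))\<^sup>2 - (norm (c a))\<^sup>2 = integral {a..b} ?g" by (simp add: H_def)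
  then show ?thesis using gi by (simp add: has_integral_iff)
qed

text \<open>An absolutely continuous function \<open>E\<close> with almost everywhere derivative \<open>\<phi>\<close>.\<close>

definition indef :: "real \<Rightarrow> (real \<Rightarrow> real) \<Rightarrow> (real \<Rightarrow> real) \<Rightarrow> bool" where
  "indef T E \<phi> \<longleftrightarrow> \<phi> absolutely_integrable_on {0..T} \<and>
    (\<forall>s t. 0 \<le> s \<longrightarrow> s \<le> t \<longrightarrow> t \<le> T \<longrightarrow> (\<phi> has_integral (E t - E s)) {s..t})"

lemma has_integral_subinterval:
  fixes f c :: "real \<Rightarrow> 'a::euclidean_space"
  assumes c: "\<And>t. 0 \<le> t \<Longrightarrow> t \<le> T \<Longrightarrow> (f has_integral (c t - c 0)) {0..t}"
    and st: "0 \<le> s" "s \<le> t" "t \<le> T"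
  shows "(f has_integral (c t - c s)) {s..t}"
proof -
  have ft: "(f has_integral (c t - c 0)) {0..t}" and fs: "(f has_integral (c s - c 0)) {0..s}"
    using c st by auto
  have "f integrable_on {s..t}"
    by (rule integrable_on_subinterval[OF has_integral_integrable[OF ft]]) (use st in auto)
  moreover have "integral {0..s} f + integral {s..t} f = integral {0..t} f"
    using st ft by (intro Henstock_Kurzweil_Integration.integral_combine) auto
  ultimately show ?thesis
    using integral_unique[OF ft] integral_unique[OF fs] by (simp add: has_integral_iff algebra_simps)
qed

text \<open>The chain rule is applied to each mode and summed over growing squares. Since twice an
  inner product is at most the sum of the squared norms, \<open>D + C\<close> dominates all partial
  sums. The type of the coefficients is left open so that the result serves both the pair
  \<open>(v1, v2)\<close> and the difference.\<close>

lemma energy_balance: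
  fixes c f :: "real \<Rightarrow> wn \<Rightarrow> 'a::euclidean_space"
  assumes T: "0 \<le> T"
    and int: "\<And>k t. 0 \<le> t \<Longrightarrow> t \<le> T \<Longrightarrow> ((\<lambda>s. f s k) has_integral (c t k - c 0 k)) {0..t}"
    and E: "\<And>t. 0 \<le> t \<Longrightarrow> t \<le> T \<Longrightarrow> ((\<lambda>k. (norm (c t k))\<^sup>2) has_sum E t) UNIV"
    and EC: "\<And>t. 0 \<le> t \<Longrightarrow> t \<le> T \<Longrightarrow> E t \<le> C"
    and N: "negligible N" and D: "D integrable_on {0..T}"
    and fD: "\<And>t F. t \<in> {0..T} - N \<Longrightarrow> finite F \<Longrightarrow> (\<Sum>k\<in>F. (norm (f t k))\<^sup>2) \<le> D t"
    and phi: "\<And>t. t \<in> {0..T} - N \<Longrightarrow> ((\<lambda>k. 2 * (f t k \<bullet> c t k)) has_sum \<phi> t) UNIV"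
  shows "indef T E (\<lambda>t. if t \<in> N then 0 else \<phi> t)"
proof -
  \<comment> \<open>Values on the null set are replaced by 0, because the convergence theorem asks
    for bounds and limits at every point of the interval.\<close>
  define f' where "f' t k = (if t \<in> N then 0 else f t k)" for t k
  define D' where "D' t = (if t \<in> N then 0 else D t)" for t
  define p where "p t = (if t \<in> N then 0 else \<phi> t)" for t
  have D'i: "D' integrable_on {0..T}"
    by (rule integrable_spike[OF D N]) (auto simp: D'_def)
  have int': "((\<lambda>s. f' s k) has_integral (c t k - c 0 k)) {0..t}" if "0 \<le> t" "t \<le> T" for k t
    by (rule has_integral_spike[OF N _ int[OF that]]) (auto simp: f'_def)
  have f'D: "(\<Sum>k\<in>F. (norm (f' t k))\<^sup>2) \<le> D' t" if "t \<in> {0..T}" "finite F" for t F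
    using fD[of t F] that by (auto simp: f'_def D'_def)
  have phi': "((\<lambda>k. 2 * (f' t k \<bullet> c t k)) has_sum p t) UNIV" if "t \<in> {0..T}" for t
    using phi[of t] that by (auto simp: f'_def p_def)
  have c_le: "(\<Sum>k\<in>F. (norm (c t k))\<^sup>2) \<le> C" if "t \<in> {0..T}" "finite F" for t F
    using finite_sum_le_infsum[OF has_sum_imp_summable[OF E], of t F] infsumI[OF E, of t] EC[of t] that by auto
  have ai: "(\<lambda>s. f' s k) absolutely_integrable_on {0..T}" for k
  proof (rule absolutely_integrable_integrable_bound)
    show "(\<lambda>s. f' s k) integrable_on {0..T}" using int'[of T k] T by blast
    show "(\<lambda>s. 1 + D' s) integrable_on {0..T}" by (intro integrable_add D'i integrable_const_ivl)
    show "norm (f' s k) \<le> 1 + D' s" if "s \<in> {0..T}" for s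
    proof -
      have "2 * norm (f' s k) \<le> 1 + (norm (f' s k))\<^sup>2"
        using sum_squares_bound[of 1 "norm (f' s k)"] by simp
      moreover have "(norm (f' s k))\<^sup>2 \<le> D' s" using f'D[OF that, of "{k}"] by simp
      ultimately show ?thesis using norm_ge_zero[of "f' s k"] by linarith
    qed
  qed
  have Sn: "((\<lambda>r. \<Sum>k\<in>Kbox n. 2 * (f' r k \<bullet> c r k)) has_integral
      ((\<Sum>k\<in>Kbox n. (norm (c t k))\<^sup>2) - (\<Sum>k\<in>Kbox n. (norm (c s k))\<^sup>2))) {s..t}"
    if st: "0 \<le> s" "s \<le> t" "t \<le> T" for n s t
    unfolding sum_subtractf[symmetric]
  proof (intro has_integral_sum finite_Kbox)
    fix k
    show "((\<lambda>r. 2 * (f' r k \<bullet> c r k)) has_integral ((norm (c t k))\<^sup>2 - (norm (c s k))\<^sup>2)) {s..t}"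
    proof (rule has_integral_norm_squared[where c = "\<lambda>r. c r k"])
      show "(\<lambda>r. f' r k) absolutely_integrable_on {s..t}"
        by (rule absolutely_integrable_on_subinterval[OF ai]) (use st in auto)
      show "((\<lambda>r. f' r k) has_integral (c r k - c s k)) {s..r}" if "s \<le> r" "r \<le> t" for r
        by (rule has_integral_subinterval[where T = T and c = "\<lambda>r. c r k", OF int']) (use that st in auto)
    qed (use st in auto)
  qed
  have dom: "norm (\<Sum>k\<in>Kbox n. 2 * (f' r k \<bullet> c r k)) \<le> D' r + C" if r: "r \<in> {0..T}" for n r
  proof -
    have "norm (\<Sum>k\<in>Kbox n. 2 * (f' r k \<bullet> c r k)) \<le> (\<Sum>k\<in>Kbox n. (norm (f' r k))\<^sup>2 + (norm (c r k))\<^sup>2)"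
    proof (rule order_trans[OF norm_sum], rule sum_mono)
      fix k
      show "norm (2 * (f' r k \<bullet> c r k)) \<le> (norm (f' r k))\<^sup>2 + (norm (c r k))\<^sup>2"
        using Cauchy_Schwarz_ineq2[of "f' r k" "c r k"] sum_squares_bound[of "norm (f' r k)" "norm (c r k)"]
        by (simp add: abs_mult)
    qed
    also have "\<dots> \<le> D' r + C" unfolding sum.distrib by (intro add_mono f'D c_le r finite_Kbox)
    finally show ?thesis .
  qed
  have bal: "(p has_integral (E t - E s)) {s..t}" if st: "0 \<le> s" "s \<le> t" "t \<le> T" for s t
  proof (rule has_integral_dominated_convergence[OF Sn[OF st]])
    show "(\<lambda>r. D' r + C) integrable_on {s..t}"
      by (rule integrable_on_subinterval[of _ "{0..T}"], intro integrable_add D'i integrable_const_ivl) (use st in auto)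
    show "\<forall>r\<in>{s..t}. norm (\<Sum>k\<in>Kbox n. 2 * (f' r k \<bullet> c r k)) \<le> D' r + C" for n
      using dom st by auto
    show "\<forall>r\<in>{s..t}. (\<lambda>n. \<Sum>k\<in>Kbox n. 2 * (f' r k \<bullet> c r k)) \<longlonglongrightarrow> p r"
      using has_sum_Kbox[OF phi'] st by auto
    show "(\<lambda>n. (\<Sum>k\<in>Kbox n. (norm (c t k))\<^sup>2) - (\<Sum>k\<in>Kbox n. (norm (c s k))\<^sup>2)) \<longlonglongrightarrow> E t - E s"
      using st by (intro tendsto_diff has_sum_Kbox E) auto
  qed
  have "p absolutely_integrable_on {0..T}"
  proof (rule absolutely_integrable_integrable_bound)
    show "p integrable_on {0..T}" using bal[of 0 T] T by blast
    show "(\<lambda>r. D' r + C) integrable_on {0..T}" by (intro integrable_add D'i integrable_const_ivl)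
    show "norm (p r) \<le> D' r + C" if r: "r \<in> {0..T}" for r
      by (rule LIMSEQ_le_const2[OF tendsto_norm[OF has_sum_Kbox[OF phi'[OF r]]]]) (use dom[OF r] in blast)
  qed
  then show ?thesis using bal by (simp add: indef_def p_def[abs_def])
qed

section \<open>Comparison, product rule and Gronwall's inequality\<close>

lemma indef_diff_le:
  assumes "indef T E \<phi>" and N: "negligible N" and st: "0 \<le> s" "s \<le> t" "t \<le> T"
    and psi: "\<psi> integrable_on {s..t}" and le: "\<And>r. r \<in> {s..t} - N \<Longrightarrow> \<phi> r \<le> \<psi> r"
  shows "E t - E s \<le> integral {s..t} \<psi>"
proof (rule has_integral_le)
  show "((\<lambda>r. if r \<in> N then 0 else \<phi> r) has_integral (E t - E s)) {s..t}"
    by (rule has_integral_spike[OF N, of _ _ \<phi>]) (use assms(1) st in \<open>auto simp: indef_def\<close>)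
  show "((\<lambda>r. if r \<in> N then 0 else \<psi> r) has_integral (integral {s..t} \<psi>)) {s..t}"
    by (rule has_integral_spike[OF N _ integrable_integral[OF psi]]) auto
qed (use le in auto)

text \<open>Polarisation: the chain rule for squares is applied to \<open>E + \<sigma> * G\<close>
  with \<sigma> equal to 1 and to -1.\<close>

lemma indef_mult:
  assumes E: "indef T E \<phi>" and G: "indef T G \<gamma>" and st: "0 \<le> s" "s \<le> t" "t \<le> T"
  shows "((\<lambda>r. \<phi> r * G r + \<gamma> r * E r) has_integral (E t * G t - E s * G s)) {s..t}"
proof -
  have sq: "((\<lambda>r. 2 * ((\<phi> r + \<sigma> * \<gamma> r) * (E r + \<sigma> * G r))) has_integral
      ((E t + \<sigma> * G t)\<^sup>2 - (E s + \<sigma> * G s)\<^sup>2)) {s..t}" for \<sigma>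
  proof -
    have "((\<lambda>r. 2 * ((\<phi> r + \<sigma> * \<gamma> r) \<bullet> (E r + \<sigma> * G r))) has_integral
      ((norm (E t + \<sigma> * G t))\<^sup>2 - (norm (E s + \<sigma> * G s))\<^sup>2)) {s..t}"
    proof (rule has_integral_norm_squared[where c = "\<lambda>r. E r + \<sigma> * G r"])
      show "(\<lambda>r. \<phi> r + \<sigma> * \<gamma> r) absolutely_integrable_on {s..t}"
        using E G st absolutely_integrable_on_subinterval[where S = "{0..T}" and a = s and b = t]
        by (intro set_integral_add(1) set_integrable_mult_right) (auto simp: indef_def)
      show "((\<lambda>r. \<phi> r + \<sigma> * \<gamma> r) has_integral (E r + \<sigma> * G r - (E s + \<sigma> * G s))) {s..r}" if "s \<le> r" "r \<le> t" for r
      proof -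
        have "((\<lambda>r. \<phi> r + \<sigma> * \<gamma> r) has_integral ((E r - E s) + \<sigma> * (G r - G s))) {s..r}"
          using E G st that by (intro has_integral_add has_integral_mult_right) (auto simp: indef_def)
        then show ?thesis by (simp add: algebra_simps)
      qed
    qed (use st in auto)
    then show ?thesis by simp
  qed
  from has_integral_mult_right[OF has_integral_diff[OF sq[of 1] sq[of "-1"]], of "1/4"]
  show ?thesis by (simp add: power2_eq_square algebra_simps add_divide_distrib)
qed

text \<open>The integrating factor \<open>G\<close> is the exponential of the integral of \<alpha>.
  As \<alpha> may change sign, only the lower bound \<open>low\<close> on its integrals enters; it
  bounds \<open>G r\<close> by \<open>G t * exp K * exp (- \<beta> * (t - r))\<close>. Integrating
  this exponential over \<open>r\<close> costs at most \<open>1 / \<beta>\<close>, whence the term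
  \<open>\<eta> / \<beta>\<close>.\<close>

lemma weighted_energy_le:
  assumes E: "indef T E \<phi>" and al: "continuous_on {0..T} \<alpha>" and N: "negligible N"
    and st: "0 \<le> s" "s \<le> t" "t \<le> T"
    and le: "\<And>r. r \<in> {s..t} - N \<Longrightarrow> \<phi> r \<le> - \<alpha> r * E r + \<eta>"
    and low: "\<And>r. s \<le> r \<Longrightarrow> r \<le> t \<Longrightarrow> \<beta> * (t - r) - K \<le> integral {r..t} \<alpha>"
    and pos: "\<beta> > 0" "\<eta> \<ge> 0" "E s \<ge> 0"
  shows "E t \<le> exp K * (E s * exp (- \<beta> * (t - s)) + \<eta> / \<beta>)"
proof -
  define a where "a r = integral {0..r} \<alpha>" for r
  define G where "G r = exp (a r)" for r
  have ad: "(a has_vector_derivative \<alpha> r) (at r within {0..T})" if "r \<in> {0..T}" for r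
    unfolding a_def by (rule integral_has_vector_derivative[OF al that])
  have Gd: "(G has_vector_derivative (\<alpha> r * G r)) (at r within {0..T})" if "r \<in> {0..T}" for r
    using ad[OF that] unfolding G_def has_real_derivative_iff_has_vector_derivative[symmetric]
    by (auto intro!: derivative_eq_intros)
  have Gc: "continuous_on {0..T} G"
    using Gd by (meson continuous_on_eq_continuous_within has_vector_derivative_continuous)
  have aG: "continuous_on {0..T} (\<lambda>r. \<alpha> r * G r)" by (intro continuous_intros al Gc)
  have G: "indef T G (\<lambda>r. \<alpha> r * G r)"
    unfolding indef_def
  proof (intro conjI allI impI)
    show "(\<lambda>r. \<alpha> r * G r) absolutely_integrable_on {0..T}" by (rule absolutely_integrable_continuous_real[OF aG])
    fix s t assume "0 \<le> s" "s \<le> t" "t \<le> T"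
    then show "((\<lambda>r. \<alpha> r * G r) has_integral (G t - G s)) {s..t}"
      by (intro fundamental_theorem_of_calculus has_vector_derivative_within_subset[OF Gd]) auto
  qed
  have sub: "{s..t} \<subseteq> {0..T}" using st by auto
  have a_split: "a t - a r = integral {r..t} \<alpha>" if "s \<le> r" "r \<le> t" for r
  proof -
    have "\<alpha> integrable_on {0..t}"
      by (rule integrable_continuous_real, rule continuous_on_subset[OF al]) (use st in auto)
    from Henstock_Kurzweil_Integration.integral_combine[OF _ that(2) this] that st show ?thesis by (simp add: a_def)
  qed
  have Gi: "G integrable_on {s..t}" by (rule integrable_continuous_real, rule continuous_on_subset[OF Gc sub])
  have "E t * G t - E s * G s \<le> \<eta> * integral {s..t} G"
  proof (rule has_integral_le)
    show "((\<lambda>r. if r \<in> N then 0 else \<phi> r * G r + \<alpha> r * G r * E r) has_integral (E t * G t - E s * G s)) {s..t}"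
      by (rule has_integral_spike[OF N _ indef_mult[OF E G st]]) auto
    show "((\<lambda>r. if r \<in> N then 0 else \<eta> * G r) has_integral (\<eta> * integral {s..t} G)) {s..t}"
      by (rule has_integral_spike[OF N _ has_integral_mult_right[OF integrable_integral[OF Gi]]]) auto
    fix r assume r: "r \<in> {s..t}"
    show "(if r \<in> N then 0 else \<phi> r * G r + \<alpha> r * G r * E r) \<le> (if r \<in> N then 0 else \<eta> * G r)"
    proof (cases "r \<in> N")
      case False
      then have "(\<phi> r + \<alpha> r * E r) * G r \<le> \<eta> * G r"
        using le[of r] r by (intro mult_right_mono) (auto simp: G_def)
      then show ?thesis using False by (simp add: algebra_simps)
    qed simp
  qed
  moreover have "integral {s..t} G \<le> G t * (exp K / \<beta>)"
  proof -
    let ?h = "\<lambda>r. G t * (exp K * exp (- \<beta> * (t - r)))"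
    have h: "(?h has_integral (G t * (exp K * (exp (- \<beta> * (t - t)) / \<beta>)) - G t * (exp K * (exp (- \<beta> * (t - s)) / \<beta>)))) {s..t}"
      using pos by (intro fundamental_theorem_of_calculus st)
        (auto intro!: derivative_eq_intros simp: has_real_derivative_iff_has_vector_derivative[symmetric])
    have "integral {s..t} G \<le> G t * (exp K * (exp (- \<beta> * (t - t)) / \<beta>)) - G t * (exp K * (exp (- \<beta> * (t - s)) / \<beta>))"
    proof (rule has_integral_le[OF integrable_integral[OF Gi] h])
      fix r assume r: "r \<in> {s..t}"
      have "a r \<le> a t + (K + - \<beta> * (t - r))" using low[of r] a_split[of r] r by (simp add: algebra_simps)
      then have "exp (a r) \<le> exp (a t + (K + - \<beta> * (t - r)))" by (simp only: exp_le_cancel_iff)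
      then show "G r \<le> ?h r" by (simp only: G_def exp_add)
    qed
    also have "\<dots> \<le> G t * (exp K / \<beta>)" using pos by (simp add: G_def)
    finally show ?thesis .
  qed
  ultimately have "E t * G t \<le> E s * G s + \<eta> * (G t * (exp K / \<beta>))"
    using mult_left_mono[OF _ pos(2), of "integral {s..t} G" "G t * (exp K / \<beta>)"] by linarith
  also have "E s * G s \<le> E s * (G t * (exp K * exp (- \<beta> * (t - s))))"
  proof -
    have "a s \<le> a t + (K + - \<beta> * (t - s))" using low[of s] a_split[of s] st by (simp add: algebra_simps)
    then have "exp (a s) \<le> exp (a t + (K + - \<beta> * (t - s)))" by (simp only: exp_le_cancel_iff)
    then show ?thesis using pos by (intro mult_left_mono) (simp_all only: G_def exp_add)
  qed
  finally have "E t * G t \<le> (exp K * (E s * exp (- \<beta> * (t - s)) + \<eta> / \<beta>)) * G t"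
    by (simp add: algebra_simps)
  moreover have "0 < G t" by (simp add: G_def)
  ultimately show ?thesis by (rule mult_right_le_imp_le)
qed

section \<open>Strong solutions\<close>

lemma Vnorm_minus_commute: "L2 u \<Longrightarrow> L2 v \<Longrightarrow> Vnorm (u - v) = Vnorm (v - u)"
  by (simp add: Vnorm_def fc_diff norm_minus_commute)

lemma abs_Vnorm_diff_le:
  assumes "Vsp u" "Vsp v"
  shows "\<bar>Vnorm u - Vnorm v\<bar> \<le> Vnorm (u - v)"
  using Vnorm_triangle[OF assms] Vnorm_triangle[OF assms(2,1)] Vnorm_minus_commute[of u v] assms Vsp_D
  by (auto simp: abs_le_iff)

lemma strong_class_Vnorm_continuous:
  assumes v: "strong_class v"
  shows "continuous_on {0..} (\<lambda>t. Vnorm (v t))"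
  unfolding continuous_on_def
proof
  fix t :: real assume t: "t \<in> {0..}"
  have V: "Vsp (v s)" if "0 \<le> s" for s using v that by (simp add: strong_class_def)
  show "((\<lambda>t. Vnorm (v t)) \<longlongrightarrow> Vnorm (v t)) (at t within {0..})"
  proof (rule LIM_zero_cancel, rule Lim_null_comparison)
    show "((\<lambda>s. Vnorm (v s - v t)) \<longlongrightarrow> 0) (at t within {0..})"
      using v t by (simp add: strong_class_def)
    show "\<forall>\<^sub>F s in at t within {0..}. norm (Vnorm (v s) - Vnorm (v t)) \<le> Vnorm (v s - v t)"
      unfolding eventually_at_filter using abs_Vnorm_diff_le V t by (auto intro!: always_eventually)
  qed
qed

lemma negligible_of_AE:
  assumes "AE t in lborel. P (t::real)"
  obtains N where "negligible N" "\<And>t. t \<notin> N \<Longrightarrow> P t"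
proof -
  obtain N where N: "N \<in> null_sets lborel" "{t \<in> space lborel. \<not> P t} \<subseteq> N"
    using assms unfolding eventually_ae_filter by blast
  then have "N \<in> null_sets lebesgue" by (auto intro: null_sets_completionI)
  with N show thesis by (intro that[of N]) (auto simp: negligible_iff_null_sets)
qed

text \<open>\<open>strong_class\<close> controls \<open>(Anorm (v t))^2\<close> through a
  nonnegative integral, whereas the energy balance works with a gauge integrable majorant. The
  truncated sums are continuous in time, increase to the full sum and have bounded integrals, so
  monotone convergence provides it.\<close>

lemma Anorm_squared_dominated:
  assumes v: "strong_class v" and T: "0 \<le> T" and c: "\<And>k. continuous_on {0..T} (\<lambda>t. fc (v t) k)"
  obtains N D where "negligible N" "D integrable_on {0..T}"
    "\<And>t. t \<in> {0..T} - N \<Longrightarrow> DA (v t)" "\<And>t. t \<in> {0..T} - N \<Longrightarrow> (Anorm (v t))\<^sup>2 \<le> D t"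
proof -
  have ae: "AE t in lborel. t \<in> {0..T} \<longrightarrow> DA (v t)"
    and J: "set_nn_integral lborel {0..T} (\<lambda>t. ennreal ((Anorm (v t))\<^sup>2)) < \<infinity>"
    using v T by (auto simp: strong_class_def)
  obtain N where N: "negligible N" "\<And>t. t \<notin> N \<Longrightarrow> t \<in> {0..T} \<longrightarrow> DA (v t)"
    by (rule negligible_of_AE[OF ae]) (rule that; assumption)
  define A where "A n t = 4 * pi\<^sup>2 * (\<Sum>k\<in>Kbox n. (ksq k)\<^sup>2 * (norm (fc (v t) k))\<^sup>2)" for n t
  have Ac: "continuous_on {0..T} (A n)" for n
    unfolding A_def by (intro continuous_intros c)
  have A_nonneg: "0 \<le> A n t" for n t unfolding A_def by (intro mult_nonneg_nonneg sum_nonneg) auto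
  have A_mono: "A n t \<le> A (Suc n) t" for n t
    unfolding A_def by (intro mult_left_mono sum_mono2 Kbox_mono) auto
  have A_lim: "(\<lambda>n. A n t) \<longlonglongrightarrow> (Anorm (v t))\<^sup>2" if "DA (v t)" for t
    using tendsto_mult_left[OF has_sum_Kbox[OF has_sum_Anorm[OF that]], of "4 * pi\<^sup>2"] by (simp add: A_def)
  have A_le: "A n t \<le> (Anorm (v t))\<^sup>2" if "DA (v t)" for n t
    by (rule incseq_le[OF incseq_SucI A_lim[OF that]]) (rule A_mono)
  have Ai: "A n integrable_on {0..T}" for n by (rule integrable_continuous_real[OF Ac])
  have le: "ennreal (integral {0..T} (A n)) \<le> set_nn_integral lborel {0..T} (\<lambda>t. ennreal ((Anorm (v t))\<^sup>2))" for n
  proof -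
    have le: "set_nn_integral lborel {0..T} (\<lambda>t. ennreal (A n t)) \<le> set_nn_integral lborel {0..T} (\<lambda>t. ennreal ((Anorm (v t))\<^sup>2))"
      using ae by (intro nn_integral_mono_AE) (auto elim!: eventually_mono simp: indicator_def intro!: ennreal_leI A_le)
    have "set_nn_integral lborel {0..T} (\<lambda>t. ennreal (A n t)) = ennreal (integral {0..T} (A n))"
    proof (rule set_nn_integral_lborel_eq_integral)
      show "set_borel_measurable borel {0..T} (A n)"
        unfolding set_borel_measurable_def by (rule borel_measurable_continuous_on_indicator[OF _ Ac]) simp
    qed (use le J A_nonneg in \<open>auto intro: le_less_trans\<close>)
    with le show ?thesis by simp
  qed
  define D where "D t = (if t \<in> N then 0 else (Anorm (v t))\<^sup>2)" for t
  let ?A = "\<lambda>n t. if t \<in> N then 0 else if t \<in> {0..T} then A n t else 0"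
  have Aint: "(?A n has_integral (integral {0..T} (A n))) {0..T}" for n
    by (rule has_integral_spike[OF N(1) _ integrable_integral[OF Ai]]) auto
  have "D integrable_on {0..T}"
  proof (rule monotone_convergence_increasing[THEN conjunct1])
    show "?A n integrable_on {0..T}" for n using Aint by blast
    show "?A n t \<le> ?A (Suc n) t" if "t \<in> {0..T}" for n t using A_mono by auto
    show "(\<lambda>n. ?A n t) \<longlonglongrightarrow> D t" if "t \<in> {0..T}" for t
      using A_lim[of t] N(2)[of t] that by (auto simp: D_def)
    show "bounded (range (\<lambda>n. integral {0..T} (?A n)))"
    proof -
      define R where "R = enn2real (set_nn_integral lborel {0..T} (\<lambda>t. ennreal ((Anorm (v t))\<^sup>2)))"
      have "norm (integral {0..T} (?A n)) \<le> R" for n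
      proof -
        have "0 \<le> integral {0..T} (A n)" by (intro Henstock_Kurzweil_Integration.integral_nonneg Ai A_nonneg)
        moreover have "integral {0..T} (A n) \<le> R"
          using enn2real_mono[OF le[of n] J[unfolded infinity_ennreal_def]] enn2real_ennreal[OF calculation] by (simp only: R_def)
        ultimately show ?thesis unfolding integral_unique[OF Aint] by simp
      qed
      then show ?thesis unfolding bounded_iff by blast
    qed
  qed
  with N show thesis by (intro that[of N D]) (auto simp: D_def)
qed

lemma has_integral_Pair:
  fixes f :: "real \<Rightarrow> 'a::euclidean_space" and g :: "real \<Rightarrow> 'b::euclidean_space"
  assumes f: "(f has_integral a) S" and g: "(g has_integral b) S"
  shows "((\<lambda>x. (f x, g x)) has_integral (a, b)) S"
proof -
  have bl: "bounded_linear (\<lambda>x::'a. (x, 0 :: 'b))" "bounded_linear (\<lambda>x::'b. (0 :: 'a, x))"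
    by (intro bounded_linear_Pair bounded_linear_ident bounded_linear_zero)+
  have "((\<lambda>x. (f x, 0 :: 'b)) has_integral (a, 0)) S" "((\<lambda>x. (0 :: 'a, g x)) has_integral (0, b)) S"
    using has_integral_linear[OF f bl(1)] has_integral_linear[OF g bl(2)] by (simp_all add: o_def)
  from has_integral_add[OF this] show ?thesis by simp
qed

text \<open>The \<open>k\<close>-th Fourier coefficient of the time derivative of a component \<open>u\<close>
  of the coupled system; \<open>w\<close> is the other component.\<close>

definition rhs :: "real \<Rightarrow> real \<Rightarrow> real \<Rightarrow> real \<Rightarrow> vf \<Rightarrow> vf \<Rightarrow> vf \<Rightarrow> wn \<Rightarrow> complex \<times> complex" where
  "rhs nu a b N g u w k = - cmul (complex_of_real nu) (Ac u k) - Bc u u k + fc g k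
    - cmul (complex_of_real a) (fc (PN N u) k) + cmul (complex_of_real b) (fc (PN N w) k)"

lemma cmul_of_real: "cmul (complex_of_real r) p = r *\<^sub>R p"
  by (simp add: cmul_def prod_eq_iff scaleR_conv_of_real)

lemma rhs_alt:
  "rhs nu a b N g u w k = - (nu * ksq k) *\<^sub>R fc u k - Bc u u k + fc g k
    - a *\<^sub>R (if k \<in> low_modes N then fc u k else 0) + b *\<^sub>R (if k \<in> low_modes N then fc w k else 0)"
  unfolding rhs_def Ac_def cmul_of_real fc_PN by simp

lemma divide_four_pi_squared_le: "0 \<le> x \<Longrightarrow> x / (4 * pi\<^sup>2) \<le> x"
proof -
  assume x: "0 \<le> x"
  have "1 \<le> pi\<^sup>2" using pi_ge_two by (intro one_le_power) simp
  then have "x / (4 * pi\<^sup>2) \<le> x / 1" using x by (intro divide_left_mono) auto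
  then show ?thesis by simp
qed

lemma sum_norm_fc_squared_le: "L2 u \<Longrightarrow> finite F \<Longrightarrow> (\<Sum>k\<in>F. (norm (fc u k))\<^sup>2) \<le> (Hnorm u)\<^sup>2"
proof -
  assume u: "L2 u" and F: "finite F"
  have "(\<Sum>k\<in>F. (norm (fc u k))\<^sup>2) \<le> (Hnorm u)\<^sup>2 / (4 * pi\<^sup>2)"
    using finite_sum_le_infsum[OF has_sum_imp_summable[OF has_sum_Hnorm[OF u]] F] infsumI[OF has_sum_Hnorm[OF u]] by simp
  also have "\<dots> \<le> (Hnorm u)\<^sup>2" by (rule divide_four_pi_squared_le) simp
  finally show ?thesis .
qed

text \<open>Four uses of the two-term bound, each doubling the constant, whence 16.\<close>

lemma norm_add5_squared_le:
  "(norm (p + q + r + s + t))\<^sup>2 \<le> 16 * ((norm p)\<^sup>2 + (norm q)\<^sup>2 + (norm r)\<^sup>2 + (norm s)\<^sup>2 + (norm t)\<^sup>2)"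
  for p q r s t :: "'a::real_normed_vector"
  using norm_add_squared_le[of "p + q + r + s" t] norm_add_squared_le[of "p + q + r" s]
    norm_add_squared_le[of "p + q" r] norm_add_squared_le[of p q]
    zero_le_power2[of "norm p"] zero_le_power2[of "norm q"] zero_le_power2[of "norm r"]
    zero_le_power2[of "norm s"] zero_le_power2[of "norm t"]
  unfolding distrib_left by argo

text \<open>Source of the majorant \<open>D\<close> in \<open>energy_balance\<close>: along a strong
  solution everything on the right except \<open>Anorm u\<close> is bounded on finite time
  intervals.\<close>

lemma sum_norm_rhs_le:
  assumes u: "DA u" and w: "L2 w" and g: "L2 g" and F: "finite F"
  shows "(\<Sum>k\<in>F. (norm (rhs nu a b N g u w k))\<^sup>2) \<le> 16 * (nu\<^sup>2 * (Anorm u)\<^sup>2 + (agmon_const * Anorm u)\<^sup>2 * (Vnorm u)\<^sup>2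
    + (Hnorm g)\<^sup>2 + a\<^sup>2 * (Hnorm u)\<^sup>2 + b\<^sup>2 * (Hnorm w)\<^sup>2)"
proof -
  have Lu: "L2 u" using u by (simp add: DA_def Vsp_D)
  let ?l = "\<lambda>v k. if k \<in> low_modes N then fc v k else 0"
  have "(\<Sum>k\<in>F. (norm (rhs nu a b N g u w k))\<^sup>2) \<le> (\<Sum>k\<in>F. 16 * (nu\<^sup>2 * ((ksq k)\<^sup>2 * (norm (fc u k))\<^sup>2) + (norm (Bc u u k))\<^sup>2
      + (norm (fc g k))\<^sup>2 + a\<^sup>2 * (norm (fc u k))\<^sup>2 + b\<^sup>2 * (norm (fc w k))\<^sup>2))"
  proof (rule sum_mono)
    fix k
    have "rhs nu a b N g u w k = (- (nu * ksq k) *\<^sub>R fc u k) + (- Bc u u k) + fc g k + (- a *\<^sub>R ?l u k) + b *\<^sub>R ?l w k"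
      unfolding rhs_alt by simp
    then have "(norm (rhs nu a b N g u w k))\<^sup>2 \<le> 16 * ((norm (- (nu * ksq k) *\<^sub>R fc u k))\<^sup>2 + (norm (- Bc u u k))\<^sup>2
        + (norm (fc g k))\<^sup>2 + (norm (- a *\<^sub>R ?l u k))\<^sup>2 + (norm (b *\<^sub>R ?l w k))\<^sup>2)"
      by (simp only: norm_add5_squared_le)
    also have "\<dots> \<le> 16 * (nu\<^sup>2 * ((ksq k)\<^sup>2 * (norm (fc u k))\<^sup>2) + (norm (Bc u u k))\<^sup>2
      + (norm (fc g k))\<^sup>2 + a\<^sup>2 * (norm (fc u k))\<^sup>2 + b\<^sup>2 * (norm (fc w k))\<^sup>2)"
      by (simp add: power_mult_distrib)
    finally show "(norm (rhs nu a b N g u w k))\<^sup>2 \<le> 16 * (nu\<^sup>2 * ((ksq k)\<^sup>2 * (norm (fc u k))\<^sup>2) + (norm (Bc u u k))\<^sup>2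
      + (norm (fc g k))\<^sup>2 + a\<^sup>2 * (norm (fc u k))\<^sup>2 + b\<^sup>2 * (norm (fc w k))\<^sup>2)" .
  qed
  also have "\<dots> = 16 * (nu\<^sup>2 * (\<Sum>k\<in>F. (ksq k)\<^sup>2 * (norm (fc u k))\<^sup>2) + (\<Sum>k\<in>F. (norm (Bc u u k))\<^sup>2)
      + (\<Sum>k\<in>F. (norm (fc g k))\<^sup>2) + a\<^sup>2 * (\<Sum>k\<in>F. (norm (fc u k))\<^sup>2) + b\<^sup>2 * (\<Sum>k\<in>F. (norm (fc w k))\<^sup>2))"
    by (simp only: sum_distrib_left[symmetric] sum.distrib)
  also have "\<dots> \<le> 16 * (nu\<^sup>2 * (Anorm u)\<^sup>2 + (agmon_const * Anorm u)\<^sup>2 * (Vnorm u)\<^sup>2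
    + (Hnorm g)\<^sup>2 + a\<^sup>2 * (Hnorm u)\<^sup>2 + b\<^sup>2 * (Hnorm w)\<^sup>2)"
  proof (intro mult_left_mono add_mono sum_norm_fc_squared_le Lu w g F)
    have A: "(\<Sum>k\<in>F. (ksq k)\<^sup>2 * (norm (fc u k))\<^sup>2) \<le> (Anorm u)\<^sup>2 / (4 * pi\<^sup>2)"
      using finite_sum_le_infsum[OF has_sum_imp_summable[OF has_sum_Anorm[OF u]] F] infsumI[OF has_sum_Anorm[OF u]] by simp
    also have "\<dots> \<le> (Anorm u)\<^sup>2" by (rule divide_four_pi_squared_le) simp
    finally show "(\<Sum>k\<in>F. (ksq k)\<^sup>2 * (norm (fc u k))\<^sup>2) \<le> (Anorm u)\<^sup>2" .
    let ?C = "(agmon_const * Anorm u)\<^sup>2 * (Vnorm u)\<^sup>2"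
    have "(\<Sum>k\<in>F. (norm (Bc u u k))\<^sup>2) \<le> ?C / (4 * pi\<^sup>2)"
      using sum_norm_Bc_le[OF u F] by (simp add: field_simps)
    also have "\<dots> \<le> ?C" by (rule divide_four_pi_squared_le) simp
    finally show "(\<Sum>k\<in>F. (norm (Bc u u k))\<^sup>2) \<le> ?C" .
  qed auto
  finally show ?thesis .
qed

section \<open>Testing the equations with the solution and with the difference\<close>

lemma has_sum_low_modes: "((\<lambda>k. if k \<in> low_modes N then h k else 0) has_sum sum h (low_modes N)) UNIV"
  for h :: "wn \<Rightarrow> real"
  by (rule has_sum_cong_neutral[THEN iffD1, OF _ _ _ has_sum_finite[OF finite_low_modes]]) auto

lemma has_sum_rhs_self:
  assumes u: "DA u" and g: "L2 g"
  shows "((\<lambda>k. rhs nu a b N g u w k \<bullet> fc u k) has_sum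
    (- nu * ((Vnorm u)\<^sup>2 / (4 * pi\<^sup>2)) + (\<integral>x. g x \<bullet> u x \<partial>torus) / (4 * pi\<^sup>2)
      - a * (\<Sum>k\<in>low_modes N. (norm (fc u k))\<^sup>2) + b * (\<Sum>k\<in>low_modes N. fc w k \<bullet> fc u k))) UNIV"
proof -
  have Lu: "L2 u" using u by (simp add: DA_def Vsp_D)
  have "((\<lambda>k. - nu * (ksq k * (norm (fc u k))\<^sup>2) - Bc u u k \<bullet> fc u k + fc g k \<bullet> fc u k
      - a * (if k \<in> low_modes N then (norm (fc u k))\<^sup>2 else 0) + b * (if k \<in> low_modes N then fc w k \<bullet> fc u k else 0)) has_sum
    (- nu * ((Vnorm u)\<^sup>2 / (4 * pi\<^sup>2)) - 0 + (\<integral>x. g x \<bullet> u x \<partial>torus) / (4 * pi\<^sup>2)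
      - a * (\<Sum>k\<in>low_modes N. (norm (fc u k))\<^sup>2) + b * (\<Sum>k\<in>low_modes N. fc w k \<bullet> fc u k))) UNIV"
    by (intro has_sum_add has_sum_diff has_sum_cmult_right has_sum_Vnorm has_sum_Bc_self has_sum_fc_inner
        has_sum_low_modes DA_imp_Vsp u g Lu)
  moreover have "- nu * (ksq k * (norm (fc u k))\<^sup>2) - Bc u u k \<bullet> fc u k + fc g k \<bullet> fc u k
      - a * (if k \<in> low_modes N then (norm (fc u k))\<^sup>2 else 0) + b * (if k \<in> low_modes N then fc w k \<bullet> fc u k else 0)
      = rhs nu a b N g u w k \<bullet> fc u k" for k
    unfolding rhs_alt by (simp add: inner_add_left inner_diff_left power2_norm_eq_inner)
  ultimately show ?thesis by simp
qed

text \<open>In the difference the coupling terms collapse to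
  \<open>-a P u + b P v + a P v - b P u = -(a + b) P (u - v)\<close>. The nonlinear terms leave only
  the transport of \<open>u\<close> by \<open>u - v\<close>, which is why the V-norm of one solution
  alone enters the rate.\<close>

lemma has_sum_rhs_diff:
  assumes u: "DA u" and v: "DA v" and g: "L2 g" and h: "L2 h"
  shows "((\<lambda>k. (rhs nu a b N g u v k - rhs nu a b N h v u k) \<bullet> fc (u - v) k) has_sum
    (- nu * ((Vnorm (u - v))\<^sup>2 / (4 * pi\<^sup>2)) - (\<integral>x. adv (u - v) u x \<bullet> (u - v) x \<partial>torus) / (4 * pi\<^sup>2)
      + (\<integral>x. (g - h) x \<bullet> (u - v) x \<partial>torus) / (4 * pi\<^sup>2)
      - (a + b) * (\<Sum>k\<in>low_modes N. (norm (fc (u - v) k))\<^sup>2))) UNIV"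
proof -
  have L: "L2 u" "L2 v" using u v by (simp_all add: DA_def Vsp_D)
  have f: "fc (u - v) k = fc u k - fc v k" "fc (g - h) k = fc g k - fc h k" for k
    by (rule fc_diff[OF L], rule fc_diff[OF g h])
  have "((\<lambda>k. - nu * (ksq k * (norm (fc (u - v) k))\<^sup>2) - (Bc u u k - Bc v v k) \<bullet> fc (u - v) k + fc (g - h) k \<bullet> fc (u - v) k
      - (a + b) * (if k \<in> low_modes N then (norm (fc (u - v) k))\<^sup>2 else 0)) has_sum
    (- nu * ((Vnorm (u - v))\<^sup>2 / (4 * pi\<^sup>2)) - (\<integral>x. adv (u - v) u x \<bullet> (u - v) x \<partial>torus) / (4 * pi\<^sup>2)
      + (\<integral>x. (g - h) x \<bullet> (u - v) x \<partial>torus) / (4 * pi\<^sup>2)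
      - (a + b) * (\<Sum>k\<in>low_modes N. (norm (fc (u - v) k))\<^sup>2))) UNIV"
    by (intro has_sum_add has_sum_diff has_sum_cmult_right has_sum_Vnorm has_sum_Bc_diff has_sum_fc_inner
        has_sum_low_modes DA_imp_Vsp DA_diff u v L2_diff g h L)
  moreover have "- nu * (ksq k * (norm (fc (u - v) k))\<^sup>2) - (Bc u u k - Bc v v k) \<bullet> fc (u - v) k + fc (g - h) k \<bullet> fc (u - v) k
      - (a + b) * (if k \<in> low_modes N then (norm (fc (u - v) k))\<^sup>2 else 0)
      = (rhs nu a b N g u v k - rhs nu a b N h v u k) \<bullet> fc (u - v) k" for k
  proof -
    have "rhs nu a b N g u v k - rhs nu a b N h v u k = - (nu * ksq k) *\<^sub>R fc (u - v) k - (Bc u u k - Bc v v k) + fc (g - h) k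
        - (a + b) *\<^sub>R (if k \<in> low_modes N then fc (u - v) k else 0)"
      unfolding rhs_alt f by (simp add: algebra_simps)
    then show ?thesis by (simp add: inner_add_left inner_diff_left power2_norm_eq_inner)
  qed
  ultimately show ?thesis by simp
qed

text \<open>Compared coefficient by coefficient: on a low mode a nonnegative amount is subtracted on
  the left, on a high mode \<open>ksq k\<close> is at least \<open>N^2\<close> and the left is not
  positive, and the zero mode vanishes.\<close>

lemma low_modes_coercive:
  assumes w: "Vsp w" and N: "N > 0"
  shows "(Hnorm w)\<^sup>2 / (4 * pi\<^sup>2) - (Vnorm w)\<^sup>2 / (4 * pi\<^sup>2) / N\<^sup>2 \<le> (\<Sum>k\<in>low_modes N. (norm (fc w k))\<^sup>2)"
proof -
  have L: "L2 w" and w0: "fc w 0 = 0" using w Vsp_D by auto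
  have "(Hnorm w)\<^sup>2 / (4 * pi\<^sup>2) - (1 / N\<^sup>2) * ((Vnorm w)\<^sup>2 / (4 * pi\<^sup>2)) \<le> (\<Sum>k\<in>low_modes N. (norm (fc w k))\<^sup>2)"
  proof (rule has_sum_mono[OF has_sum_diff[OF has_sum_Hnorm[OF L] has_sum_cmult_right[OF has_sum_Vnorm[OF w]]] has_sum_low_modes])
    fix k
    show "(norm (fc w k))\<^sup>2 - 1 / N\<^sup>2 * (ksq k * (norm (fc w k))\<^sup>2) \<le> (if k \<in> low_modes N then (norm (fc w k))\<^sup>2 else 0)"
    proof (cases "k \<in> low_modes N \<or> k = 0")
      case True
      then show ?thesis using w0 N by (auto intro!: mult_nonneg_nonneg divide_nonneg_nonneg)
    next
      case False
      then have "N < sqrt (ksq k)" by (auto simp: low_modes_def zero_prod_def)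
      then have "N\<^sup>2 \<le> ksq k" using N by (metis less_imp_le power_mono real_sqrt_pow2 ksq_nonneg)
      then have "1 \<le> 1 / N\<^sup>2 * ksq k" using N by (simp add: field_simps)
      then have "1 * (norm (fc w k))\<^sup>2 \<le> (1 / N\<^sup>2 * ksq k) * (norm (fc w k))\<^sup>2" by (intro mult_right_mono) auto
      then show ?thesis using False by (simp add: mult.assoc)
    qed
  qed
  then show ?thesis by (simp add: mult.commute)
qed

text \<open>Half of the dissipation absorbs the forcing, by Young's and Poincare's inequalities. For
  the coupling, \<open>2 * b * R\<close> is at most \<open>b * (P + Q)\<close> and hence at most
  \<open>a * (P + Q)\<close>, so its total contribution is not positive.\<close>

lemma pair_rate_le:
  assumes nu: "nu > 0" and ab: "b \<le> a" "0 \<le> b" and u: "DA u" and v: "DA v" and g: "L2 g" and h: "L2 h"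
  shows "2 * (- nu * ((Vnorm u)\<^sup>2 / (4 * pi\<^sup>2)) + (\<integral>x. g x \<bullet> u x \<partial>torus) / (4 * pi\<^sup>2)
      - a * (\<Sum>k\<in>low_modes N. (norm (fc u k))\<^sup>2) + b * (\<Sum>k\<in>low_modes N. fc v k \<bullet> fc u k)) +
    2 * (- nu * ((Vnorm v)\<^sup>2 / (4 * pi\<^sup>2)) + (\<integral>x. h x \<bullet> v x \<partial>torus) / (4 * pi\<^sup>2)
      - a * (\<Sum>k\<in>low_modes N. (norm (fc v k))\<^sup>2) + b * (\<Sum>k\<in>low_modes N. fc u k \<bullet> fc v k))
    \<le> (- nu * ((Vnorm u)\<^sup>2 + (Vnorm v)\<^sup>2) + ((Hnorm g)\<^sup>2 + (Hnorm h)\<^sup>2) / nu) / (4 * pi\<^sup>2)"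
proof -
  define P Q R where "P = (\<Sum>k\<in>low_modes N. (norm (fc u k))\<^sup>2)" and "Q = (\<Sum>k\<in>low_modes N. (norm (fc v k))\<^sup>2)"
    and "R = (\<Sum>k\<in>low_modes N. fc u k \<bullet> fc v k)"
  have R': "(\<Sum>k\<in>low_modes N. fc v k \<bullet> fc u k) = R" by (simp add: R_def inner_commute)
  have forcing: "2 * (\<integral>x. f x \<bullet> w x \<partial>torus) \<le> nu * (Vnorm w)\<^sup>2 + (Hnorm f)\<^sup>2 / nu" if "L2 f" "DA w" for f w
  proof -
    have V: "Vsp w" by (rule DA_imp_Vsp[OF that(2)])
    have "(\<integral>x. f x \<bullet> w x \<partial>torus) \<le> Hnorm f * Hnorm w"
      using integral_inner_le[OF that(1) Vsp_D(2)[OF Vsp_D(1)[OF V]]] by simp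
    also have "\<dots> \<le> Hnorm f * Vnorm w" by (intro mult_left_mono Hnorm_le_Vnorm V) simp
    finally have 1: "(\<integral>x. f x \<bullet> w x \<partial>torus) \<le> Hnorm f * Vnorm w" .
    have "0 \<le> (nu * Vnorm w - Hnorm f)\<^sup>2 / nu" using nu by simp
    also have "\<dots> = nu * (Vnorm w)\<^sup>2 + (Hnorm f)\<^sup>2 / nu - 2 * (Hnorm f * Vnorm w)"
      using nu by (simp add: field_simps power2_eq_square)
    finally show ?thesis using 1 by argo
  qed
  have PQ: "2 * R \<le> P + Q"
    unfolding P_def Q_def R_def sum_distrib_left sum.distrib[symmetric]
  proof (rule sum_mono)
    fix k
    have "0 \<le> (norm (fc u k - fc v k))\<^sup>2" by simp
    then show "2 * (fc u k \<bullet> fc v k) \<le> (norm (fc u k))\<^sup>2 + (norm (fc v k))\<^sup>2"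
      by (simp add: power2_norm_eq_inner inner_diff_left inner_diff_right inner_commute)
  qed
  have nn: "0 \<le> P" "0 \<le> Q" by (auto simp: P_def Q_def intro: sum_nonneg)
  have low: "- a * P + b * R - a * Q + b * R \<le> 0"
  proof -
    have "b * (2 * R) \<le> b * (P + Q)" by (rule mult_left_mono[OF PQ ab(2)])
    also have "\<dots> \<le> a * (P + Q)" using nn by (intro mult_right_mono ab) auto
    finally show ?thesis by (simp add: algebra_simps)
  qed
  let ?I = "\<integral>x. g x \<bullet> u x \<partial>torus" and ?J = "\<integral>x. h x \<bullet> v x \<partial>torus"
  have "2 * (- nu * ((Vnorm u)\<^sup>2 / (4 * pi\<^sup>2)) + ?I / (4 * pi\<^sup>2) - a * P + b * R) +
    2 * (- nu * ((Vnorm v)\<^sup>2 / (4 * pi\<^sup>2)) + ?J / (4 * pi\<^sup>2) - a * Q + b * R) =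
    (- 2 * nu * ((Vnorm u)\<^sup>2 + (Vnorm v)\<^sup>2) + (2 * ?I + 2 * ?J)) / (4 * pi\<^sup>2) + 2 * (- a * P + b * R - a * Q + b * R)"
    by (simp add: field_simps)
  also have "\<dots> \<le> (- nu * ((Vnorm u)\<^sup>2 + (Vnorm v)\<^sup>2) + ((Hnorm g)\<^sup>2 + (Hnorm h)\<^sup>2) / nu) / (4 * pi\<^sup>2) + 0"
  proof (rule add_mono[OF divide_right_mono])
    show "- 2 * nu * ((Vnorm u)\<^sup>2 + (Vnorm v)\<^sup>2) + (2 * ?I + 2 * ?J) \<le>
        - nu * ((Vnorm u)\<^sup>2 + (Vnorm v)\<^sup>2) + ((Hnorm g)\<^sup>2 + (Hnorm h)\<^sup>2) / nu"
      using add_mono[OF forcing[OF g u] forcing[OF h v]] by (simp add: algebra_simps add_divide_distrib)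
  qed (use low in auto)
  finally show ?thesis unfolding P_def[symmetric] Q_def[symmetric] R_def[symmetric] R' by simp
qed

text \<open>The dissipation \<open>2 * nu * X^2\<close> is spent as follows: \<open>nu\<close> on
  the nonlinear term, \<open>nu / 2\<close> on the high modes that the damping misses, while the
  remaining \<open>nu / 2\<close> is converted into a multiple of \<open>Y^2\<close> by Poincare's
  inequality. Of that multiple, \<open>nu / 4\<close> absorbs the forcing and \<open>nu / 4\<close>
  stays as the decay rate.\<close>

lemma diff_rate_le:
  assumes nu: "nu > 0" and ab: "0 \<le> a + b" "a + b \<le> N\<^sup>2 * nu / 4" and N: "N > 0"
    and u: "DA u" and v: "DA v" and g: "L2 g" and h: "L2 h"
    and CL: "(L4norm (u - v))\<^sup>2 \<le> C_L * Vnorm (u - v) * Hnorm (u - v)"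
  shows "2 * (- nu * ((Vnorm (u - v))\<^sup>2 / (4 * pi\<^sup>2)) - (\<integral>x. adv (u - v) u x \<bullet> (u - v) x \<partial>torus) / (4 * pi\<^sup>2)
      + (\<integral>x. (g - h) x \<bullet> (u - v) x \<partial>torus) / (4 * pi\<^sup>2)
      - (a + b) * (\<Sum>k\<in>low_modes N. (norm (fc (u - v) k))\<^sup>2))
    \<le> - (nu / 4 + 2 * (a + b) - C_L\<^sup>2 * (Vnorm u)\<^sup>2 / nu) * ((Hnorm (u - v))\<^sup>2 / (4 * pi\<^sup>2))
      + 4 / nu * (Hnorm (g - h))\<^sup>2 / (4 * pi\<^sup>2)"
proof -
  note w = DA_diff[OF u v]
  note Vw = DA_imp_Vsp[OF w]
  have Lw: "L2 (u - v)" using Vw Vsp_D by auto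
  define X Y Z M where "X = Vnorm (u - v)" and "Y = Hnorm (u - v)" and "Z = Vnorm u" and "M = a + b"
  define G where "G = Hnorm (g - h)"
  define I J S where "I = (\<integral>x. adv (u - v) u x \<bullet> (u - v) x \<partial>torus)" and "J = (\<integral>x. (g - h) x \<bullet> (u - v) x \<partial>torus)"
    and "S = (\<Sum>k\<in>low_modes N. (norm (fc (u - v) k))\<^sup>2)"
  define p where "p = 4 * pi\<^sup>2"
  have p: "p > 0" by (simp add: p_def)
  have nn: "0 \<le> X" "0 \<le> Y" "0 \<le> Z" "0 \<le> G" by (simp_all add: X_def Y_def Z_def G_def)
  have YX: "Y\<^sup>2 \<le> X\<^sup>2" unfolding X_def Y_def by (intro power_mono Hnorm_le_Vnorm Vw) simp
  have I: "- I \<le> C_L * X * Y * Z"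
  proof -
    have "- I \<le> (L4norm (u - v))\<^sup>2 * Z"
      using integral_adv_le_L4norm[OF w DA_imp_Vsp[OF u]] by (simp add: I_def Z_def)
    also have "\<dots> \<le> C_L * X * Y * Z" using mult_right_mono[OF CL nn(3)] by (simp add: X_def Y_def)
    finally show ?thesis .
  qed
  have J: "J \<le> G * Y" using integral_inner_le[OF L2_diff[OF g h] Lw] by (simp add: J_def G_def Y_def)
  have S: "Y\<^sup>2 / p - X\<^sup>2 / p / N\<^sup>2 \<le> S"
    using low_modes_coercive[OF Vw N] by (simp add: S_def X_def Y_def p_def)
  have 1: "2 * (C_L * X * Y * Z) \<le> nu * X\<^sup>2 + C_L\<^sup>2 * Z\<^sup>2 / nu * Y\<^sup>2"
  proof -
    have "0 \<le> (nu * X - C_L * Y * Z)\<^sup>2 / nu" using nu by simp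
    also have "\<dots> = nu * X\<^sup>2 + C_L\<^sup>2 * Z\<^sup>2 / nu * Y\<^sup>2 - 2 * (C_L * X * Y * Z)"
      using nu by (simp add: field_simps power2_eq_square)
    finally show ?thesis by argo
  qed
  \<comment> \<open>Young's inequality, weighted so that only \<open>nu / 4\<close> of
    \<open>Y^2\<close> is consumed; this is the origin of the factor \<open>4 / nu\<close> on the
    forcing.\<close>
  have 2: "2 * (G * Y) \<le> 4 / nu * G\<^sup>2 + nu / 4 * Y\<^sup>2"
  proof -
    have "0 \<le> (nu * Y - 4 * G)\<^sup>2 / (4 * nu)" using nu by simp
    also have "\<dots> = 4 / nu * G\<^sup>2 + nu / 4 * Y\<^sup>2 - 2 * (G * Y)"
      using nu by (simp add: field_simps power2_eq_square)
    finally show ?thesis by argo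
  qed
  have 3: "2 * M * (Y\<^sup>2 - X\<^sup>2 / N\<^sup>2) \<le> 2 * M * (p * S)"
  proof (rule mult_left_mono)
    have "p * (Y\<^sup>2 / p - X\<^sup>2 / p / N\<^sup>2) \<le> p * S" using p by (intro mult_left_mono S) auto
    then show "Y\<^sup>2 - X\<^sup>2 / N\<^sup>2 \<le> p * S" using p by (simp add: right_diff_distrib)
  qed (use ab in \<open>simp add: M_def\<close>)
  have 4: "2 * M * (X\<^sup>2 / N\<^sup>2) \<le> nu / 2 * X\<^sup>2"
  proof -
    have "M / N\<^sup>2 \<le> nu / 4" using ab(2) N by (simp add: M_def field_simps)
    then have "2 * (M / N\<^sup>2) * X\<^sup>2 \<le> 2 * (nu / 4) * X\<^sup>2" by (intro mult_right_mono mult_left_mono) auto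
    then show ?thesis by simp
  qed
  have 5: "nu / 2 * Y\<^sup>2 \<le> nu / 2 * X\<^sup>2" using nu by (intro mult_left_mono YX) auto
  have "- 2 * nu * X\<^sup>2 - 2 * I + 2 * J - 2 * M * (p * S) \<le> - (nu / 4 + 2 * M - C_L\<^sup>2 * Z\<^sup>2 / nu) * Y\<^sup>2 + 4 / nu * G\<^sup>2"
    using I J 1 2 3 4 5 unfolding left_diff_distrib right_diff_distrib distrib_right minus_diff_eq mult_minus_left by argo
  then have "(- 2 * nu * X\<^sup>2 - 2 * I + 2 * J - 2 * M * (p * S)) / p \<le> (- (nu / 4 + 2 * M - C_L\<^sup>2 * Z\<^sup>2 / nu) * Y\<^sup>2 + 4 / nu * G\<^sup>2) / p"
    using p by (intro divide_right_mono) auto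
  moreover have "(- 2 * nu * X\<^sup>2 - 2 * I + 2 * J - 2 * M * (p * S)) / p = 2 * (- nu * (X\<^sup>2 / p) - I / p + J / p - M * S)"
    using p by (simp add: field_simps)
  moreover have "(- (nu / 4 + 2 * M - C_L\<^sup>2 * Z\<^sup>2 / nu) * Y\<^sup>2 + 4 / nu * G\<^sup>2) / p =
      - (nu / 4 + 2 * M - C_L\<^sup>2 * Z\<^sup>2 / nu) * (Y\<^sup>2 / p) + 4 / nu * G\<^sup>2 / p"
    by (simp only: add_divide_distrib times_divide_eq_right)
  ultimately show ?thesis
    unfolding X_def[symmetric] Y_def[symmetric] Z_def[symmetric] M_def[symmetric] G_def[symmetric]
      I_def[symmetric] J_def[symmetric] S_def[symmetric] p_def[symmetric] by simp
qed

lemma bounded_on_interval: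
  fixes f :: "real \<Rightarrow> real"
  assumes "continuous_on {0..T} f"
  obtains B where "\<And>t. t \<in> {0..T} \<Longrightarrow> f t \<le> B" "0 \<le> B"
proof -
  obtain B where B: "\<forall>y\<in>f ` {0..T}. norm y \<le> B"
    using compact_imp_bounded[OF compact_continuous_image[OF assms compact_Icc]] unfolding bounded_iff by blast
  show thesis
  proof (rule that[of "max B 0"])
    fix t assume "t \<in> {0..T}"
    then have "norm (f t) \<le> B" using B by blast
    then show "f t \<le> max B 0" by simp
  qed simp
qed

lemma Linf_D: "Linf g \<Longrightarrow> 0 \<le> t \<Longrightarrow> Hsp (g t)" "Linf g \<Longrightarrow> 0 \<le> t \<Longrightarrow> L2 (g t)"
  by (auto simp: Linf_def dest: Vsp_D)

lemma Hnorm_le_gfrak: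
  assumes "Linf g" "nu > 0" "0 \<le> t"
  shows "Hnorm (g t) \<le> nu\<^sup>2 * gfrak g nu"
proof -
  have "Hnorm (g t) \<le> (SUP t\<in>{0..}. Hnorm (g t))"
    using assms by (intro cSUP_upper) (auto simp: Linf_def)
  then show ?thesis using assms by (simp add: gfrak_def)
qed

text \<open>On \<open>[0, T]\<close> the V-norms are bounded by continuity and the forcing by its
  supremum, so the bound on the right-hand side becomes affine in the integrable majorant of
  \<open>(Anorm (u t))^2\<close>.\<close>

lemma rhs_dominated:
  assumes u: "strong_class u" and w: "strong_class w" and g: "Linf g" and nu: "nu > 0" and T: "0 \<le> T"
    and int: "\<And>t k. 0 \<le> t \<Longrightarrow> ((\<lambda>s. rhs nu a b N (g s) (u s) (w s) k) has_integral (fc (u t) k - fc (u 0) k)) {0..t}"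
  obtains S D where "negligible S" "D integrable_on {0..T}" "\<And>t. t \<in> {0..T} - S \<Longrightarrow> DA (u t)"
    "\<And>t F. t \<in> {0..T} - S \<Longrightarrow> finite F \<Longrightarrow> (\<Sum>k\<in>F. (norm (rhs nu a b N (g t) (u t) (w t) k))\<^sup>2) \<le> D t"
proof -
  \<comment> \<open>Each coefficient is an indefinite integral of the right-hand side, hence
    continuous in time.\<close>
  have cont: "continuous_on {0..T} (\<lambda>t. fc (u t) k)" for k
  proof -
    have i: "(\<lambda>s. rhs nu a b N (g s) (u s) (w s) k) integrable_on {0..T}" using int[OF T] by blast
    have "continuous_on {0..T} (\<lambda>t. fc (u 0) k + integral {0..t} (\<lambda>s. rhs nu a b N (g s) (u s) (w s) k))"
      by (intro continuous_intros indefinite_integral_continuous_1 i)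
    then show ?thesis
      by (rule continuous_on_eq) (use integral_unique[OF int] in simp)
  qed
  obtain S A where S: "negligible S" and A: "A integrable_on {0..T}"
    and DA: "\<And>t. t \<in> {0..T} - S \<Longrightarrow> DA (u t)" and Ale: "\<And>t. t \<in> {0..T} - S \<Longrightarrow> (Anorm (u t))\<^sup>2 \<le> A t"
    by (rule Anorm_squared_dominated[OF u T cont]) (rule that; assumption)
  have sub: "{0..T} \<subseteq> {0..}" by auto
  obtain Bu where Bu: "\<And>t. t \<in> {0..T} \<Longrightarrow> Vnorm (u t) \<le> Bu" "0 \<le> Bu"
    by (rule bounded_on_interval[OF continuous_on_subset[OF strong_class_Vnorm_continuous[OF u] sub]]) (rule that; assumption)
  obtain Bw where Bw: "\<And>t. t \<in> {0..T} \<Longrightarrow> Vnorm (w t) \<le> Bw" "0 \<le> Bw"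
    by (rule bounded_on_interval[OF continuous_on_subset[OF strong_class_Vnorm_continuous[OF w] sub]]) (rule that; assumption)
  define Bg where "Bg = nu\<^sup>2 * gfrak g nu"
  let ?D = "\<lambda>t. 16 * ((nu\<^sup>2 + agmon_const\<^sup>2 * Bu\<^sup>2) * A t + (Bg\<^sup>2 + a\<^sup>2 * Bu\<^sup>2 + b\<^sup>2 * Bw\<^sup>2))"
  show thesis
  proof (rule that[of S ?D])
    show "?D integrable_on {0..T}"
      by (intro integrable_on_mult_right integrable_add A integrable_const_ivl)
    fix t F assume t: "t \<in> {0..T} - S" and F: "finite (F :: wn set)"
    have V: "Vsp (u t)" "Vsp (w t)" using u w t by (auto simp: strong_class_def)
    have Hu: "(Hnorm (u t))\<^sup>2 \<le> Bu\<^sup>2" and Hw: "(Hnorm (w t))\<^sup>2 \<le> Bw\<^sup>2"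
      using Hnorm_le_Vnorm[OF V(1)] Bu(1)[of t] Hnorm_le_Vnorm[OF V(2)] Bw(1)[of t] t by (auto intro!: power_mono)
    have Vu: "(Vnorm (u t))\<^sup>2 \<le> Bu\<^sup>2" using Bu(1)[of t] t by (auto intro!: power_mono)
    have Hg: "(Hnorm (g t))\<^sup>2 \<le> Bg\<^sup>2" using Hnorm_le_gfrak[OF g nu, of t] t by (auto simp: Bg_def intro!: power_mono)
    have "(\<Sum>k\<in>F. (norm (rhs nu a b N (g t) (u t) (w t) k))\<^sup>2) \<le>
        16 * (nu\<^sup>2 * (Anorm (u t))\<^sup>2 + (agmon_const * Anorm (u t))\<^sup>2 * (Vnorm (u t))\<^sup>2
          + (Hnorm (g t))\<^sup>2 + a\<^sup>2 * (Hnorm (u t))\<^sup>2 + b\<^sup>2 * (Hnorm (w t))\<^sup>2)"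
      using V(2) g t by (intro sum_norm_rhs_le DA t F) (auto intro: Linf_D dest: Vsp_D)
    also have "\<dots> \<le> 16 * (nu\<^sup>2 * A t + (agmon_const\<^sup>2 * A t) * Bu\<^sup>2 + Bg\<^sup>2 + a\<^sup>2 * Bu\<^sup>2 + b\<^sup>2 * Bw\<^sup>2)"
      unfolding power_mult_distrib using Ale[OF t] order_trans[OF zero_le_power2 Ale[OF t]]
      by (intro mult_left_mono add_mono mult_mono Hu Hw Vu Hg) auto
    also have "\<dots> = ?D t" by (simp add: algebra_simps)
    finally show "(\<Sum>k\<in>F. (norm (rhs nu a b N (g t) (u t) (w t) k))\<^sup>2) \<le> ?D t" .
  qed (use S DA in auto)
qed

section \<open>Energy balances of a given solution\<close>

locale nudging_solution =
  fixes nu mu1 mu2 N :: real and g1 g2 v1 v2 :: "real \<Rightarrow> vf"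
  assumes nu: "nu > 0" and mu: "mu1 \<ge> mu2" "mu2 \<ge> 0" and N: "N > 0"
    and g: "Linf g1" "Linf g2" and sol: "sym_nudge_sol nu mu1 mu2 N g1 g2 v1 v2"
begin

lemma strong: "strong_class v1" "strong_class v2"
  using sol by (auto simp: sym_nudge_sol_def)

lemma Vsp: "0 \<le> t \<Longrightarrow> Vsp (v1 t)" "0 \<le> t \<Longrightarrow> Vsp (v2 t)"
  using strong by (auto simp: strong_class_def)

lemma L2v: "0 \<le> t \<Longrightarrow> L2 (v1 t)" "0 \<le> t \<Longrightarrow> L2 (v2 t)"
  using Vsp Vsp_D by blast+

lemma has_integral_rhs:
  assumes "0 \<le> t"
  shows "((\<lambda>s. rhs nu mu1 mu2 N (g1 s) (v1 s) (v2 s) k) has_integral (fc (v1 t) k - fc (v1 0) k)) {0..t}"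
    and "((\<lambda>s. rhs nu mu1 mu2 N (g2 s) (v2 s) (v1 s) k) has_integral (fc (v2 t) k - fc (v2 0) k)) {0..t}"
proof -
  have eq: "rhs nu mu1 mu2 N (g2 s) (v2 s) (v1 s) k = - cmul (complex_of_real nu) (Ac (v2 s) k) - Bc (v2 s) (v2 s) k + fc (g2 s) k
            + cmul (complex_of_real mu2) (fc (PN N (v1 s)) k)
            - cmul (complex_of_real mu1) (fc (PN N (v2 s)) k)" for s
    by (simp add: rhs_def)
  show "((\<lambda>s. rhs nu mu1 mu2 N (g1 s) (v1 s) (v2 s) k) has_integral (fc (v1 t) k - fc (v1 0) k)) {0..t}"
    unfolding rhs_def using sol assms unfolding sym_nudge_sol_def by blast
  show "((\<lambda>s. rhs nu mu1 mu2 N (g2 s) (v2 s) (v1 s) k) has_integral (fc (v2 t) k - fc (v2 0) k)) {0..t}"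
    unfolding eq using sol assms unfolding sym_nudge_sol_def by blast
qed

abbreviation "f1 t \<equiv> rhs nu mu1 mu2 N (g1 t) (v1 t) (v2 t)"
abbreviation "f2 t \<equiv> rhs nu mu1 mu2 N (g2 t) (v2 t) (v1 t)"

lemma dominated:
  assumes T: "0 \<le> T"
  obtains S D where "negligible S" "D integrable_on {0..T}" "\<And>t. t \<in> {0..T} - S \<Longrightarrow> DA (v1 t)" "\<And>t. t \<in> {0..T} - S \<Longrightarrow> DA (v2 t)"
    "\<And>t F. t \<in> {0..T} - S \<Longrightarrow> finite F \<Longrightarrow> (\<Sum>k\<in>F. (norm (f1 t k))\<^sup>2) + (\<Sum>k\<in>F. (norm (f2 t k))\<^sup>2) \<le> D t"
proof -
  obtain S1 D1 where 1: "negligible S1" "D1 integrable_on {0..T}" "\<And>t. t \<in> {0..T} - S1 \<Longrightarrow> DA (v1 t)"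
    "\<And>t F. t \<in> {0..T} - S1 \<Longrightarrow> finite F \<Longrightarrow> (\<Sum>k\<in>F. (norm (f1 t k))\<^sup>2) \<le> D1 t"
    by (rule rhs_dominated[OF strong g(1) nu T has_integral_rhs(1)], assumption) (rule that; assumption)
  obtain S2 D2 where 2: "negligible S2" "D2 integrable_on {0..T}" "\<And>t. t \<in> {0..T} - S2 \<Longrightarrow> DA (v2 t)"
    "\<And>t F. t \<in> {0..T} - S2 \<Longrightarrow> finite F \<Longrightarrow> (\<Sum>k\<in>F. (norm (f2 t k))\<^sup>2) \<le> D2 t"
    by (rule rhs_dominated[OF strong(2,1) g(2) nu T has_integral_rhs(2)], assumption) (rule that; assumption)
  show thesis
    by (rule that[of "S1 \<union> S2" "\<lambda>t. D1 t + D2 t"]) (use 1 2 in \<open>auto intro!: integrable_add add_mono\<close>)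
qed

lemma Vnorm_bound:
  obtains B where "\<And>t. t \<in> {0..T} \<Longrightarrow> Vnorm (v1 t) \<le> B" "\<And>t. t \<in> {0..T} \<Longrightarrow> Vnorm (v2 t) \<le> B" "0 \<le> B"
proof -
  have sub: "{0..T} \<subseteq> {0..}" by auto
  have "continuous_on {0..T} (\<lambda>t. Vnorm (v1 t) + Vnorm (v2 t))"
    by (intro continuous_intros continuous_on_subset[OF strong_class_Vnorm_continuous[OF strong(1)] sub]
        continuous_on_subset[OF strong_class_Vnorm_continuous[OF strong(2)] sub])
  then obtain B where B: "\<And>t. t \<in> {0..T} \<Longrightarrow> Vnorm (v1 t) + Vnorm (v2 t) \<le> B" "0 \<le> B"
    by (rule bounded_on_interval) (rule that; assumption)
  have "Vnorm (v1 t) \<le> Vnorm (v1 t) + Vnorm (v2 t)" "Vnorm (v2 t) \<le> Vnorm (v1 t) + Vnorm (v2 t)" for t by simp_all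
  with B show thesis by (intro that[of B]) (meson order_trans)+
qed

text \<open>The two equations are treated as one system for the pair of coefficients, so that the
  sum of the energies comes from a single balance in which the coupling is estimated as a
  whole.\<close>

lemma pair_energy:
  assumes T: "0 \<le> T"
  obtains S \<phi> where "negligible S" "indef T (\<lambda>t. ((Hnorm (v1 t))\<^sup>2 + (Hnorm (v2 t))\<^sup>2) / (4 * pi\<^sup>2)) \<phi>"
    "\<And>t. t \<in> {0..T} - S \<Longrightarrow> \<phi> t \<le> (- nu * ((Vnorm (v1 t))\<^sup>2 + (Vnorm (v2 t))\<^sup>2) + ((Hnorm (g1 t))\<^sup>2 + (Hnorm (g2 t))\<^sup>2) / nu) / (4 * pi\<^sup>2)"
proof -
  obtain S D where S: "negligible S" "D integrable_on {0..T}" "\<And>t. t \<in> {0..T} - S \<Longrightarrow> DA (v1 t)" "\<And>t. t \<in> {0..T} - S \<Longrightarrow> DA (v2 t)"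
    "\<And>t F. t \<in> {0..T} - S \<Longrightarrow> finite F \<Longrightarrow> (\<Sum>k\<in>F. (norm (f1 t k))\<^sup>2) + (\<Sum>k\<in>F. (norm (f2 t k))\<^sup>2) \<le> D t"
    by (rule dominated[OF T]) (rule that; assumption)
  obtain B where B: "\<And>t. t \<in> {0..T} \<Longrightarrow> Vnorm (v1 t) \<le> B" "\<And>t. t \<in> {0..T} \<Longrightarrow> Vnorm (v2 t) \<le> B" "0 \<le> B"
    by (rule Vnorm_bound[of T]) (rule that; assumption)
  have np: "(norm (x, y))\<^sup>2 = (norm x)\<^sup>2 + (norm y)\<^sup>2" for x y :: "complex \<times> complex"
    by (simp add: norm_Pair)
  let ?s1 = "\<lambda>t. - nu * ((Vnorm (v1 t))\<^sup>2 / (4 * pi\<^sup>2)) + (\<integral>x. g1 t x \<bullet> v1 t x \<partial>torus) / (4 * pi\<^sup>2)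
      - mu1 * (\<Sum>k\<in>low_modes N. (norm (fc (v1 t) k))\<^sup>2) + mu2 * (\<Sum>k\<in>low_modes N. fc (v2 t) k \<bullet> fc (v1 t) k)"
  let ?s2 = "\<lambda>t. - nu * ((Vnorm (v2 t))\<^sup>2 / (4 * pi\<^sup>2)) + (\<integral>x. g2 t x \<bullet> v2 t x \<partial>torus) / (4 * pi\<^sup>2)
      - mu1 * (\<Sum>k\<in>low_modes N. (norm (fc (v2 t) k))\<^sup>2) + mu2 * (\<Sum>k\<in>low_modes N. fc (v1 t) k \<bullet> fc (v2 t) k)"
  define \<phi> where "\<phi> t = 2 * ?s1 t + 2 * ?s2 t" for t
  have "indef T (\<lambda>t. ((Hnorm (v1 t))\<^sup>2 + (Hnorm (v2 t))\<^sup>2) / (4 * pi\<^sup>2)) (\<lambda>t. if t \<in> S then 0 else \<phi> t)"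
  proof (rule energy_balance[where c = "\<lambda>t k. (fc (v1 t) k, fc (v2 t) k)" and f = "\<lambda>t k. (f1 t k, f2 t k)"
      and D = D and C = "2 * B\<^sup>2", OF T])
    show "((\<lambda>s. (f1 s k, f2 s k)) has_integral ((fc (v1 t) k, fc (v2 t) k) - (fc (v1 0) k, fc (v2 0) k))) {0..t}"
      if "0 \<le> t" "t \<le> T" for k t
      using has_integral_Pair[OF has_integral_rhs(1)[OF that(1), of k] has_integral_rhs(2)[OF that(1), of k]] by simp
    show "((\<lambda>k. (norm (fc (v1 t) k, fc (v2 t) k))\<^sup>2) has_sum (((Hnorm (v1 t))\<^sup>2 + (Hnorm (v2 t))\<^sup>2) / (4 * pi\<^sup>2))) UNIV"
      if "0 \<le> t" "t \<le> T" for t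
      unfolding np add_divide_distrib by (intro has_sum_add has_sum_Hnorm L2v that)
    show "((Hnorm (v1 t))\<^sup>2 + (Hnorm (v2 t))\<^sup>2) / (4 * pi\<^sup>2) \<le> 2 * B\<^sup>2" if "0 \<le> t" "t \<le> T" for t
    proof -
      have "(Hnorm (v1 t))\<^sup>2 \<le> B\<^sup>2" "(Hnorm (v2 t))\<^sup>2 \<le> B\<^sup>2"
        using order_trans[OF Hnorm_le_Vnorm[OF Vsp(1)] B(1), of t] order_trans[OF Hnorm_le_Vnorm[OF Vsp(2)] B(2), of t] that
        by (auto intro!: power_mono)
      then have le: "(Hnorm (v1 t))\<^sup>2 + (Hnorm (v2 t))\<^sup>2 \<le> 2 * B\<^sup>2" by simp
      have "((Hnorm (v1 t))\<^sup>2 + (Hnorm (v2 t))\<^sup>2) / (4 * pi\<^sup>2) \<le> (Hnorm (v1 t))\<^sup>2 + (Hnorm (v2 t))\<^sup>2"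
        by (rule divide_four_pi_squared_le) simp
      then show ?thesis using le by simp
    qed
    show "(\<Sum>k\<in>F. (norm (f1 t k, f2 t k))\<^sup>2) \<le> D t" if "t \<in> {0..T} - S" "finite F" for t F
      unfolding np sum.distrib by (rule S(5)[OF that])
    show "((\<lambda>k. 2 * ((f1 t k, f2 t k) \<bullet> (fc (v1 t) k, fc (v2 t) k))) has_sum \<phi> t) UNIV" if t: "t \<in> {0..T} - S" for t
    proof -
      have g': "L2 (g1 t)" "L2 (g2 t)" using g t by (auto intro: Linf_D)
      show ?thesis
        unfolding inner_Pair distrib_left[of 2 "_ \<bullet> _"] \<phi>_def
        by (intro has_sum_add has_sum_cmult_right has_sum_rhs_self S t g')
    qed
  qed (use S in auto)
  moreover have "\<phi> t \<le> (- nu * ((Vnorm (v1 t))\<^sup>2 + (Vnorm (v2 t))\<^sup>2) + ((Hnorm (g1 t))\<^sup>2 + (Hnorm (g2 t))\<^sup>2) / nu) / (4 * pi\<^sup>2)"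
    if t: "t \<in> {0..T} - S" for t
    unfolding \<phi>_def using g t by (intro pair_rate_le nu mu S t) (auto intro: Linf_D)
  ultimately show thesis using S(1) by (intro that[of S]) auto
qed

lemma diff_energy:
  assumes T: "0 \<le> T" and cond: "mu1 + mu2 \<le> N\<^sup>2 * nu / 4"
    and CL: "\<And>u. Vsp u \<Longrightarrow> (L4norm u)\<^sup>2 \<le> C_L * Vnorm u * Hnorm u"
  obtains S \<phi> where "negligible S" "indef T (\<lambda>t. (Hnorm (v1 t - v2 t))\<^sup>2 / (4 * pi\<^sup>2)) \<phi>"
    "\<And>t. t \<in> {0..T} - S \<Longrightarrow> \<phi> t \<le> - (nu / 4 + 2 * (mu1 + mu2) - C_L\<^sup>2 * (Vnorm (v1 t))\<^sup>2 / nu) * ((Hnorm (v1 t - v2 t))\<^sup>2 / (4 * pi\<^sup>2))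
      + 4 / nu * (Hnorm (g1 t - g2 t))\<^sup>2 / (4 * pi\<^sup>2)"
proof -
  obtain S D where S: "negligible S" "D integrable_on {0..T}" "\<And>t. t \<in> {0..T} - S \<Longrightarrow> DA (v1 t)" "\<And>t. t \<in> {0..T} - S \<Longrightarrow> DA (v2 t)"
    "\<And>t F. t \<in> {0..T} - S \<Longrightarrow> finite F \<Longrightarrow> (\<Sum>k\<in>F. (norm (f1 t k))\<^sup>2) + (\<Sum>k\<in>F. (norm (f2 t k))\<^sup>2) \<le> D t"
    by (rule dominated[OF T]) (rule that; assumption)
  obtain B where B: "\<And>t. t \<in> {0..T} \<Longrightarrow> Vnorm (v1 t) \<le> B" "\<And>t. t \<in> {0..T} \<Longrightarrow> Vnorm (v2 t) \<le> B" "0 \<le> B"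
    by (rule Vnorm_bound[of T]) (rule that; assumption)
  define \<phi> where "\<phi> t = 2 * (- nu * ((Vnorm (v1 t - v2 t))\<^sup>2 / (4 * pi\<^sup>2)) - (\<integral>x. adv (v1 t - v2 t) (v1 t) x \<bullet> (v1 t - v2 t) x \<partial>torus) / (4 * pi\<^sup>2)
      + (\<integral>x. (g1 t - g2 t) x \<bullet> (v1 t - v2 t) x \<partial>torus) / (4 * pi\<^sup>2)
      - (mu1 + mu2) * (\<Sum>k\<in>low_modes N. (norm (fc (v1 t - v2 t) k))\<^sup>2))" for t
  have fcd: "fc (v1 t - v2 t) k = fc (v1 t) k - fc (v2 t) k" if "0 \<le> t" for t k
    by (rule fc_diff[OF L2v(1)[OF that] L2v(2)[OF that]])
  have "indef T (\<lambda>t. (Hnorm (v1 t - v2 t))\<^sup>2 / (4 * pi\<^sup>2)) (\<lambda>t. if t \<in> S then 0 else \<phi> t)"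
  \<comment> \<open>Both \<open>2 * D t\<close> and \<open>4 * B^2\<close> come from bounding the
    square of a difference by twice the sum of the squares.\<close>
  proof (rule energy_balance[where c = "\<lambda>t k. fc (v1 t - v2 t) k" and f = "\<lambda>t k. f1 t k - f2 t k"
      and D = "\<lambda>t. 2 * D t" and C = "4 * B\<^sup>2", OF T])
    show "((\<lambda>s. f1 s k - f2 s k) has_integral (fc (v1 t - v2 t) k - fc (v1 0 - v2 0) k)) {0..t}"
      if "0 \<le> t" "t \<le> T" for k t
      using has_integral_diff[OF has_integral_rhs(1)[OF that(1), of k] has_integral_rhs(2)[OF that(1), of k]] that
      by (simp add: fcd algebra_simps)
    show "((\<lambda>k. (norm (fc (v1 t - v2 t) k))\<^sup>2) has_sum ((Hnorm (v1 t - v2 t))\<^sup>2 / (4 * pi\<^sup>2))) UNIV"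
      if "0 \<le> t" "t \<le> T" for t
      by (intro has_sum_Hnorm L2_diff L2v that)
    show "(Hnorm (v1 t - v2 t))\<^sup>2 / (4 * pi\<^sup>2) \<le> 4 * B\<^sup>2" if "0 \<le> t" "t \<le> T" for t
    proof -
      have L: "L2 (v1 t)" "L2 (v2 t)" using L2v that by auto
      have "(Hnorm (v1 t))\<^sup>2 \<le> B\<^sup>2" "(Hnorm (v2 t))\<^sup>2 \<le> B\<^sup>2"
        using order_trans[OF Hnorm_le_Vnorm[OF Vsp(1)] B(1), of t] order_trans[OF Hnorm_le_Vnorm[OF Vsp(2)] B(2), of t] that
        by (auto intro!: power_mono)
      moreover have "(Hnorm (v1 t - v2 t))\<^sup>2 \<le> 2 * (Hnorm (v1 t))\<^sup>2 + 2 * (Hnorm (v2 t))\<^sup>2"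
      proof -
        have "(Hnorm (v1 t - v2 t))\<^sup>2 \<le> (\<integral>x. 2 * (norm (v1 t x))\<^sup>2 + 2 * (norm (v2 t x))\<^sup>2 \<partial>torus)"
          unfolding Hnorm_squared
        proof (rule integral_mono)
          show "(norm ((v1 t - v2 t) x))\<^sup>2 \<le> 2 * (norm (v1 t x))\<^sup>2 + 2 * (norm (v2 t x))\<^sup>2" for x
            using norm_add_squared_le[of "v1 t x" "- v2 t x"] by simp
        qed (intro integrable_norm_squared L2_diff L Bochner_Integration.integrable_add integrable_mult_right)+
        then show ?thesis by (simp add: Hnorm_squared integrable_norm_squared L)
      qed
      ultimately have le: "(Hnorm (v1 t - v2 t))\<^sup>2 \<le> 4 * B\<^sup>2" by argo
      have "(Hnorm (v1 t - v2 t))\<^sup>2 / (4 * pi\<^sup>2) \<le> (Hnorm (v1 t - v2 t))\<^sup>2"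
        by (rule divide_four_pi_squared_le) simp
      then show ?thesis using le by simp
    qed
    show "(\<lambda>t. 2 * D t) integrable_on {0..T}" by (intro integrable_on_mult_right S)
    show "(\<Sum>k\<in>F. (norm (f1 t k - f2 t k))\<^sup>2) \<le> 2 * D t" if "t \<in> {0..T} - S" "finite F" for t F
    proof -
      have "(\<Sum>k\<in>F. (norm (f1 t k - f2 t k))\<^sup>2) \<le> (\<Sum>k\<in>F. 2 * (norm (f1 t k))\<^sup>2 + 2 * (norm (f2 t k))\<^sup>2)"
        using norm_add_squared_le[of "f1 t k" "- f2 t k" for k] by (intro sum_mono) simp
      also have "\<dots> = 2 * ((\<Sum>k\<in>F. (norm (f1 t k))\<^sup>2) + (\<Sum>k\<in>F. (norm (f2 t k))\<^sup>2))"
        by (simp only: sum.distrib sum_distrib_left[symmetric] distrib_left)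
      also have "\<dots> \<le> 2 * D t" by (intro mult_left_mono S(5)[OF that]) simp
      finally show ?thesis .
    qed
    show "((\<lambda>k. 2 * ((f1 t k - f2 t k) \<bullet> fc (v1 t - v2 t) k)) has_sum \<phi> t) UNIV" if t: "t \<in> {0..T} - S" for t
    proof -
      have g': "L2 (g1 t)" "L2 (g2 t)" using g t by (auto intro: Linf_D)
      show ?thesis
        unfolding \<phi>_def by (intro has_sum_cmult_right has_sum_rhs_diff S t g')
    qed
  qed (use S in auto)
  moreover have "\<phi> t \<le> - (nu / 4 + 2 * (mu1 + mu2) - C_L\<^sup>2 * (Vnorm (v1 t))\<^sup>2 / nu) * ((Hnorm (v1 t - v2 t))\<^sup>2 / (4 * pi\<^sup>2))
      + 4 / nu * (Hnorm (g1 t - g2 t))\<^sup>2 / (4 * pi\<^sup>2)"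
    if t: "t \<in> {0..T} - S" for t
  proof -
    have "L2 (g1 t)" "L2 (g2 t)" "0 \<le> t" using g t by (auto intro: Linf_D)
    moreover have "0 \<le> mu1 + mu2" using mu by simp
    ultimately show ?thesis
      unfolding \<phi>_def by (intro diff_rate_le nu cond N S t CL Vsp_diff Vsp)
  qed
  ultimately show thesis using S(1) by (intro that[of S]) auto
qed

end

section \<open>Long-time bounds and convergence\<close>

context nudging_solution
begin

definition pair_E :: "real \<Rightarrow> real" where
  "pair_E t = ((Hnorm (v1 t))\<^sup>2 + (Hnorm (v2 t))\<^sup>2) / (4 * pi\<^sup>2)"

text \<open>Each forcing has norm at most \<open>nu^2\<close> times its \<open>gfrak\<close>;
  squaring and dividing by \<open>nu\<close> leaves \<open>nu^3\<close>.\<close>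

definition forcing_const :: real where
  "forcing_const = nu ^ 3 * ((gfrak g1 nu)\<^sup>2 + (gfrak g2 nu)\<^sup>2)"

lemma forcing_const_nonneg: "0 \<le> forcing_const"
  using nu by (simp add: forcing_const_def)

lemma pair_E_nonneg: "0 \<le> pair_E t"
  by (simp add: pair_E_def)

lemma forcing_le:
  assumes t: "0 \<le> t"
  shows "((Hnorm (g1 t))\<^sup>2 + (Hnorm (g2 t))\<^sup>2) / nu \<le> forcing_const"
proof -
  have "(Hnorm (g1 t))\<^sup>2 \<le> (nu\<^sup>2 * gfrak g1 nu)\<^sup>2" "(Hnorm (g2 t))\<^sup>2 \<le> (nu\<^sup>2 * gfrak g2 nu)\<^sup>2"
    using Hnorm_le_gfrak[OF g(1) nu t] Hnorm_le_gfrak[OF g(2) nu t] by (auto intro!: power_mono)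
  then have "((Hnorm (g1 t))\<^sup>2 + (Hnorm (g2 t))\<^sup>2) / nu \<le> ((nu\<^sup>2 * gfrak g1 nu)\<^sup>2 + (nu\<^sup>2 * gfrak g2 nu)\<^sup>2) / nu"
    using nu by (intro divide_right_mono add_mono) auto
  also have "\<dots> = forcing_const"
    using nu by (simp add: forcing_const_def field_simps power2_eq_square power3_eq_cube)
  finally show ?thesis .
qed

lemma pair_rate:
  assumes T: "0 \<le> T"
  obtains S \<phi> where "negligible S" "indef T pair_E \<phi>"
    "\<And>t. t \<in> {0..T} - S \<Longrightarrow> \<phi> t \<le> (- nu * ((Vnorm (v1 t))\<^sup>2 + (Vnorm (v2 t))\<^sup>2) + forcing_const) / (4 * pi\<^sup>2)"
proof -
  obtain S \<phi> where 1: "negligible S" "indef T (\<lambda>t. ((Hnorm (v1 t))\<^sup>2 + (Hnorm (v2 t))\<^sup>2) / (4 * pi\<^sup>2)) \<phi>"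
    "\<And>t. t \<in> {0..T} - S \<Longrightarrow> \<phi> t \<le> (- nu * ((Vnorm (v1 t))\<^sup>2 + (Vnorm (v2 t))\<^sup>2) + ((Hnorm (g1 t))\<^sup>2 + (Hnorm (g2 t))\<^sup>2) / nu) / (4 * pi\<^sup>2)"
    by (rule pair_energy[OF T]) (rule that; assumption)
  show thesis
  proof (rule that[of S \<phi>])
    show "indef T pair_E \<phi>" using 1(2) by (simp add: pair_E_def[abs_def])
    fix t assume t: "t \<in> {0..T} - S"
    have "\<phi> t \<le> (- nu * ((Vnorm (v1 t))\<^sup>2 + (Vnorm (v2 t))\<^sup>2) + ((Hnorm (g1 t))\<^sup>2 + (Hnorm (g2 t))\<^sup>2) / nu) / (4 * pi\<^sup>2)"
      by (rule 1(3)[OF t])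
    also have "\<dots> \<le> (- nu * ((Vnorm (v1 t))\<^sup>2 + (Vnorm (v2 t))\<^sup>2) + forcing_const) / (4 * pi\<^sup>2)"
      using t by (intro divide_right_mono add_left_mono forcing_le) auto
    finally show "\<phi> t \<le> (- nu * ((Vnorm (v1 t))\<^sup>2 + (Vnorm (v2 t))\<^sup>2) + forcing_const) / (4 * pi\<^sup>2)" .
  qed (rule 1(1))
qed

definition pair_bound :: real where
  "pair_bound = pair_E 0 + forcing_const / (4 * pi\<^sup>2) / nu"

text \<open>Poincare's inequality turns the dissipation into decay at the constant rate
  \<open>nu\<close>, so Gronwall's inequality applies with \<open>K = 0\<close> and gives the
  initial energy plus forcing over rate.\<close>

lemma pair_E_le:
  assumes t: "0 \<le> t"
  shows "pair_E t \<le> pair_bound"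
proof -
  obtain S \<phi> where S: "negligible S" "indef t pair_E \<phi>"
    "\<And>r. r \<in> {0..t} - S \<Longrightarrow> \<phi> r \<le> (- nu * ((Vnorm (v1 r))\<^sup>2 + (Vnorm (v2 r))\<^sup>2) + forcing_const) / (4 * pi\<^sup>2)"
    by (rule pair_rate[OF t]) (rule that; assumption)
  have "pair_E t \<le> exp 0 * (pair_E 0 * exp (- nu * (t - 0)) + forcing_const / (4 * pi\<^sup>2) / nu)"
  proof (rule weighted_energy_le[OF S(2), where \<alpha> = "\<lambda>_. nu" and N = S])
    fix r assume r: "r \<in> {0..t} - S"
    then have r0: "0 \<le> r" by simp
    have "(Hnorm (v1 r))\<^sup>2 \<le> (Vnorm (v1 r))\<^sup>2" "(Hnorm (v2 r))\<^sup>2 \<le> (Vnorm (v2 r))\<^sup>2"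
      using Hnorm_le_Vnorm[OF Vsp(1)[OF r0]] Hnorm_le_Vnorm[OF Vsp(2)[OF r0]] by (auto intro!: power_mono)
    then have "nu * ((Hnorm (v1 r))\<^sup>2 + (Hnorm (v2 r))\<^sup>2) \<le> nu * ((Vnorm (v1 r))\<^sup>2 + (Vnorm (v2 r))\<^sup>2)"
      using nu by (intro mult_left_mono add_mono) auto
    then have "(- nu * ((Vnorm (v1 r))\<^sup>2 + (Vnorm (v2 r))\<^sup>2) + forcing_const) / (4 * pi\<^sup>2) \<le>
        (- nu * ((Hnorm (v1 r))\<^sup>2 + (Hnorm (v2 r))\<^sup>2) + forcing_const) / (4 * pi\<^sup>2)"
      by (intro divide_right_mono) auto
    also have "\<dots> = - nu * pair_E r + forcing_const / (4 * pi\<^sup>2)"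
      by (simp add: pair_E_def field_simps)
    finally show "\<phi> r \<le> - nu * pair_E r + forcing_const / (4 * pi\<^sup>2)" using S(3)[OF r] by linarith
  qed (use S(1) t nu forcing_const_nonneg pair_E_nonneg in auto)
  also have "\<dots> \<le> pair_bound"
    using nu t mult_left_mono[of "exp (- nu * t)" 1 "pair_E 0"] pair_E_nonneg[of 0] by (simp add: pair_bound_def)
  finally show ?thesis .
qed

lemma Vnorm_squared_continuous: "0 \<le> s \<Longrightarrow> continuous_on {s..t} (\<lambda>r. (Vnorm (v1 r))\<^sup>2)"
  by (intro continuous_intros continuous_on_subset[OF strong_class_Vnorm_continuous[OF strong(1)]]) auto

text \<open>Here the dissipation is kept and integrated. The energy at \<open>s\<close> is replaced
  by its uniform bound, so the additive term depends neither on \<open>s\<close> nor on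
  \<open>t\<close>; this uniformity is what permits a comparison started at an arbitrarily late
  time.\<close>

lemma integral_Vnorm_le:
  assumes st: "0 \<le> s" "s \<le> t"
  shows "nu * integral {s..t} (\<lambda>r. (Vnorm (v1 r))\<^sup>2) \<le> forcing_const * (t - s) + 4 * pi\<^sup>2 * pair_bound"
proof -
  have t: "0 \<le> t" using st by simp
  obtain S \<phi> where S: "negligible S" "indef t pair_E \<phi>"
    "\<And>r. r \<in> {0..t} - S \<Longrightarrow> \<phi> r \<le> (- nu * ((Vnorm (v1 r))\<^sup>2 + (Vnorm (v2 r))\<^sup>2) + forcing_const) / (4 * pi\<^sup>2)"
    by (rule pair_rate[OF t]) (rule that; assumption)
  let ?V = "\<lambda>r. (Vnorm (v1 r))\<^sup>2"
  have Vi: "(?V has_integral (integral {s..t} ?V)) {s..t}"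
    by (intro integrable_integral integrable_continuous_real Vnorm_squared_continuous st)
  have "((\<lambda>r. (1 / (4 * pi\<^sup>2)) * (- nu * ?V r + forcing_const)) has_integral
      ((1 / (4 * pi\<^sup>2)) * (- nu * integral {s..t} ?V + (t - s) * forcing_const))) {s..t}"
    using has_integral_const_real[of forcing_const s t] st
    by (intro has_integral_mult_right has_integral_add Vi) simp
  then have psi: "((\<lambda>r. (- nu * ?V r + forcing_const) / (4 * pi\<^sup>2)) has_integral
      ((- nu * integral {s..t} ?V + (t - s) * forcing_const) / (4 * pi\<^sup>2))) {s..t}"
    by simp
  have "pair_E t - pair_E s \<le> integral {s..t} (\<lambda>r. (- nu * ?V r + forcing_const) / (4 * pi\<^sup>2))"
  proof (rule indef_diff_le[OF S(2,1) st order_refl has_integral_integrable[OF psi]])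
    fix r assume r: "r \<in> {s..t} - S"
    have "nu * (Vnorm (v1 r))\<^sup>2 \<le> nu * ((Vnorm (v1 r))\<^sup>2 + (Vnorm (v2 r))\<^sup>2)"
      using nu by (intro mult_left_mono) auto
    then have "(- nu * ((Vnorm (v1 r))\<^sup>2 + (Vnorm (v2 r))\<^sup>2) + forcing_const) / (4 * pi\<^sup>2) \<le> (- nu * ?V r + forcing_const) / (4 * pi\<^sup>2)"
      by (intro divide_right_mono) auto
    then show "\<phi> r \<le> (- nu * ?V r + forcing_const) / (4 * pi\<^sup>2)"
      using S(3)[of r] r st by force
  qed
  then have "(4 * pi\<^sup>2) * (pair_E t - pair_E s) \<le> - nu * integral {s..t} ?V + (t - s) * forcing_const"
    unfolding integral_unique[OF psi] by (simp add: field_simps)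
  moreover have "(4 * pi\<^sup>2) * (pair_E s - pair_E t) \<le> (4 * pi\<^sup>2) * pair_bound"
    using pair_E_le[OF st(1)] pair_E_nonneg[of t] by (intro mult_left_mono) auto
  ultimately show ?thesis by (simp add: algebra_simps)
qed

text \<open>Up to the additive constant, the time average of
  \<open>C_L^2 * (Vnorm (v1 r))^2 / nu\<close> is at most \<open>C_L^2 * nu\<close> times the
  squared forcing size, and \<open>cond\<close> bounds four times this quantity by
  \<open>mu1 + mu2\<close>. The damping \<open>2 * (mu1 + mu2)\<close> therefore outweighs it, and
  \<open>nu / 4\<close> survives as the rate.\<close>

lemma damping_lower:
  fixes C_L :: real
  assumes cond: "(4 * C_L * sqrt ((gfrak g1 nu)\<^sup>2 + (gfrak g2 nu)\<^sup>2))\<^sup>2 * nu / 4 \<le> mu1 + mu2"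
    and st: "0 \<le> s" "s \<le> t"
  shows "nu / 4 * (t - s) - C_L\<^sup>2 * (4 * pi\<^sup>2 * pair_bound) / nu\<^sup>2 \<le>
    integral {s..t} (\<lambda>r. nu / 4 + 2 * (mu1 + mu2) - C_L\<^sup>2 * (Vnorm (v1 r))\<^sup>2 / nu)"
proof -
  let ?V = "\<lambda>r. (Vnorm (v1 r))\<^sup>2"
  have Vi: "(?V has_integral (integral {s..t} ?V)) {s..t}"
    by (intro integrable_integral integrable_continuous_real Vnorm_squared_continuous st)
  have "((\<lambda>r. (nu / 4 + 2 * (mu1 + mu2)) - C_L\<^sup>2 / nu * ?V r) has_integral
      ((t - s) * (nu / 4 + 2 * (mu1 + mu2)) - C_L\<^sup>2 / nu * integral {s..t} ?V)) {s..t}"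
    using has_integral_const_real[of "nu / 4 + 2 * (mu1 + mu2)" s t] st
    by (intro has_integral_mult_right has_integral_diff Vi) simp
  then have I: "integral {s..t} (\<lambda>r. nu / 4 + 2 * (mu1 + mu2) - C_L\<^sup>2 * ?V r / nu) =
      (t - s) * (nu / 4 + 2 * (mu1 + mu2)) - C_L\<^sup>2 / nu * integral {s..t} ?V"
    by (simp add: integral_unique)
  have "C_L\<^sup>2 / nu\<^sup>2 * (nu * integral {s..t} ?V) \<le> C_L\<^sup>2 / nu\<^sup>2 * (forcing_const * (t - s) + 4 * pi\<^sup>2 * pair_bound)"
    by (intro mult_left_mono integral_Vnorm_le st) auto
  moreover have "C_L\<^sup>2 / nu\<^sup>2 * (nu * integral {s..t} ?V) = C_L\<^sup>2 / nu * integral {s..t} ?V"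
    using nu by (simp add: power2_eq_square)
  moreover have "C_L\<^sup>2 / nu\<^sup>2 * forcing_const * (t - s) \<le> 2 * (mu1 + mu2) * (t - s)"
  proof (rule mult_right_mono)
    have "C_L\<^sup>2 / nu\<^sup>2 * forcing_const = C_L\<^sup>2 * nu * ((gfrak g1 nu)\<^sup>2 + (gfrak g2 nu)\<^sup>2)"
      using nu by (simp add: forcing_const_def field_simps power2_eq_square power3_eq_cube)
    moreover have "(4 * C_L * sqrt ((gfrak g1 nu)\<^sup>2 + (gfrak g2 nu)\<^sup>2))\<^sup>2 * nu / 4 =
        4 * (C_L\<^sup>2 * nu * ((gfrak g1 nu)\<^sup>2 + (gfrak g2 nu)\<^sup>2))"
      by (simp add: power_mult_distrib)
    moreover have "0 \<le> C_L\<^sup>2 * nu * ((gfrak g1 nu)\<^sup>2 + (gfrak g2 nu)\<^sup>2)" using nu by simp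
    ultimately show "C_L\<^sup>2 / nu\<^sup>2 * forcing_const \<le> 2 * (mu1 + mu2)" using cond mu by argo
  qed (use st in simp)
  moreover have "C_L\<^sup>2 / nu\<^sup>2 * (forcing_const * (t - s) + 4 * pi\<^sup>2 * pair_bound) =
      C_L\<^sup>2 / nu\<^sup>2 * forcing_const * (t - s) + C_L\<^sup>2 * (4 * pi\<^sup>2 * pair_bound) / nu\<^sup>2"
    by (simp only: distrib_left times_divide_eq_left mult.assoc)
  moreover have "(t - s) * (nu / 4 + 2 * (mu1 + mu2)) = nu / 4 * (t - s) + 2 * (mu1 + mu2) * (t - s)"
    by (simp only: distrib_left mult.commute)
  \<comment> \<open>What is left is linear; stating it for variables keeps the products out of the
    arithmetic.\<close>
  moreover have "nu / 4 * d - c \<le> x - w"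
    if "w' \<le> y" "w' = w" "z \<le> q" "y = z + c" "x = nu / 4 * d + q" for c d w w' x y z q
    using that by argo
  ultimately show ?thesis unfolding I by blast
qed

text \<open>\<open>K\<close> does not depend on the starting time, so the smallness \<eta> asked of
  the forcing can be fixed before the time \<open>s\<close> after which it holds. The energy present
  at \<open>s\<close> then decays exponentially.\<close>

lemma difference_tendsto_0:
  fixes C_L :: real
  assumes CL: "\<And>u. Vsp u \<Longrightarrow> (L4norm u)\<^sup>2 \<le> C_L * Vnorm u * Hnorm u"
    and cond: "(4 * C_L * sqrt ((gfrak g1 nu)\<^sup>2 + (gfrak g2 nu)\<^sup>2))\<^sup>2 * nu / 4 \<le> mu1 + mu2"
      "mu1 + mu2 \<le> N\<^sup>2 * nu / 4"
    and gconv: "((\<lambda>t. Hnorm (g1 t - g2 t)) \<longlongrightarrow> 0) at_top"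
  shows "((\<lambda>t. (Hnorm (v1 t - v2 t))\<^sup>2 / (4 * pi\<^sup>2)) \<longlongrightarrow> 0) at_top"
proof (rule tendstoI)
  fix e :: real assume e: "e > 0"
  define E where "E t = (Hnorm (v1 t - v2 t))\<^sup>2 / (4 * pi\<^sup>2)" for t
  have E_nonneg: "0 \<le> E t" for t by (simp add: E_def)
  define K where "K = C_L\<^sup>2 * (4 * pi\<^sup>2 * pair_bound) / nu\<^sup>2"
  \<comment> \<open>Chosen so that \<open>exp K * (\<eta> / (nu / 4)) = e / 2\<close>; the other
    half of \<open>e\<close> is reserved for the decaying energy from time \<open>s\<close>.\<close>
  define \<eta> where "\<eta> = e * nu / (8 * exp K)"
  have eta: "\<eta> > 0" using e nu by (simp add: \<eta>_def)
  have "((\<lambda>t. 4 / nu * (Hnorm (g1 t - g2 t))\<^sup>2 / (4 * pi\<^sup>2)) \<longlongrightarrow> 4 / nu * 0\<^sup>2 / (4 * pi\<^sup>2)) at_top"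
    by (intro tendsto_intros gconv) auto
  then have "\<forall>\<^sub>F t in at_top. 4 / nu * (Hnorm (g1 t - g2 t))\<^sup>2 / (4 * pi\<^sup>2) < \<eta>"
    using eta by (intro order_tendstoD(2)) auto
  then obtain s0 where s0: "\<And>t. t \<ge> s0 \<Longrightarrow> 4 / nu * (Hnorm (g1 t - g2 t))\<^sup>2 / (4 * pi\<^sup>2) < \<eta>"
    by (auto simp: eventually_at_top_linorder)
  define s where "s = max s0 0"
  have s: "0 \<le> s" "s0 \<le> s" by (auto simp: s_def)
  let ?a = "\<lambda>r. nu / 4 + 2 * (mu1 + mu2) - C_L\<^sup>2 * (Vnorm (v1 r))\<^sup>2 / nu"
  have bound: "E t \<le> exp K * (E s * exp (- (nu / 4) * (t - s)) + \<eta> / (nu / 4))" if "s \<le> t" for t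
  proof -
    have t: "0 \<le> t" using that s by simp
    obtain S \<phi> where S: "negligible S" "indef t (\<lambda>t. (Hnorm (v1 t - v2 t))\<^sup>2 / (4 * pi\<^sup>2)) \<phi>"
      "\<And>r. r \<in> {0..t} - S \<Longrightarrow> \<phi> r \<le> - ?a r * ((Hnorm (v1 r - v2 r))\<^sup>2 / (4 * pi\<^sup>2))
        + 4 / nu * (Hnorm (g1 r - g2 r))\<^sup>2 / (4 * pi\<^sup>2)"
      by (rule diff_energy[OF t cond(2) CL], assumption) (rule that; assumption)
    note S = S[folded E_def]
    show ?thesis
    proof (rule weighted_energy_le[OF S(2) _ S(1) s(1) that order_refl])
      show "continuous_on {0..t} ?a"
        using nu by (intro continuous_intros Vnorm_squared_continuous) auto
      show "\<phi> r \<le> - ?a r * E r + \<eta>" if "r \<in> {s..t} - S" for r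
        using S(3)[of r] s0[of r] that s by force
      show "nu / 4 * (t - r) - K \<le> integral {r..t} ?a" if "s \<le> r" "r \<le> t" for r
        unfolding K_def using that s by (intro damping_lower cond) auto
    qed (use nu eta E_nonneg in auto)
  qed
  have half: "exp K * (\<eta> / (nu / 4)) = e / 2"
    using nu by (simp add: \<eta>_def)
  have "((\<lambda>t. exp K * (E s * exp (- (nu / 4) * (t - s)))) \<longlongrightarrow> exp K * (E s * 0)) at_top"
  proof (intro tendsto_intros filterlim_compose[OF exp_at_bot])
    have "filterlim (\<lambda>t. - s + t) at_top at_top" by (rule filterlim_tendsto_add_at_top[OF tendsto_const filterlim_ident])
    then show "filterlim (\<lambda>t. - (nu / 4) * (t - s)) at_bot at_top"
      using nu by (intro filterlim_tendsto_neg_mult_at_bot[OF tendsto_const]) auto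
  qed
  then have "\<forall>\<^sub>F t in at_top. exp K * (E s * exp (- (nu / 4) * (t - s))) < e / 2"
    using e by (intro order_tendstoD(2)) auto
  then show "\<forall>\<^sub>F t in at_top. dist ((Hnorm (v1 t - v2 t))\<^sup>2 / (4 * pi\<^sup>2)) 0 < e"
    using eventually_ge_at_top[of s]
  proof eventually_elim
    case (elim t)
    have "E t \<le> exp K * (E s * exp (- (nu / 4) * (t - s))) + exp K * (\<eta> / (nu / 4))"
      using bound[OF elim(2)] by (simp only: distrib_left)
    then have "E t < e" using elim(1) half by argo
    then show ?case using E_nonneg[of t] by (simp add: E_def)
  qed
qed

end

theorem theorem3p17:
  fixes nu mu1 mu2 N C_L :: real and g1 g2 v1 v2 :: "real \<Rightarrow> vf"
  assumes nu: "nu > 0"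
    and mu: "mu1 \<ge> mu2" "mu2 \<ge> 0"
    and N: "N > 0"
    and CL: "\<forall>u. Vsp u \<longrightarrow> (L4norm u)^2 \<le> C_L * Vnorm u * Hnorm u"
    and g: "Linf g1" "Linf g2"
    and cond: "(4 * C_L * sqrt ((gfrak g1 nu)^2 + (gfrak g2 nu)^2))^2 * nu / 4 \<le> mu1 + mu2"
              "mu1 + mu2 \<le> N^2 * nu / 4"
    and sol: "sym_nudge_sol nu mu1 mu2 N g1 g2 v1 v2"
    and gconv: "((\<lambda>t. Hnorm (g1 t - g2 t)) \<longlongrightarrow> 0) at_top"
  shows "((\<lambda>t. Hnorm (v1 t - v2 t)) \<longlongrightarrow> 0) at_top"
proof -
  interpret nudging_solution nu mu1 mu2 N g1 g2 v1 v2
    by unfold_locales (fact nu mu N g sol)+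
  have "((\<lambda>t. (Hnorm (v1 t - v2 t))\<^sup>2 / (4 * pi\<^sup>2)) \<longlongrightarrow> 0) at_top"
    using CL by (intro difference_tendsto_0[of C_L] cond gconv) auto
  \<comment> \<open>Multiplying by \<open>4 * pi^2\<close> and taking the root undoes the
    normalisation of the energy.\<close>
  then have "((\<lambda>t. sqrt ((4 * pi\<^sup>2) * ((Hnorm (v1 t - v2 t))\<^sup>2 / (4 * pi\<^sup>2)))) \<longlongrightarrow> sqrt ((4 * pi\<^sup>2) * 0)) at_top"
    by (intro tendsto_intros)
  then show ?thesis by simp
qed

end
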